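(* Let $M$ be a compact symplectic manifold equipped with a Hamiltonian action of a compact torus $T$, let $Q\subset T$ be a circle, and let $\Phi:M\to\mathbb{R}$ be the moment map of the $Q$-action (where $\mathfrak{q}^*$ is identified with $\mathbb{R}$). If $0$ is a regular value of $\Phi$, then the kernel of the restriction map $\kappa^A:\mathcal{A}_T(M)\to\mathcal{A}_T(\Phi^{-1}(0))$ is equal to the direct sum $\mathcal{K}^+\oplus\mathcal{K}^-$, where $\mathcal{K}^+$ (respectively $\mathcal{K}^-$) consists of all $A\in\mathcal{A}_T(M)$ with the property that $A(F)=0$ for all connected components $F$ of $M^T$ with $\Phi(F)>0$ (respectively $\Phi(F)<0$).
   Context: $\mathfrak{t}$ is the Lie algebra of $T$ and $\mathfrak{q}\subset\mathfrak{t}$ that of $Q$; for a point $p$ of a $T$-space, $\mathfrak{t}_p\subset\mathfrak{t}$ is the Lie algebra of the isotropy group $T_p$. For a subspace $\mathfrak{h}\subset\mathfrak{t}$, $S(\mathfrak{h}^* )$ is the algebra of real polynomial functions on $\mathfrak{h}$. A (polynomial) assignment on a $T$-space $X$ is a map $A$ assigning to each $p\in X$ a polynomial $A(p)\in S(\mathfrak{t}_p^* )$ such that for every (connected) subtorus $H\subset T$ with Lie algebra $\mathfrak{h}$, the map $p\mapsto A(p)|_{\mathfrak{h}}$ is locally constant on the fixed point set $X^H$. $\mathcal{A}_T(X)$ denotes the set of all assignments, an $S(\mathfrak{t}^* )$-algebra with pointwise operations ($\mathcal{A}_T(\emptyset)=\{0\}$). For a $T$-invariant subspace $Y\subset X$,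 the restriction map $\mathcal{A}_T(X)\to\mathcal{A}_T(Y)$ sends $A$ to $A|_Y$. A circle $Q\subset T$ is a one-dimensional subtorus; the identification $\mathfrak{q}^*=\mathfrak{q}=\mathbb{R}$ is made by means of an inner product on $\mathfrak{t}$. For a connected component $F$ of $M^T$, both $A$ and $\Phi$ are constant on $F$; $A(F)\in S(\mathfrak{t}^* )$ and $\Phi(F)\in\mathbb{R}$ denote the constant values. *)

theory Defs
  imports "HOL-Analysis.Analysis" "HOL-Algebra.Group_Action" "HOL-Algebra.AbelCoset"
    "HOL-Algebra.Module"
begin

section \<open>Smooth maps on relatively open subsets of a linear subspace\<close>

text \<open>
  The intended \<open>S\<close> is relatively open in a linear subspace \<open>E\<close> of the ambient space. There
  the derivative within \<open>S\<close> is determined on \<open>E\<close> and arbitrary off \<open>E\<close>; since it can be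
  precomposed with a projection onto \<open>E\<close>, letting \<open>v\<close> range over the whole
  ambient space imposes no additional condition. Working in a subspace allows
  manifolds of every dimension, including \<open>0\<close>, which the class \<open>euclidean_space\<close> excludes.
\<close>

primrec Ck_on :: "nat \<Rightarrow> 'a::real_normed_vector set \<Rightarrow> ('a \<Rightarrow> 'b::real_normed_vector) \<Rightarrow> bool" where
  "Ck_on 0 S f \<longleftrightarrow> continuous_on S f"
| "Ck_on (Suc k) S f \<longleftrightarrow>
     (\<exists>f'. (\<forall>x\<in>S. (f has_derivative f' x) (at x within S)) \<and> (\<forall>v. Ck_on k S (\<lambda>x. f' x v)))"

definition smooth_on :: "'a::real_normed_vector set \<Rightarrow> ('a \<Rightarrow> 'b::real_normed_vector) \<Rightarrow> bool" where
  "smooth_on S f \<longleftrightarrow> (\<forall>k. Ck_on k S f)"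

definition dir_deriv :: "('a::real_normed_vector \<Rightarrow> 'b::real_normed_vector) \<Rightarrow> 'a \<Rightarrow> 'a \<Rightarrow> 'b" where
  "dir_deriv f x v = vector_derivative (\<lambda>s. f (x + s *\<^sub>R v)) (at 0)"


section \<open>Smooth manifolds\<close>

type_synonym ('m, 'e) chart = "'m set \<times> ('m \<Rightarrow> 'e)"

abbreviation chart_dom :: "('m, 'e) chart \<Rightarrow> 'm set" where "chart_dom \<equiv> fst"
abbreviation chart_map :: "('m, 'e) chart \<Rightarrow> 'm \<Rightarrow> 'e" where "chart_map \<equiv> snd"

definition chart_img :: "('m, 'e) chart \<Rightarrow> 'e set" where
  "chart_img c = chart_map c ` chart_dom c"

definition chart_inv :: "('m, 'e) chart \<Rightarrow> 'e \<Rightarrow> 'm" where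
  "chart_inv c = inv_into (chart_dom c) (chart_map c)"

locale smooth_manifold =
  fixes M :: "'m topology"
    and E :: "'e::euclidean_space set"
    and \<A> :: "('m, 'e) chart set"
  assumes hausdorff: "Hausdorff_space M"
    and second_countable: "second_countable M"
    and model_subspace: "subspace E"
    and dom_open: "c \<in> \<A> \<Longrightarrow> openin M (chart_dom c)"
    and img_open: "c \<in> \<A> \<Longrightarrow> openin (top_of_set E) (chart_img c)"
    and chart_homeo: "c \<in> \<A> \<Longrightarrow>
      homeomorphic_map (subtopology M (chart_dom c)) (top_of_set (chart_img c)) (chart_map c)"
    and charts_cover: "(\<Union>c\<in>\<A>. chart_dom c) = topspace M"
    and charts_compatible: "\<lbrakk>c \<in> \<A>; d \<in> \<A>\<rbrakk> \<Longrightarrow>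
      smooth_on (chart_map c ` (chart_dom c \<inter> chart_dom d)) (chart_map d \<circ> chart_inv c)"

text \<open>
  A tangent vector at \<open>p\<close> is represented by its coordinates \<open>v \<in> E\<close> in a chart around \<open>p\<close>.
  The next two definitions are the coordinate expressions of the differential at \<open>p\<close> of a map
  \<open>f\<close> from the manifold to itself (in charts \<open>c\<close> around \<open>p\<close> and \<open>d\<close> around \<open>f p\<close>; for \<open>f = id\<close>
  this is the change of coordinates) and of a real function.
\<close>

definition tangent_map ::
  "('m, 'e::euclidean_space) chart \<Rightarrow> ('m, 'e) chart \<Rightarrow> ('m \<Rightarrow> 'm) \<Rightarrow> 'm \<Rightarrow> 'e \<Rightarrow> 'e" where
  "tangent_map c d f p v = dir_deriv (chart_map d \<circ> f \<circ> chart_inv c) (chart_map c p) v"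

definition differential ::
  "('m, 'e::euclidean_space) chart \<Rightarrow> ('m \<Rightarrow> real) \<Rightarrow> 'm \<Rightarrow> 'e \<Rightarrow> real" where
  "differential c f p v = dir_deriv (f \<circ> chart_inv c) (chart_map c p) v"

definition smooth_function :: "('m, 'e::euclidean_space) chart set \<Rightarrow> ('m \<Rightarrow> real) \<Rightarrow> bool" where
  "smooth_function \<A> f \<longleftrightarrow> (\<forall>c\<in>\<A>. smooth_on (chart_img c) (f \<circ> chart_inv c))"

definition regular_value ::
  "'m topology \<Rightarrow> 'e::euclidean_space set \<Rightarrow> ('m, 'e) chart set \<Rightarrow> ('m \<Rightarrow> real) \<Rightarrow> real \<Rightarrow> bool" where
  "regular_value M E \<A> f a \<longleftrightarrow>
     (\<forall>p\<in>topspace M. f p = a \<longrightarrow>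
        (\<forall>c\<in>\<A>. p \<in> chart_dom c \<longrightarrow> differential c f p ` E = UNIV))"


section \<open>Symplectic manifolds\<close>

text \<open>
  A differential 2-form is given by its coordinate expressions: \<open>\<omega> c p u v\<close> is the value at \<open>p\<close>
  on the tangent vectors with coordinates \<open>u, v \<in> E\<close> in the chart \<open>c\<close>. Values for \<open>u, v\<close> outside
  \<open>E\<close> are irrelevant; any bilinear form on \<open>E\<close> extends to a bilinear form on the ambient space.
  In \<open>closed_form\<close> the cyclic sum is \<open>d\<omega>\<close> evaluated on the constant coordinate vector fields
  \<open>u, v, w\<close>.
\<close>

type_synonym ('m, 'e) form2 = "('m, 'e) chart \<Rightarrow> 'm \<Rightarrow> 'e \<Rightarrow> 'e \<Rightarrow> real"

locale symplectic_manifold = smooth_manifold M E \<A>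
  for M :: "'m topology" and E :: "'e::euclidean_space set" and \<A> :: "('m, 'e) chart set" +
  fixes \<omega> :: "('m, 'e) form2"
  assumes form_bilinear: "\<lbrakk>c \<in> \<A>; p \<in> chart_dom c\<rbrakk> \<Longrightarrow> bilinear (\<omega> c p)"
    and form_alternating: "\<lbrakk>c \<in> \<A>; p \<in> chart_dom c; u \<in> E\<rbrakk> \<Longrightarrow> \<omega> c p u u = 0"
    and form_compatible: "\<lbrakk>c \<in> \<A>; d \<in> \<A>; p \<in> chart_dom c; p \<in> chart_dom d; u \<in> E; v \<in> E\<rbrakk> \<Longrightarrow>
      \<omega> d p (tangent_map c d id p u) (tangent_map c d id p v) = \<omega> c p u v"
    and form_smooth: "\<lbrakk>c \<in> \<A>; u \<in> E; v \<in> E\<rbrakk> \<Longrightarrow>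
      smooth_on (chart_img c) (\<lambda>x. \<omega> c (chart_inv c x) u v)"
    and closed_form: "\<lbrakk>c \<in> \<A>; x \<in> chart_img c; u \<in> E; v \<in> E; w \<in> E\<rbrakk> \<Longrightarrow>
        dir_deriv (\<lambda>y. \<omega> c (chart_inv c y) v w) x u
      + dir_deriv (\<lambda>y. \<omega> c (chart_inv c y) w u) x v
      + dir_deriv (\<lambda>y. \<omega> c (chart_inv c y) u v) x w = 0"
    and form_nondegenerate: "\<lbrakk>c \<in> \<A>; p \<in> chart_dom c; u \<in> E; \<And>v. v \<in> E \<Longrightarrow> \<omega> c p u v = 0\<rbrakk> \<Longrightarrow>
      u = 0"


section \<open>Tori\<close>

text \<open>The torus \<open>(S\<^sup>1)\<^sup>n\<close> with \<open>n = CARD('n)\<close>; its Lie algebra is \<open>real^'n\<close>.\<close>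

definition torus :: "(complex^'n) monoid" where
  "torus = \<lparr>carrier = {z. \<forall>i. norm (z $ i) = 1}, mult = (*), one = 1\<rparr>"

definition torus_exp :: "real^'n \<Rightarrow> complex^'n" where
  "torus_exp x = (\<chi> i. cis (x $ i))"

definition lie_algebra :: "(complex^'n) set \<Rightarrow> (real^'n) set" where
  "lie_algebra H = {\<xi>. \<forall>s. torus_exp (s *\<^sub>R \<xi>) \<in> H}"

definition subtorus :: "(complex^'n) set \<Rightarrow> bool" where
  "subtorus H \<longleftrightarrow> subgroup H torus \<and> closed H \<and> connected H"

definition circle_subgroup :: "(complex^'n) set \<Rightarrow> bool" where
  "circle_subgroup Q \<longleftrightarrow> subtorus Q \<and> dim (lie_algebra Q) = 1"

definition inner_product :: "('v::real_vector \<Rightarrow> 'v \<Rightarrow> real) \<Rightarrow> bool" where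
  "inner_product g \<longleftrightarrow>
     bilinear g \<and> (\<forall>x y. g x y = g y x) \<and> (\<forall>x. x \<noteq> 0 \<longrightarrow> g x x > 0)"


section \<open>Hamiltonian torus actions\<close>

text \<open>
  As \<open>torus_exp\<close> is a local diffeomorphism onto the torus, the action is smooth iff
  its pullback to \<open>real^'n\<close> times the manifold is.
\<close>

definition smooth_torus_action ::
  "'m topology \<Rightarrow> ('m, 'e::euclidean_space) chart set \<Rightarrow> (complex^'n \<Rightarrow> 'm \<Rightarrow> 'm) \<Rightarrow> bool" where
  "smooth_torus_action M \<A> \<rho> \<longleftrightarrow>
     group_action torus (topspace M) \<rho> \<and>
     continuous_map (prod_topology (top_of_set (carrier torus)) M) M (\<lambda>(g, p). \<rho> g p) \<and>
     (\<forall>c\<in>\<A>. \<forall>d\<in>\<A>.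
        smooth_on {(\<xi>, x). x \<in> chart_img c \<and> \<rho> (torus_exp \<xi>) (chart_inv c x) \<in> chart_dom d}
          (\<lambda>(\<xi>, x). chart_map d (\<rho> (torus_exp \<xi>) (chart_inv c x))))"

text \<open>The coordinates in \<open>c\<close> of the value at \<open>p\<close> of the vector field generated by \<open>\<xi>\<close>.\<close>

definition generating_field ::
  "(complex^'n \<Rightarrow> 'm \<Rightarrow> 'm) \<Rightarrow> ('m, 'e::euclidean_space) chart \<Rightarrow> real^'n \<Rightarrow> 'm \<Rightarrow> 'e" where
  "generating_field \<rho> c \<xi> p = vector_derivative (\<lambda>s. chart_map c (\<rho> (torus_exp (s *\<^sub>R \<xi>)) p)) (at 0)"

definition symplectic_action ::
  "'e::euclidean_space set \<Rightarrow> ('m, 'e) chart set \<Rightarrow> ('m, 'e) form2 \<Rightarrow>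
     (complex^'n \<Rightarrow> 'm \<Rightarrow> 'm) \<Rightarrow> bool" where
  "symplectic_action E \<A> \<omega> \<rho> \<longleftrightarrow>
     (\<forall>g\<in>carrier torus. \<forall>c\<in>\<A>. \<forall>d\<in>\<A>. \<forall>p\<in>chart_dom c. \<rho> g p \<in> chart_dom d \<longrightarrow>
        (\<forall>u\<in>E. \<forall>v\<in>E.
           \<omega> d (\<rho> g p) (tangent_map c d (\<rho> g) p u) (tangent_map c d (\<rho> g) p v) = \<omega> c p u v))"

text \<open>
  \<open>\<Psi> p\<close> is an element of the dual of the Lie algebra of \<open>H\<close>, given by its values on that Lie
  algebra. The coadjoint action of a torus is trivial, so equivariance is invariance.
\<close>

definition moment_map ::
  "'m topology \<Rightarrow> 'e::euclidean_space set \<Rightarrow> ('m, 'e) chart set \<Rightarrow> ('m, 'e) form2 \<Rightarrow>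
     (complex^'n \<Rightarrow> 'm \<Rightarrow> 'm) \<Rightarrow> (complex^'n) set \<Rightarrow> ('m \<Rightarrow> real^'n \<Rightarrow> real) \<Rightarrow> bool" where
  "moment_map M E \<A> \<omega> \<rho> H \<Psi> \<longleftrightarrow>
     (\<forall>p\<in>topspace M. \<exists>L. linear L \<and> (\<forall>\<xi>\<in>lie_algebra H. \<Psi> p \<xi> = L \<xi>)) \<and>
     (\<forall>h\<in>H. \<forall>p\<in>topspace M. \<forall>\<xi>\<in>lie_algebra H. \<Psi> (\<rho> h p) \<xi> = \<Psi> p \<xi>) \<and>
     (\<forall>\<xi>\<in>lie_algebra H. smooth_function \<A> (\<lambda>p. \<Psi> p \<xi>) \<and>
        (\<forall>c\<in>\<A>. \<forall>p\<in>chart_dom c. \<forall>v\<in>E.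
           differential c (\<lambda>p. \<Psi> p \<xi>) p v = \<omega> c p (generating_field \<rho> c \<xi> p) v))"

definition hamiltonian_torus_action ::
  "'m topology \<Rightarrow> 'e::euclidean_space set \<Rightarrow> ('m, 'e) chart set \<Rightarrow> ('m, 'e) form2 \<Rightarrow>
     (complex^'n \<Rightarrow> 'm \<Rightarrow> 'm) \<Rightarrow> bool" where
  "hamiltonian_torus_action M E \<A> \<omega> \<rho> \<longleftrightarrow>
     smooth_torus_action M \<A> \<rho> \<and> symplectic_action E \<A> \<omega> \<rho> \<and>
     (\<exists>\<mu>. moment_map M E \<A> \<omega> \<rho> (carrier torus) \<mu>)"

text \<open>
  An inner product \<open>g\<close> on the Lie algebra of the torus and a unit vector \<open>\<eta>\<close> spanning the Lie
  algebra of the circle \<open>Q\<close> identify a real number \<open>r\<close> with the linear form \<open>\<xi> \<mapsto> r * g \<eta> \<xi>\<close>.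
\<close>

definition circle_moment_map ::
  "'m topology \<Rightarrow> 'e::euclidean_space set \<Rightarrow> ('m, 'e) chart set \<Rightarrow> ('m, 'e) form2 \<Rightarrow>
     (complex^'n \<Rightarrow> 'm \<Rightarrow> 'm) \<Rightarrow> (complex^'n) set \<Rightarrow>
     (real^'n \<Rightarrow> real^'n \<Rightarrow> real) \<Rightarrow> real^'n \<Rightarrow> ('m \<Rightarrow> real) \<Rightarrow> bool" where
  "circle_moment_map M E \<A> \<omega> \<rho> Q g \<eta> \<Phi> \<longleftrightarrow>
     \<eta> \<in> lie_algebra Q \<and> g \<eta> \<eta> = 1 \<and>
     moment_map M E \<A> \<omega> \<rho> Q (\<lambda>p \<xi>. \<Phi> p * g \<eta> \<xi>)"


section \<open>Assignments\<close>

text \<open>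
  \<open>sym_algebra \<h>\<close> is the algebra of real polynomial functions on the subspace \<open>\<h>\<close>, each
  represented by an extensional function on \<open>\<h>\<close>.
\<close>

definition sym_algebra :: "(real^'n) set \<Rightarrow> (real^'n \<Rightarrow> real) ring" where
  "sym_algebra \<h> =
     \<lparr>carrier = {restrict f \<h> | f. real_polynomial_function f},
      mult = (\<lambda>f g. \<lambda>\<xi>\<in>\<h>. f \<xi> * g \<xi>),
      one = (\<lambda>\<xi>\<in>\<h>. 1),
      zero = (\<lambda>\<xi>\<in>\<h>. 0),
      add = (\<lambda>f g. \<lambda>\<xi>\<in>\<h>. f \<xi> + g \<xi>)\<rparr>"

definition isotropy_algebra :: "(complex^'n \<Rightarrow> 'm \<Rightarrow> 'm) \<Rightarrow> 'm \<Rightarrow> (real^'n) set" where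
  "isotropy_algebra \<rho> p = lie_algebra (stabilizer torus \<rho> p)"

definition fixed_points :: "(complex^'n \<Rightarrow> 'm \<Rightarrow> 'm) \<Rightarrow> 'm topology \<Rightarrow> (complex^'n) set \<Rightarrow> 'm set" where
  "fixed_points \<rho> X H = {p \<in> topspace X. \<forall>h\<in>H. \<rho> h p = p}"

definition locally_constant_on :: "'m topology \<Rightarrow> 'm set \<Rightarrow> ('m \<Rightarrow> 'b) \<Rightarrow> bool" where
  "locally_constant_on X S f \<longleftrightarrow>
     (\<forall>p\<in>S. \<exists>U. openin (subtopology X S) U \<and> p \<in> U \<and> (\<forall>q\<in>U. f q = f p))"

definition assignments ::
  "(complex^'n \<Rightarrow> 'm \<Rightarrow> 'm) \<Rightarrow> 'm topology \<Rightarrow> ('m \<Rightarrow> real^'n \<Rightarrow> real) set" where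
  "assignments \<rho> X =
     {A \<in> (\<Pi>\<^sub>E p\<in>topspace X. carrier (sym_algebra (isotropy_algebra \<rho> p))).
        \<forall>H. subtorus H \<longrightarrow>
          locally_constant_on X (fixed_points \<rho> X H) (\<lambda>p. restrict (A p) (lie_algebra H))}"

definition assignment_algebra ::
  "(complex^'n \<Rightarrow> 'm \<Rightarrow> 'm) \<Rightarrow> 'm topology \<Rightarrow>
     (real^'n \<Rightarrow> real, 'm \<Rightarrow> real^'n \<Rightarrow> real) module" where
  "assignment_algebra \<rho> X =
     \<lparr>carrier = assignments \<rho> X,
      mult = (\<lambda>A B. \<lambda>p\<in>topspace X. A p \<otimes>\<^bsub>sym_algebra (isotropy_algebra \<rho> p)\<^esub> B p),
      one = (\<lambda>p\<in>topspace X. \<one>\<^bsub>sym_algebra (isotropy_algebra \<rho> p)\<^esub>),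
      zero = (\<lambda>p\<in>topspace X. \<zero>\<^bsub>sym_algebra (isotropy_algebra \<rho> p)\<^esub>),
      add = (\<lambda>A B. \<lambda>p\<in>topspace X. A p \<oplus>\<^bsub>sym_algebra (isotropy_algebra \<rho> p)\<^esub> B p),
      smult = (\<lambda>f A. \<lambda>p\<in>topspace X.
        restrict f (isotropy_algebra \<rho> p) \<otimes>\<^bsub>sym_algebra (isotropy_algebra \<rho> p)\<^esub> A p)\<rparr>"

definition assignment_restriction ::
  "'m set \<Rightarrow> ('m \<Rightarrow> real^'n \<Rightarrow> real) \<Rightarrow> 'm \<Rightarrow> real^'n \<Rightarrow> real" where
  "assignment_restriction Y A = restrict A Y"

definition zero_level :: "'m topology \<Rightarrow> ('m \<Rightarrow> real) \<Rightarrow> 'm set" where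
  "zero_level M \<Phi> = {p \<in> topspace M. \<Phi> p = 0}"

text \<open>For a function constant on \<open>F\<close>, \<open>value_on f F\<close> is the constant value.\<close>

definition value_on :: "('m \<Rightarrow> 'b) \<Rightarrow> 'm set \<Rightarrow> 'b" where
  "value_on f F = the_elem (f ` F)"

definition fixed_components :: "(complex^'n \<Rightarrow> 'm \<Rightarrow> 'm) \<Rightarrow> 'm topology \<Rightarrow> 'm set set" where
  "fixed_components \<rho> M =
     connected_components_of (subtopology M (fixed_points \<rho> M (carrier torus)))"

definition K_plus ::
  "(complex^'n \<Rightarrow> 'm \<Rightarrow> 'm) \<Rightarrow> 'm topology \<Rightarrow> ('m \<Rightarrow> real) \<Rightarrow> ('m \<Rightarrow> real^'n \<Rightarrow> real) set" where
  "K_plus \<rho> M \<Phi> = {A \<in> assignments \<rho> M.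
     \<forall>F\<in>fixed_components \<rho> M. value_on \<Phi> F > 0 \<longrightarrow> value_on A F = \<zero>\<^bsub>sym_algebra UNIV\<^esub>}"

definition K_minus ::
  "(complex^'n \<Rightarrow> 'm \<Rightarrow> 'm) \<Rightarrow> 'm topology \<Rightarrow> ('m \<Rightarrow> real) \<Rightarrow> ('m \<Rightarrow> real^'n \<Rightarrow> real) set" where
  "K_minus \<rho> M \<Phi> = {A \<in> assignments \<rho> M.
     \<forall>F\<in>fixed_components \<rho> M. value_on \<Phi> F < 0 \<longrightarrow> value_on A F = \<zero>\<^bsub>sym_algebra UNIV\<^esub>}"

definition internal_direct_sum ::
  "('a, 'r) ring_scheme \<Rightarrow> ('a, 'b, 'v) module_scheme \<Rightarrow> 'b set \<Rightarrow> 'b set \<Rightarrow> 'b set \<Rightarrow> bool" where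
  "internal_direct_sum R V K K1 K2 \<longleftrightarrow>
     submodule K1 R V \<and> submodule K2 R V \<and> K1 \<inter> K2 = {\<zero>\<^bsub>V\<^esub>} \<and> K = set_add V K1 K2"

end

theory Submission
  imports Defs
begin

text \<open>
  Two facts carry the proof.

  First, an assignment that vanishes on the zero level \<open>Z\<close> of \<open>\<Phi>\<close> can be cut along \<open>Z\<close>: set it to
  zero where \<open>\<Phi> \<ge> 0\<close>, or set it to zero where \<open>\<Phi> \<le> 0\<close>. Both pieces are again assignments. Only
  local constancy on the fixed point set \<open>M\<^sup>H\<close> of a subtorus at a point \<open>p \<in> Z\<close> is in question, and
  there \<open>A(p) = 0\<close>, so the restriction of \<open>A\<close> to the Lie algebra of \<open>H\<close> vanishes near \<open>p\<close> in \<open>M\<^sup>H\<close>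
  (\<open>cut_assignment\<close>). This gives one inclusion, \<open>ker \<subseteq> K\<^sup>+ + K\<^sup>-\<close>.

  Second, the values at \<open>T\<close>-fixed points control an assignment. Let \<open>p \<in> M\<close> and let \<open>H\<close> be the
  identity component of the stabilizer of \<open>p\<close>. The points \<open>q \<in> M\<^sup>H\<close> at which \<open>A\<close> has the same
  restriction to the Lie algebra of \<open>H\<close> as at \<open>p\<close> form a compact set \<open>X\<close> which is open in \<open>M\<^sup>H\<close>.
  Choose a direction \<open>\<xi>\<close> near \<open>\<eta>\<close> whose one-parameter group is dense in the torus, and maximise the
  \<open>\<xi>\<close>-component of the moment map on \<open>X\<close>. A maximum on an open part of \<open>M\<^sup>H\<close> is a critical point on all
  of \<open>M\<close>; there the generating vector field of \<open>\<xi>\<close> is zero, and by density the point is fixed by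
  the torus. So \<open>A(p)\<close> is the restriction of the value of \<open>A\<close> at a \<open>T\<close>-fixed point \<open>q\<close>, and
  \<open>\<Phi>(q) > \<Phi>(p) - \<epsilon>\<close> if \<open>\<xi>\<close> is close to \<open>\<eta>\<close>
  (\<open>exists_torus_fixed_point_nearly_above\<close>). If \<open>p\<close> is not critical for \<open>\<Phi>\<close>, one can first move inside
  \<open>X\<close> to a point with a larger value of \<open>\<Phi>\<close>, which yields \<open>\<Phi>(q) > \<Phi>(p)\<close>
  (\<open>exists_torus_fixed_point_above\<close>). As \<open>0\<close> is a regular value, this applies at all points of \<open>Z\<close>
  and shows \<open>K\<^sup>+ \<subseteq> ker\<close>, and \<open>K\<^sup>- \<subseteq> ker\<close> by passing to \<open>-\<Phi>\<close>. Moreover no \<open>T\<close>-fixed point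
  lies on \<open>Z\<close>, so an element of \<open>K\<^sup>+ \<inter> K\<^sup>-\<close> vanishes at all \<open>T\<close>-fixed points and hence everywhere.

  The differential-geometric input is the behaviour of smooth functions near a point \<open>q\<close> of \<open>M\<^sup>H\<close>:
  an invariant function that is not critical at \<open>q\<close> takes larger values at points of \<open>M\<^sup>H\<close>
  arbitrarily close to \<open>q\<close>, and a function with zero differential along \<open>M\<^sup>H\<close> is locally constant on
  it. The usual proof linearises the action by averaging over \<open>H\<close>. Here fixed points are produced
  directly, as unique minimisers: in a chart, the penalty \<open>D(y) = sup {|h y - c|\<^sup>2 | h \<in> H}\<close> is
  \<open>H\<close>-invariant and, because the action is \<open>C\<^sup>2\<close>, strongly convex near \<open>c\<close>. So \<open>f + K D\<close> has a unique
  minimiser for every invariant \<open>C\<^sup>2\<close> function \<open>f\<close> and large \<open>K\<close>, and a unique minimiser of an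
  invariant function is a fixed point (\<open>fixed_point_of_penalized_minimum\<close>). Suprema and midpoint
  inequalities replace invariant integration and second derivatives.
\<close>

section \<open>Uniform estimates for maps with continuous derivatives\<close>

lemma linear_map_bounded_on_Basis:
  fixes A :: "'a::euclidean_space \<Rightarrow> 'b::real_normed_vector"
  assumes "linear A" and B: "\<And>b. b \<in> Basis \<Longrightarrow> norm (A b) \<le> B b"
  shows "norm (A v) \<le> (\<Sum>b\<in>Basis. B b) * norm v"
proof -
  have "A v = A (\<Sum>b\<in>Basis. (v \<bullet> b) *\<^sub>R b)"
    by (simp add: euclidean_representation)
  also have "\<dots> = (\<Sum>b\<in>Basis. (v \<bullet> b) *\<^sub>R A b)"
    by (simp add: linear_sum[OF assms(1)] linear_scale[OF assms(1)])
  finally have "norm (A v) \<le> (\<Sum>b\<in>Basis. norm ((v \<bullet> b) *\<^sub>R A b))"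
    using norm_sum by metis
  also have "\<dots> \<le> (\<Sum>b\<in>Basis. norm v * B b)"
    by (intro sum_mono) (simp add: Basis_le_norm B mult_mono)
  finally show ?thesis by (simp add: sum_distrib_left mult.commute)
qed

text \<open>
  One constant serves all segments in the compact set \<open>Z\<close>. For a family of maps depending on a
  compact parameter, \<open>Z\<close> is a product and the segments lie in its fibres; this is how bounds uniform
  over a group are obtained.
\<close>
lemma C1_imp_lipschitz_on_segments:
  fixes f :: "'a::euclidean_space \<Rightarrow> 'b::real_normed_vector"
  assumes "Ck_on (Suc 0) S f" "compact Z" "Z \<subseteq> S"
  obtains L where "L > 0"
    "\<And>x y. closed_segment x y \<subseteq> Z \<Longrightarrow> norm (f x - f y) \<le> L * norm (x - y)"
proof -
  obtain f' where f': "\<And>x. x \<in> S \<Longrightarrow> (f has_derivative f' x) (at x within S)"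
    and cont: "\<And>v. continuous_on S (\<lambda>x. f' x v)"
    using assms(1) by auto
  have "\<exists>B. \<forall>x\<in>Z. norm (f' x b) \<le> B" for b
  proof -
    have "compact ((\<lambda>x. f' x b) ` Z)"
      by (rule compact_continuous_image[OF continuous_on_subset[OF cont assms(3)] assms(2)])
    from compact_imp_bounded[OF this] show ?thesis
      by (simp add: bounded_iff)
  qed
  then obtain B where B: "\<And>b x. x \<in> Z \<Longrightarrow> norm (f' x b) \<le> B b" by metis
  define L where "L = 1 + \<bar>\<Sum>b\<in>Basis. B b\<bar>"
  have Lpos: "L > 0" unfolding L_def by simp
  have onorm_le: "onorm (f' x) \<le> L" if x: "x \<in> Z" for x
  proof (rule onorm_le)
    fix v
    have "linear (f' x)" using f'[of x] x assms(3) has_derivative_linear by blast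
    then have "norm (f' x v) \<le> (\<Sum>b\<in>Basis. B b) * norm v"
      using B[OF x] by (rule linear_map_bounded_on_Basis)
    also have "\<dots> \<le> L * norm v" unfolding L_def by (intro mult_right_mono) auto
    finally show "norm (f' x v) \<le> L * norm v" .
  qed
  have "norm (f x - f y) \<le> L * norm (x - y)" if seg: "closed_segment x y \<subseteq> Z" for x y
  proof (rule differentiable_bound[of "closed_segment x y" f f'])
    show "(f has_derivative f' z) (at z within closed_segment x y)"
      if "z \<in> closed_segment x y" for z
      using f'[of z] seg assms(3) that by (meson has_derivative_subset subsetD subset_trans)
    show "onorm (f' z) \<le> L" if "z \<in> closed_segment x y" for z
      using onorm_le seg that by blast
  qed auto
  with Lpos show ?thesis by (rule that)
qed

lemma C2_imp_taylor_estimate_on_segments: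
  fixes f :: "'a::euclidean_space \<Rightarrow> 'b::real_normed_vector"
  assumes "Ck_on (Suc (Suc 0)) S f" "compact Z" "Z \<subseteq> S"
  obtains f' C where "C > 0" "\<And>x. x \<in> S \<Longrightarrow> (f has_derivative f' x) (at x within S)"
    "\<And>x y. closed_segment x y \<subseteq> Z \<Longrightarrow>
       norm (f y - f x - f' x (y - x)) \<le> C * (norm (x - y))\<^sup>2"
proof -
  obtain f' where f': "\<And>x. x \<in> S \<Longrightarrow> (f has_derivative f' x) (at x within S)"
    and C1: "\<And>v. Ck_on (Suc 0) S (\<lambda>x. f' x v)"
    using assms(1) by (auto simp del: Ck_on.simps(2) simp: Ck_on.simps(2)[of "Suc 0"])
  have "\<exists>L>0. \<forall>x y. closed_segment x y \<subseteq> Z \<longrightarrow> norm (f' x b - f' y b) \<le> L * norm (x - y)" for b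
    using C1_imp_lipschitz_on_segments[OF C1[of b] assms(2,3)] by metis
  then obtain L where Lpos: "\<And>b. L b > 0" and
    L: "\<And>b x y. closed_segment x y \<subseteq> Z \<Longrightarrow> norm (f' x b - f' y b) \<le> L b * norm (x - y)"
    by metis
  define C where "C = 1 + (\<Sum>b\<in>Basis. L b)"
  have Cpos: "C > 0"
    unfolding C_def using Lpos by (smt (verit) sum_nonneg less_eq_real_def)
  have f'_lip: "onorm (\<lambda>w. f' x w - f' y w) \<le> C * norm (x - y)"
    if seg: "closed_segment x y \<subseteq> Z" for x y
  proof (rule onorm_le)
    fix w
    have "x \<in> S" "y \<in> S" using seg assms(3) by auto
    then have "linear (\<lambda>w. f' x w - f' y w)"
      using f' has_derivative_linear by (blast intro: linear_compose_sub)
    from linear_map_bounded_on_Basis[OF this L[OF seg]]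
    have "norm (f' x w - f' y w) \<le> (\<Sum>b\<in>Basis. L b * norm (x - y)) * norm w" .
    also have "\<dots> = (\<Sum>b\<in>Basis. L b) * norm (x - y) * norm w"
      by (simp add: sum_distrib_right)
    also have "\<dots> \<le> C * norm (x - y) * norm w"
      unfolding C_def by (intro mult_right_mono) auto
    finally show "norm (f' x w - f' y w) \<le> C * norm (x - y) * norm w" .
  qed
  have "norm (f y - f x - f' x (y - x)) \<le> C * (norm (x - y))\<^sup>2"
    if seg: "closed_segment x y \<subseteq> Z" for x y
  proof -
    have "norm (f y - f x - f' x (y - x)) \<le> norm (y - x) * (C * norm (x - y))"
    proof (rule differentiable_bound_linearization[of x y "closed_segment x y" f f'])
      show "x + t *\<^sub>R (y - x) \<in> closed_segment x y" if "t \<in> {0..1}" for t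
        using that by (auto simp: in_segment algebra_simps)
      show "(f has_derivative f' z) (at z within closed_segment x y)"
        if "z \<in> closed_segment x y" for z
        using f'[of z] seg assms(3) that by (meson has_derivative_subset subsetD subset_trans)
      show "onorm (f' z - f' x) \<le> C * norm (x - y)" if z: "z \<in> closed_segment x y" for z
      proof -
        have "closed_segment z x \<subseteq> Z"
          using seg z subset_closed_segment by (metis ends_in_segment(1) subset_trans)
        from f'_lip[OF this] have "onorm (f' z - f' x) \<le> C * norm (z - x)"
          by (simp add: fun_diff_def)
        also have "\<dots> \<le> C * norm (x - y)"
          using segment_bound(1)[OF z] Cpos by (simp add: norm_minus_commute)
        finally show ?thesis .
      qed
    qed simp
    then show ?thesis by (simp add: norm_minus_commute power2_eq_square algebra_simps)
  qed
  with Cpos f' show ?thesis by (rule that)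
qed

text \<open>
  Expanding \<open>f\<close> at the midpoint, the linear terms towards the two ends cancel.
\<close>
lemma C2_imp_midpoint_estimate_on_segments:
  fixes f :: "'a::euclidean_space \<Rightarrow> 'b::real_normed_vector"
  assumes "Ck_on (Suc (Suc 0)) S f" "compact Z" "Z \<subseteq> S"
  obtains C where "C > 0"
    "\<And>x y. closed_segment x y \<subseteq> Z \<Longrightarrow>
       norm (f (midpoint x y) - (1/2) *\<^sub>R (f x + f y)) \<le> C * (norm (x - y))\<^sup>2"
proof (rule C2_imp_taylor_estimate_on_segments[OF assms])
  fix f' C
  assume C: "C > 0" and f': "\<And>x. x \<in> S \<Longrightarrow> (f has_derivative f' x) (at x within S)"
    and est: "\<And>x y. closed_segment x y \<subseteq> Z \<Longrightarrow>
       norm (f y - f x - f' x (y - x)) \<le> C * (norm (x - y))\<^sup>2"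
  have "norm (f (midpoint x y) - (1/2) *\<^sub>R (f x + f y)) \<le> C * (norm (x - y))\<^sup>2"
    if seg: "closed_segment x y \<subseteq> Z" for x y
  proof -
    define m where "m = midpoint x y"
    have m: "m \<in> closed_segment x y" by (simp add: m_def)
    then have segs: "closed_segment m x \<subseteq> Z" "closed_segment m y \<subseteq> Z"
      using seg subset_closed_segment by (metis ends_in_segment subset_trans)+
    have "linear (f' m)" using f' m seg assms(3) has_derivative_linear by blast
    moreover have "y - m = - (x - m)"
      by (simp add: m_def midpoint_def algebra_simps flip: scaleR_add_left)
    ultimately have lin: "f' m (y - m) = - f' m (x - m)"
      by (metis linear_neg)
    have norms: "norm (m - x) = norm (x - y) / 2" "norm (m - y) = norm (x - y) / 2"
      using dist_midpoint(3,4)[of x y] by (simp_all add: m_def dist_norm)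
    have "f m - (1/2) *\<^sub>R (f x + f y)
        = - (1/2) *\<^sub>R ((f x - f m - f' m (x - m)) + (f y - f m - f' m (y - m)))"
      by (simp add: lin algebra_simps flip: scaleR_add_left)
    then have "norm (f m - (1/2) *\<^sub>R (f x + f y))
        = (1/2) * norm ((f x - f m - f' m (x - m)) + (f y - f m - f' m (y - m)))"
      by simp
    also have "\<dots> \<le> (1/2) * (C * (norm (m - x))\<^sup>2 + C * (norm (m - y))\<^sup>2)"
      using norm_triangle_mono[OF est[OF segs(1)] est[OF segs(2)]] by simp
    also have "\<dots> \<le> C * (norm (x - y))\<^sup>2"
      using C by (simp add: norms power_divide)
    finally show ?thesis by (simp add: m_def)
  qed
  with C show ?thesis by (rule that)
qed

section \<open>Fixed points as minimisers\<close>

text \<open>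
  The coordinate expression of a group acting near a fixed point, with bounds uniform over the group.
  The maps \<open>\<phi> i\<close> may leave the set \<open>B\<close>, so the group laws are required only for points that stay
  in it. Second derivatives enter through midpoints alone.
\<close>
locale uniformly_C2_local_action =
  fixes I :: "'i set" and \<phi> :: "'i \<Rightarrow> 'e::euclidean_space \<Rightarrow> 'e"
    and E B :: "'e set" and L C :: real
  assumes compact_B: "compact B" and convex_B: "convex B"
    and L_pos: "L > 0" and C_pos: "C > 0"
    and identity: "\<exists>e\<in>I. \<forall>y\<in>B. \<phi> e y = y"
    and composition: "\<lbrakk>i \<in> I; k \<in> I\<rbrakk> \<Longrightarrow> \<exists>j\<in>I. \<forall>y\<in>B. \<phi> i y \<in> B \<longrightarrow> \<phi> k (\<phi> i y) = \<phi> j y"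
    and inverse: "i \<in> I \<Longrightarrow> \<exists>j\<in>I. \<forall>y\<in>B. \<phi> i y \<in> B \<longrightarrow> \<phi> j (\<phi> i y) = y"
    and into_E: "\<lbrakk>i \<in> I; y \<in> B\<rbrakk> \<Longrightarrow> \<phi> i y \<in> E"
    and lipschitz: "\<lbrakk>i \<in> I; x \<in> B; y \<in> B\<rbrakk> \<Longrightarrow> norm (\<phi> i x - \<phi> i y) \<le> L * norm (x - y)"
    and midpoint_estimate: "\<lbrakk>i \<in> I; x \<in> B; y \<in> B\<rbrakk> \<Longrightarrow>
      norm (\<phi> i (midpoint x y) - (1/2) *\<^sub>R (\<phi> i x + \<phi> i y)) \<le> C * (norm (x - y))\<^sup>2"
begin

text \<open>
  The inverse of \<open>\<phi> i\<close> is again one of the maps, hence has the same Lipschitz constant.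
\<close>
lemma expanding:
  assumes "i \<in> I" "x \<in> B" "y \<in> B" "\<phi> i x \<in> B" "\<phi> i y \<in> B"
  shows "norm (x - y) \<le> L * norm (\<phi> i x - \<phi> i y)"
proof -
  obtain j where "j \<in> I" "\<forall>y\<in>B. \<phi> i y \<in> B \<longrightarrow> \<phi> j (\<phi> i y) = y"
    using inverse[OF assms(1)] by blast
  then show ?thesis using lipschitz[of j "\<phi> i x" "\<phi> i y"] assms by auto
qed

lemma midpoint_in_B: "\<lbrakk>x \<in> B; y \<in> B\<rbrakk> \<Longrightarrow> midpoint x y \<in> B"
  using convex_B midpoint_in_closed_segment convex_contains_segment by blast

text \<open>
  The parallelogram law gives a gain of \<open>|\<phi> i x - \<phi> i y|\<^sup>2 / 4\<close>, which is at least \<open>|x - y|\<^sup>2 / (4 L\<^sup>2)\<close>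
  by \<open>expanding\<close>. The failure of \<open>\<phi> i\<close> to be affine costs at most half of that gain when
  \<open>\<delta>\<close> is small.
\<close>
lemma square_distance_midpoint:
  assumes small: "2 * \<delta> * C + 4 * \<delta>\<^sup>2 * C\<^sup>2 \<le> 1 / (8 * L\<^sup>2)"
    and sub: "cball c \<delta> \<inter> E \<subseteq> B"
    and i: "i \<in> I" and x: "x \<in> B" and y: "y \<in> B"
    and dx: "norm (\<phi> i x - c) \<le> \<delta>" and dy: "norm (\<phi> i y - c) \<le> \<delta>"
    and xc: "norm (x - c) \<le> \<delta>" and yc: "norm (y - c) \<le> \<delta>"
  shows "(norm (\<phi> i (midpoint x y) - c))\<^sup>2
     \<le> ((norm (\<phi> i x - c))\<^sup>2 + (norm (\<phi> i y - c))\<^sup>2) / 2 - (norm (x - y))\<^sup>2 / (8 * L\<^sup>2)"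
proof -
  define a b e where "a = \<phi> i x - c" and "b = \<phi> i y - c" and "e = norm (x - y)"
  define h where "h = (1/2) *\<^sub>R (a + b)"
  have \<delta>: "\<delta> \<ge> 0" using dx norm_ge_zero order_trans by blast
  have "\<phi> i x \<in> B" "\<phi> i y \<in> B"
    using sub dx dy into_E[OF i x] into_E[OF i y] by (auto simp: dist_norm norm_minus_commute)
  then have "e \<le> L * norm (a - b)"
    using expanding[OF i x y] by (simp add: a_def b_def e_def)
  then have "e\<^sup>2 \<le> (L * norm (a - b))\<^sup>2"
    by (intro power_mono) (auto simp: e_def)
  then have ab: "e\<^sup>2 / L\<^sup>2 \<le> (norm (a - b))\<^sup>2"
    using L_pos by (simp add: power_mult_distrib divide_le_eq mult.commute)
  have par: "(norm h)\<^sup>2 = ((norm a)\<^sup>2 + (norm b)\<^sup>2) / 2 - (norm (a - b))\<^sup>2 / 4"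
  proof -
    have "norm h = norm (a + b) / 2" by (simp add: h_def)
    then have "(norm h)\<^sup>2 = (norm (a + b))\<^sup>2 / 4" by (simp only: power_divide) simp
    moreover have "(norm (a + b))\<^sup>2 = (norm a)\<^sup>2 + 2 * (a \<bullet> b) + (norm b)\<^sup>2"
      by (simp add: power2_norm_eq_inner inner_add inner_commute)
    moreover have "(norm (a - b))\<^sup>2 = (norm a)\<^sup>2 - 2 * (a \<bullet> b) + (norm b)\<^sup>2"
      by (simp add: power2_norm_eq_inner inner_diff inner_commute)
    ultimately show ?thesis by (simp add: field_simps)
  qed
  have h\<delta>: "norm h \<le> \<delta>"
    using norm_triangle_ineq[of a b] dx dy by (simp add: h_def a_def b_def)
  have e2: "e \<le> 2 * \<delta>"
  proof -
    have "x - y = (x - c) - (y - c)" by simp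
    then have "e \<le> norm (x - c) + norm (y - c)" unfolding e_def by (metis norm_triangle_ineq4)
    then show ?thesis using xc yc by simp
  qed
  have "\<phi> i (midpoint x y) - c = (\<phi> i (midpoint x y) - (1/2) *\<^sub>R (\<phi> i x + \<phi> i y)) + h"
    by (simp add: h_def a_def b_def algebra_simps flip: scaleR_add_left)
  then have "norm (\<phi> i (midpoint x y) - c) \<le> C * e\<^sup>2 + norm h"
    using midpoint_estimate[OF i x y] norm_triangle_ineq unfolding e_def
    by (metis add_mono_thms_linordered_semiring(3) order_trans)
  then have "(norm (\<phi> i (midpoint x y) - c))\<^sup>2 \<le> (C * e\<^sup>2 + norm h)\<^sup>2"
    by (intro power_mono) auto
  also have "\<dots> = (norm h)\<^sup>2 + e\<^sup>2 * (2 * norm h * C + e\<^sup>2 * C\<^sup>2)"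
    by (simp add: power2_eq_square algebra_simps)
  also have "\<dots> \<le> (norm h)\<^sup>2 + e\<^sup>2 * (2 * \<delta> * C + 4 * \<delta>\<^sup>2 * C\<^sup>2)"
  proof -
    have "e\<^sup>2 \<le> (2 * \<delta>)\<^sup>2" using e2 by (intro power_mono) (auto simp: e_def)
    then have "e\<^sup>2 * C\<^sup>2 \<le> 4 * \<delta>\<^sup>2 * C\<^sup>2"
      by (intro mult_right_mono) (auto simp: power_mult_distrib)
    moreover have "2 * norm h * C \<le> 2 * \<delta> * C"
      using h\<delta> C_pos by auto
    ultimately show ?thesis by (intro add_left_mono mult_left_mono) auto
  qed
  also have "\<dots> \<le> (norm h)\<^sup>2 + e\<^sup>2 * (1 / (8 * L\<^sup>2))"
    by (intro add_left_mono mult_left_mono small) auto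
  also have "\<dots> \<le> ((norm a)\<^sup>2 + (norm b)\<^sup>2) / 2 - e\<^sup>2 / (8 * L\<^sup>2)"
    using par ab by simp
  finally show ?thesis by (simp add: a_def b_def e_def)
qed

text \<open>
  Let \<open>R u\<close> be the largest distance from \<open>c\<close> to the orbit of \<open>u\<close>. The function \<open>f + K R\<^sup>2\<close> does not
  increase along orbits and satisfies a strict midpoint inequality on \<open>{u. R u \<le> \<delta>}\<close>, because the
  gain from \<open>R\<^sup>2\<close> outweighs the defect \<open>A\<close> of \<open>f\<close>. Its minimiser is therefore unique, so it is
  fixed by all \<open>\<phi> i\<close>. The conclusion compares its value with that at a prescribed point \<open>y\<close>.
\<close>
lemma fixed_point_of_penalized_minimum:
  assumes \<delta>: "\<delta> > 0"
    and small: "2 * \<delta> * C + 4 * \<delta>\<^sup>2 * C\<^sup>2 \<le> 1 / (8 * L\<^sup>2)"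
    and sub: "cball c \<delta> \<inter> E \<subseteq> B"
    and y: "y \<in> B" and ys: "\<And>i. i \<in> I \<Longrightarrow> norm (\<phi> i y - c) \<le> s" and s: "s \<le> \<delta>"
    and f_cont: "continuous_on B f"
    and f_mid: "\<And>u v. \<lbrakk>u \<in> B; v \<in> B\<rbrakk> \<Longrightarrow>
       f (midpoint u v) \<le> (f u + f v) / 2 + A * (norm (u - v))\<^sup>2"
    and f_inv: "\<And>i u. \<lbrakk>i \<in> I; u \<in> B; \<phi> i u \<in> B\<rbrakk> \<Longrightarrow> f (\<phi> i u) = f u"
    and K: "K > 0" "A < K / (8 * L\<^sup>2)"
  obtains z where "z \<in> B" "\<And>i. i \<in> I \<Longrightarrow> \<phi> i z = z"
    "norm (z - c) \<le> \<delta>" "f z + K * (norm (z - c))\<^sup>2 \<le> f y + K * s\<^sup>2"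
proof -
  obtain e where e: "e \<in> I" "\<And>u. u \<in> B \<Longrightarrow> \<phi> e u = u" using identity by blast
  define R where "R u = (SUP i\<in>I. norm (\<phi> i u - c))" for u
  have bound: "norm (\<phi> i u - c) \<le> L * norm (u - y) + s" if "i \<in> I" "u \<in> B" for i u
  proof -
    have "\<phi> i u - c = (\<phi> i u - \<phi> i y) + (\<phi> i y - c)" by simp
    then have "norm (\<phi> i u - c) \<le> norm (\<phi> i u - \<phi> i y) + norm (\<phi> i y - c)"
      by (metis norm_triangle_ineq)
    then show ?thesis using lipschitz[OF that(1,2) y] ys[OF that(1)] by linarith
  qed
  have R_upper: "norm (\<phi> i u - c) \<le> R u" if "i \<in> I" "u \<in> B" for i u
    unfolding R_def by (rule cSUP_upper[OF that(1)]) (rule bdd_aboveI2, rule bound[OF _ that(2)])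
  have R_least: "R u \<le> t" if "\<And>i. i \<in> I \<Longrightarrow> norm (\<phi> i u - c) \<le> t" for u t
    unfolding R_def by (rule cSUP_least) (use e that in auto)
  have R_center: "norm (u - c) \<le> R u" if "u \<in> B" for u
    using R_upper[OF e(1) that] e(2)[OF that] by simp
  have R_nonneg: "0 \<le> R u" if "u \<in> B" for u
    using R_center[OF that] norm_ge_zero order_trans by blast
  have R_lip: "R u \<le> R v + L * norm (u - v)" if "u \<in> B" "v \<in> B" for u v
  proof (rule R_least)
    fix i assume i: "i \<in> I"
    have "\<phi> i u - c = (\<phi> i v - c) + (\<phi> i u - \<phi> i v)" by simp
    then have "norm (\<phi> i u - c) \<le> norm (\<phi> i v - c) + norm (\<phi> i u - \<phi> i v)"
      by (metis norm_triangle_ineq)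
    then show "norm (\<phi> i u - c) \<le> R v + L * norm (u - v)"
      using lipschitz[OF i that] R_upper[OF i that(2)] by linarith
  qed
  have "L-lipschitz_on B R"
  proof (rule lipschitz_onI)
    show "dist (R u) (R v) \<le> L * dist u v" if "u \<in> B" "v \<in> B" for u v
      using R_lip[OF that] R_lip[OF that(2,1)] by (auto simp: dist_norm norm_minus_commute)
  qed (use L_pos in simp)
  then have R_cont: "continuous_on B R" by (rule lipschitz_on_continuous_on)
  define N where "N = {u \<in> B. R u \<le> \<delta>}"
  have "closed (B \<inter> R -` {..\<delta>})"
    by (rule continuous_closed_preimage[OF R_cont compact_imp_closed[OF compact_B]]) simp
  then have "closed N" by (simp add: N_def vimage_def Int_def)
  then have "compact N"
    using compact_B by (metis (no_types, lifting) N_def compact_Int_closed inf.absorb_iff2 mem_Collect_eq subsetI)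
  moreover have yN: "y \<in> N" using R_least[of y s] ys s y by (auto simp: N_def)
  moreover have "continuous_on N (\<lambda>u. f u + K * (R u)\<^sup>2)"
    by (intro continuous_intros continuous_on_subset[OF f_cont] continuous_on_subset[OF R_cont])
       (auto simp: N_def)
  ultimately obtain z where z: "z \<in> N"
    and min: "\<And>u. u \<in> N \<Longrightarrow> f z + K * (R z)\<^sup>2 \<le> f u + K * (R u)\<^sup>2"
    using continuous_attains_inf[of N "\<lambda>u. f u + K * (R u)\<^sup>2"] by blast
  have zB: "z \<in> B" and z\<delta>: "R z \<le> \<delta>" using z by (auto simp: N_def)
  have fixed: "\<phi> i z = z" if i: "i \<in> I" for i
  proof (rule ccontr)
    assume ne: "\<phi> i z \<noteq> z"
    define x where "x = \<phi> i z"
    have xB: "x \<in> B"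
      using sub R_upper[OF i zB] z\<delta> into_E[OF i zB]
      by (auto simp: x_def dist_norm norm_minus_commute)
    have Rx: "R x \<le> R z"
    proof (rule R_least)
      fix k assume k: "k \<in> I"
      obtain j where "j \<in> I" "\<phi> k x = \<phi> j z"
        using composition[OF i k] zB xB unfolding x_def by blast
      then show "norm (\<phi> k x - c) \<le> R z" using R_upper zB by metis
    qed
    define m where "m = midpoint z x"
    have mB: "m \<in> B" unfolding m_def by (rule midpoint_in_B[OF zB xB])
    define q where "q = ((R z)\<^sup>2 + (R x)\<^sup>2) / 2 - (norm (z - x))\<^sup>2 / (8 * L\<^sup>2)"
    have le_q: "(norm (\<phi> k m - c))\<^sup>2 \<le> q" if k: "k \<in> I" for k
    proof -
      have "(norm (\<phi> k m - c))\<^sup>2 \<le>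
         ((norm (\<phi> k z - c))\<^sup>2 + (norm (\<phi> k x - c))\<^sup>2) / 2 - (norm (z - x))\<^sup>2 / (8 * L\<^sup>2)"
        unfolding m_def
        by (rule square_distance_midpoint[OF small sub k zB xB])
           (use R_upper[OF k zB] R_upper[OF k xB] z\<delta> Rx R_center[OF zB] R_center[OF xB] in linarith)+
      moreover have "(norm (\<phi> k z - c))\<^sup>2 \<le> (R z)\<^sup>2" "(norm (\<phi> k x - c))\<^sup>2 \<le> (R x)\<^sup>2"
        using R_upper[OF k zB] R_upper[OF k xB] by (auto intro: power_mono)
      moreover have "a \<le> (b' + c') / 2 - w"
        if "a \<le> (b + c) / 2 - w" "b \<le> b'" "c \<le> c'" for a b c b' c' w :: real
        using that by (simp add: field_simps)
      ultimately show ?thesis unfolding q_def by metis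
    qed
    have "R m \<le> sqrt q"
      by (rule R_least) (use le_q real_le_rsqrt in blast)
    moreover have "0 \<le> q" using le_q[OF e(1)] zero_le_power2 order_trans by blast
    ultimately have Rm: "(R m)\<^sup>2 \<le> q"
      using R_nonneg[OF mB] by (metis power_mono real_sqrt_pow2)
    have Rx2: "(R x)\<^sup>2 \<le> (R z)\<^sup>2" using Rx R_nonneg[OF xB] by (rule power_mono)
    have q_le: "q \<le> (R z)\<^sup>2 - (norm (z - x))\<^sup>2 / (8 * L\<^sup>2)"
      using Rx2 by (simp add: q_def)
    then have "(R m)\<^sup>2 \<le> (R z)\<^sup>2"
      using Rm by (smt (verit) divide_nonneg_nonneg zero_le_power2 mult_nonneg_nonneg)
    then have "R m \<le> \<delta>"
      using R_nonneg[OF zB] z\<delta> by (meson power2_le_imp_le order_trans)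
    then have "m \<in> N" using mB by (simp add: N_def)
    then have "f z + K * (R z)\<^sup>2 \<le> f m + K * (R m)\<^sup>2" by (rule min)
    also have "\<dots> \<le> ((f z + f x) / 2 + A * (norm (z - x))\<^sup>2) + K * q"
      using f_mid[OF zB xB] Rm K(1) by (intro add_mono mult_left_mono) (auto simp: m_def)
    also have "f x = f z" unfolding x_def by (rule f_inv[OF i zB]) (use xB x_def in simp)
    also have "((f z + f z) / 2 + A * (norm (z - x))\<^sup>2) + K * q
        \<le> f z + A * (norm (z - x))\<^sup>2 + K * ((R z)\<^sup>2 - (norm (z - x))\<^sup>2 / (8 * L\<^sup>2))"
      using mult_left_mono[OF q_le, of K] K(1) by simp
    also have "\<dots> = f z + K * (R z)\<^sup>2 + (A - K / (8 * L\<^sup>2)) * (norm (z - x))\<^sup>2"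
      by (simp add: algebra_simps)
    also have "\<dots> < f z + K * (R z)\<^sup>2"
      using K(2) ne by (simp add: x_def mult_less_0_iff)
    finally show False by simp
  qed
  have "f z + K * (norm (z - c))\<^sup>2 \<le> f z + K * (R z)\<^sup>2"
    using R_center[OF zB] K(1) by (simp add: power_mono)
  also have "\<dots> \<le> f y + K * (R y)\<^sup>2" using min[OF yN] .
  also have "\<dots> \<le> f y + K * s\<^sup>2"
    using R_least[of y s] ys R_nonneg[OF y] K(1) by (simp add: power_mono)
  finally have "f z + K * (norm (z - c))\<^sup>2 \<le> f y + K * s\<^sup>2" .
  moreover have "norm (z - c) \<le> \<delta>" using R_center[OF zB] z\<delta> by simp
  ultimately show ?thesis using that zB fixed by blast
qed

lemma small_radius:
  obtains \<delta>\<^sub>0 where "\<delta>\<^sub>0 > 0"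
    "\<And>\<delta>. \<lbrakk>0 < \<delta>; \<delta> \<le> \<delta>\<^sub>0\<rbrakk> \<Longrightarrow> 2 * \<delta> * C + 4 * \<delta>\<^sup>2 * C\<^sup>2 \<le> 1 / (8 * L\<^sup>2)"
proof
  define \<tau> where "\<tau> = 1 / (8 * L\<^sup>2)"
  define k where "k = 2 * C + 4 * C\<^sup>2"
  have pos: "\<tau> > 0" "k > 0" using L_pos C_pos by (auto simp: \<tau>_def k_def add_pos_pos)
  show "min 1 (\<tau> / k) > 0" using pos by simp
  show "2 * \<delta> * C + 4 * \<delta>\<^sup>2 * C\<^sup>2 \<le> 1 / (8 * L\<^sup>2)"
    if \<delta>: "0 < \<delta>" "\<delta> \<le> min 1 (\<tau> / k)" for \<delta>
  proof -
    have "\<delta>\<^sup>2 \<le> \<delta>" using \<delta> by (simp add: power2_eq_square mult_left_le)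
    then have "4 * \<delta>\<^sup>2 * C\<^sup>2 \<le> 4 * \<delta> * C\<^sup>2" by (intro mult_right_mono mult_left_mono) auto
    then have "2 * \<delta> * C + 4 * \<delta>\<^sup>2 * C\<^sup>2 \<le> \<delta> * k" by (simp add: k_def algebra_simps)
    also have "\<dots> \<le> \<tau>" using \<delta> pos by (simp add: pos_le_divide_eq)
    finally show ?thesis by (simp add: \<tau>_def)
  qed
qed

text \<open>
  The midpoint of two fixed points is moved only by an amount quadratic in their distance, so
  penalising the distance from it, with \<open>f = 0\<close>, produces a true fixed point at quadratic distance.
\<close>
lemma fixed_point_near_midpoint:
  assumes \<delta>: "\<delta> > 0"
    and small: "2 * \<delta> * C + 4 * \<delta>\<^sup>2 * C\<^sup>2 \<le> 1 / (8 * L\<^sup>2)"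
    and sub: "cball (midpoint x y) \<delta> \<inter> E \<subseteq> B"
    and x: "x \<in> B" "\<And>i. i \<in> I \<Longrightarrow> \<phi> i x = x" and y: "y \<in> B" "\<And>i. i \<in> I \<Longrightarrow> \<phi> i y = y"
    and close: "C * (norm (x - y))\<^sup>2 \<le> \<delta>"
  obtains z where "z \<in> B" "\<And>i. i \<in> I \<Longrightarrow> \<phi> i z = z"
    "norm (z - midpoint x y) \<le> C * (norm (x - y))\<^sup>2"
proof -
  let ?m = "midpoint x y"
  have "norm (\<phi> i ?m - ?m) \<le> C * (norm (x - y))\<^sup>2" if "i \<in> I" for i
    using midpoint_estimate[OF that x(1) y(1)] x(2)[OF that] y(2)[OF that]
    by (simp add: midpoint_def)
  from fixed_point_of_penalized_minimum[OF \<delta> small sub midpoint_in_B[OF x(1) y(1)] this close,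
      where f = "\<lambda>_. 0" and A = 0 and K = 1]
  obtain z where z: "z \<in> B" "\<And>i. i \<in> I \<Longrightarrow> \<phi> i z = z"
    "(norm (z - ?m))\<^sup>2 \<le> (C * (norm (x - y))\<^sup>2)\<^sup>2"
    using L_pos by auto
  have "norm (z - ?m) \<le> C * (norm (x - y))\<^sup>2"
    by (rule power2_le_imp_le[OF z(3)]) (use C_pos in simp)
  then show ?thesis using that z by blast
qed

text \<open>
  For a function that varies only quadratically on fixed points. Bisecting with
  \<open>fixed_point_near_midpoint\<close> shrinks the distance \<open>d\<close> of two fixed points to at most \<open>2 d / 3\<close> on
  each side, so two steps of size \<open>(2 d / 3)\<^sup>2\<close> replace one of size \<open>d\<^sup>2\<close>. The bound improves by the
  factor \<open>2 \<cdot> (2/3)\<^sup>2 = 8/9\<close> each time and tends to zero.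
\<close>
lemma locally_constant_on_fixed_points:
  assumes "r > 0" and B: "cball a r \<inter> E \<subseteq> B"
    and F: "\<And>x y. \<lbrakk>x \<in> B; y \<in> B; \<And>i. i \<in> I \<Longrightarrow> \<phi> i x = x; \<And>i. i \<in> I \<Longrightarrow> \<phi> i y = y\<rbrakk> \<Longrightarrow>
       \<bar>F x - F y\<bar> \<le> A * (norm (x - y))\<^sup>2"
  obtains \<epsilon> where "\<epsilon> > 0"
    "\<And>x y. \<lbrakk>x \<in> B; y \<in> B; \<And>i. i \<in> I \<Longrightarrow> \<phi> i x = x; \<And>i. i \<in> I \<Longrightarrow> \<phi> i y = y;
       norm (x - a) \<le> \<epsilon>; norm (y - a) \<le> \<epsilon>\<rbrakk> \<Longrightarrow> F x = F y"
proof -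
  define Fix where "Fix = {x \<in> B. \<forall>i\<in>I. \<phi> i x = x}"
  obtain \<delta>\<^sub>0 where \<delta>\<^sub>0: "\<delta>\<^sub>0 > 0"
    "\<And>\<delta>. \<lbrakk>0 < \<delta>; \<delta> \<le> \<delta>\<^sub>0\<rbrakk> \<Longrightarrow> 2 * \<delta> * C + 4 * \<delta>\<^sup>2 * C\<^sup>2 \<le> 1 / (8 * L\<^sup>2)"
    using small_radius by blast
  define \<delta> where "\<delta> = min \<delta>\<^sub>0 (r / 2)"
  have \<delta>: "\<delta> > 0" "\<delta> \<le> \<delta>\<^sub>0" "\<delta> \<le> r / 2" using \<delta>\<^sub>0 \<open>r > 0\<close> by (auto simp: \<delta>_def)
  \<comment> \<open>Then \<open>3 d \<le> R\<close> implies \<open>C d\<^sup>2 \<le> d / 6\<close>, so that both halves have length at most \<open>d / 2 + d / 6\<close>.\<close>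
  define R where "R = min \<delta> (1 / (2 * C))"
  have R: "R > 0" "R \<le> \<delta>" "C * R \<le> 1 / 2"
  proof -
    show "R > 0" "R \<le> \<delta>" using \<delta> C_pos by (auto simp: R_def)
    have "C * R \<le> C * (1 / (2 * C))" using C_pos by (intro mult_left_mono) (auto simp: R_def)
    then show "C * R \<le> 1 / 2" using C_pos by simp
  qed
  \<comment> \<open>The quantity \<open>|x - a| + 3 d\<close> does not grow, as \<open>d / 6 + 3 (2 d / 3) \<le> 3 d\<close>; this keeps the new points near \<open>a\<close>.\<close>
  have bisect: "\<exists>z\<in>Fix. norm (x - z) \<le> 2 / 3 * norm (x - y) \<and> norm (y - z) \<le> 2 / 3 * norm (x - y)
      \<and> norm (z - a) + 3 * (2 / 3 * norm (x - y)) \<le> R"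
    if x: "x \<in> Fix" "norm (x - a) + 3 * norm (x - y) \<le> R"
      and y: "y \<in> Fix" "norm (y - a) + 3 * norm (x - y) \<le> R" for x y
  proof -
    define d where "d = norm (x - y)"
    define m where "m = midpoint x y"
    have "m - a = (1/2) *\<^sub>R ((x - a) + (y - a))"
      by (simp add: m_def midpoint_def algebra_simps flip: scaleR_add_left)
    then have "norm (m - a) \<le> (norm (x - a) + norm (y - a)) / 2"
      using norm_triangle_ineq[of "x - a" "y - a"] by simp
    then have m: "norm (m - a) + 3 * d \<le> R" using x(2) y(2) unfolding d_def by (simp add: field_simps)
    have "0 \<le> d" by (simp add: d_def)
    moreover have "3 * d \<le> R" using m norm_ge_zero[of "m - a"] by linarith
    ultimately have d: "0 \<le> d" "3 * d \<le> R" by blast+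
    have "C * d \<le> C * (R / 3)" using C_pos d by (intro mult_left_mono) auto
    then have Cd: "C * d \<le> 1 / 6" using R(3) by simp
    then have "C * d * d \<le> 1 / 6 * d" using d(1) by (rule mult_right_mono)
    then have Cd2: "C * d\<^sup>2 \<le> d / 6" by (simp add: power2_eq_square mult.assoc)
    have sub: "cball m \<delta> \<inter> E \<subseteq> B"
    proof -
      have "cball m \<delta> \<subseteq> cball a r"
        using m d(1) R(2) \<delta> by (simp add: cball_subset_cball_iff dist_norm)
      then show ?thesis using B by blast
    qed
    obtain z where z: "z \<in> B" "\<And>i. i \<in> I \<Longrightarrow> \<phi> i z = z" "norm (z - m) \<le> C * d\<^sup>2"
      using fixed_point_near_midpoint[OF \<delta>(1) \<delta>\<^sub>0(2)[OF \<delta>(1,2)] sub[unfolded m_def], of thesis]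
        x(1) y(1) Cd2 d R(2) unfolding Fix_def d_def m_def by auto
    have "norm (x - m) = d / 2" "norm (y - m) = d / 2"
      by (simp_all add: m_def d_def dist_midpoint flip: dist_norm)
    moreover have "norm (x - z) \<le> norm (x - m) + norm (z - m)" "norm (y - z) \<le> norm (y - m) + norm (z - m)"
      using norm_triangle_ineq4[of "x - m" "z - m"] norm_triangle_ineq4[of "y - m" "z - m"] by simp_all
    moreover have "norm (z - a) \<le> norm (z - m) + norm (m - a)"
      using norm_triangle_ineq[of "z - m" "m - a"] by simp
    ultimately have "norm (x - z) \<le> 2/3 * d" "norm (y - z) \<le> 2/3 * d" "norm (z - a) + 3 * (2/3 * d) \<le> R"
      using z(3) Cd2 m d(1) by linarith+
    then show ?thesis using z(1,2) unfolding d_def Fix_def by blast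
  qed
  have A: "\<bar>F x - F y\<bar> \<le> \<bar>A\<bar> * (norm (x - y))\<^sup>2" if "x \<in> Fix" "y \<in> Fix" for x y
  proof -
    have "\<bar>F x - F y\<bar> \<le> A * (norm (x - y))\<^sup>2" using F that by (simp add: Fix_def)
    also have "\<dots> \<le> \<bar>A\<bar> * (norm (x - y))\<^sup>2" by (intro mult_right_mono) auto
    finally show ?thesis .
  qed
  have decay: "\<bar>F x - F y\<bar> \<le> \<bar>A\<bar> * (8 / 9) ^ k * (norm (x - y))\<^sup>2"
    if "x \<in> Fix" "y \<in> Fix" "norm (x - a) + 3 * norm (x - y) \<le> R" "norm (y - a) + 3 * norm (x - y) \<le> R"
    for x y k
    using that
  proof (induction k arbitrary: x y)
    case 0
    then show ?case using A by simp
  next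
    case (Suc k)
    define d where "d = norm (x - y)"
    obtain z where z: "z \<in> Fix" "norm (x - z) \<le> 2/3 * d" "norm (y - z) \<le> 2/3 * d"
      "norm (z - a) + 3 * (2/3 * d) \<le> R"
      using bisect[OF Suc.prems(1,3,2,4)] unfolding d_def by blast
    have d: "0 \<le> d" "norm (x - a) + 3 * d \<le> R" "norm (y - a) + 3 * d \<le> R"
      using Suc.prems by (simp_all add: d_def)
    let ?k = "\<bar>A\<bar> * (8 / 9) ^ k"
    have "\<bar>F x - F z\<bar> \<le> ?k * (norm (x - z))\<^sup>2" "\<bar>F y - F z\<bar> \<le> ?k * (norm (y - z))\<^sup>2"
      by (rule Suc.IH; use Suc.prems z d in linarith | use Suc.prems z in blast)+
    moreover have "?k * (norm (x - z))\<^sup>2 \<le> ?k * (2/3 * d)\<^sup>2" "?k * (norm (y - z))\<^sup>2 \<le> ?k * (2/3 * d)\<^sup>2"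
      using z by (intro mult_left_mono power_mono; simp)+
    ultimately have "\<bar>F x - F y\<bar> \<le> 2 * (?k * (2/3 * d)\<^sup>2)" by linarith
    also have "\<dots> = \<bar>A\<bar> * (8 / 9) ^ Suc k * d\<^sup>2" by (simp add: power_mult_distrib power_divide)
    finally show ?case by (simp add: d_def)
  qed
  have const: "F x = F y" if xy: "x \<in> Fix" "y \<in> Fix" "norm (x - a) \<le> R / 7" "norm (y - a) \<le> R / 7" for x y
  proof -
    have "norm (x - y) \<le> 2 * R / 7"
      using norm_triangle_ineq4[of "x - a" "y - a"] xy by simp
    then have "\<bar>F x - F y\<bar> \<le> \<bar>A\<bar> * (8 / 9) ^ k * (norm (x - y))\<^sup>2" for k
      using decay[OF xy(1,2)] xy(3,4) R(1) by simp
    moreover have "(\<lambda>k. \<bar>A\<bar> * (8 / 9) ^ k * (norm (x - y))\<^sup>2) \<longlonglongrightarrow> \<bar>A\<bar> * 0 * (norm (x - y))\<^sup>2"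
      by (intro tendsto_intros LIMSEQ_power_zero) simp
    ultimately have "\<bar>F x - F y\<bar> \<le> \<bar>A\<bar> * 0 * (norm (x - y))\<^sup>2"
      by (intro LIMSEQ_le_const) auto
    then show ?thesis by simp
  qed
  show ?thesis
    by (rule that[of "R / 7"]) (use R(1) const in \<open>auto simp: Fix_def\<close>)
qed

end

section \<open>Closed subgroups and one-parameter groups of the torus\<close>

lemma in_torus_iff: "z \<in> carrier torus \<longleftrightarrow> (\<forall>i. norm (z $ i) = 1)"
  by (simp add: torus_def)

lemma torus_simps [simp]:
  "x \<otimes>\<^bsub>torus\<^esub> y = x * y" "\<one>\<^bsub>torus\<^esub> = 1"
  by (simp_all add: torus_def)

lemma torus_exp_add: "torus_exp (x + y) = torus_exp x * torus_exp y"
  by (simp add: torus_exp_def vec_eq_iff cis_mult)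

lemma torus_exp_0 [simp]: "torus_exp 0 = 1"
  by (simp add: torus_exp_def vec_eq_iff)

lemma torus_exp_in_torus [simp]: "torus_exp x \<in> carrier torus"
  by (simp add: torus_exp_def in_torus_iff)

lemma continuous_on_torus_exp: "continuous_on S torus_exp"
  unfolding torus_exp_def[abs_def] by (intro continuous_intros)

lemma torus_exp_surj:
  assumes "z \<in> carrier torus"
  shows "\<exists>x\<in>cbox 0 (\<chi> i. 2 * pi). torus_exp x = z"
proof
  define x where "x = (\<chi> i. Arg2pi (z $ i))"
  show "x \<in> cbox 0 (\<chi> i. 2 * pi)"
    using Arg2pi by (auto simp: mem_box_cart x_def less_imp_le)
  show "torus_exp x = z"
    using assms Arg2pi_eq by (simp add: torus_exp_def x_def vec_eq_iff cis_conv_exp in_torus_iff)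
      (metis mult.left_neutral of_real_1)
qed

lemma group_torus: "group torus"
proof (rule groupI)
  show "\<exists>y\<in>carrier torus. y \<otimes>\<^bsub>torus\<^esub> x = \<one>\<^bsub>torus\<^esub>" if x: "x \<in> carrier torus" for x
  proof -
    obtain t where "torus_exp t = x" using torus_exp_surj[OF x] by blast
    then have "torus_exp (- t) * x = 1" using torus_exp_add[of "-t" t] by simp
    then show ?thesis using torus_exp_in_torus[of "-t"] by auto
  qed
qed (auto simp: in_torus_iff norm_mult algebra_simps)

lemma torus_exp_surj_compact:
  assumes "closed H" "H \<subseteq> carrier torus"
  obtains \<Xi> where "compact \<Xi>" "torus_exp ` \<Xi> = H"
proof
  let ?\<Xi> = "cbox 0 (\<chi> i. 2 * pi) \<inter> torus_exp -` H"
  show "compact ?\<Xi>"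
    using continuous_closed_preimage[OF continuous_on_torus_exp[of "cbox 0 (\<chi> i. 2 * pi)"] closed_cbox assms(1)]
    by (metis compact_cbox compact_Int_closed inf.left_idem)
  show "torus_exp ` ?\<Xi> = H"
    using torus_exp_surj assms(2) by blast
qed

lemma subtorus_torus: "subtorus (carrier torus :: (complex^'n) set)"
proof -
  have eq: "carrier torus = torus_exp ` (UNIV :: (real^'n) set)"
    using torus_exp_surj torus_exp_in_torus by fast
  have "connected (carrier torus :: (complex^'n) set)"
    unfolding eq by (rule connected_continuous_image[OF continuous_on_torus_exp connected_UNIV])
  moreover have "closed (carrier torus :: (complex^'n) set)"
  proof -
    have "carrier torus = (\<Inter>i. {z::complex^'n. norm (z $ i) = 1})" by (auto simp: in_torus_iff)
    moreover have "closed (\<Inter>i. {z::complex^'n. norm (z $ i) = 1})"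
      by (intro closed_INT ballI closed_Collect_eq continuous_intros)
    ultimately show ?thesis by simp
  qed
  ultimately show ?thesis
    using group.subgroup_self[OF group_torus] by (simp add: subtorus_def)
qed

lemma lie_algebra_torus [simp]: "lie_algebra (carrier torus) = UNIV"
  using torus_exp_in_torus by (auto simp: lie_algebra_def)

lemma subspace_lie_algebra:
  assumes "subgroup H torus"
  shows "subspace (lie_algebra H)"
  unfolding subspace_def lie_algebra_def
  using subgroup.one_closed[OF assms] subgroup.m_closed[OF assms]
  by (auto simp: scaleR_add_right torus_exp_add)

lemma tendsto_vec_mult:
  fixes X Y :: "nat \<Rightarrow> complex^'n"
  assumes "X \<longlonglongrightarrow> x" "Y \<longlonglongrightarrow> y"
  shows "(\<lambda>k. X k * Y k) \<longlonglongrightarrow> x * y"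
  using assms by (intro vec_tendstoI) (auto intro!: tendsto_mult tendsto_vec_nth)

text \<open>
  With \<open>V\<close> the Lie algebra of a stabilizer, this is the identity component of the stabilizer.
\<close>
lemma subtorus_closure_exp:
  fixes V :: "(real^'n) set"
  assumes V: "subspace V"
  shows "subtorus (closure (torus_exp ` V))" (is "subtorus ?H")
    and "V \<subseteq> lie_algebra (closure (torus_exp ` V))"
proof -
  have sub: "?H \<subseteq> carrier torus"
    using subtorus_torus torus_exp_in_torus
    by (intro closure_minimal) (auto simp: subtorus_def)
  have one: "1 \<in> ?H"
    using subspace_0[OF V] closure_subset by (metis image_eqI subsetD torus_exp_0)
  have mult: "x * y \<in> ?H" if x: "x \<in> ?H" and y: "y \<in> ?H" for x y
  proof -
    obtain X where X: "\<And>k. X k \<in> torus_exp ` V" "X \<longlonglongrightarrow> x"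
      using x unfolding closure_sequential by blast
    obtain Y where Y: "\<And>k. Y k \<in> torus_exp ` V" "Y \<longlonglongrightarrow> y"
      using y unfolding closure_sequential by blast
    have "X k * Y k \<in> torus_exp ` V" for k
      using X(1)[of k] Y(1)[of k] subspace_add[OF V] by (auto simp flip: torus_exp_add)
    then show ?thesis
      using tendsto_vec_mult[OF X(2) Y(2)] unfolding closure_sequential
      by (intro exI[of _ "\<lambda>k. X k * Y k"]) blast
  qed
  have inv: "\<exists>y\<in>?H. y * x = 1" if x: "x \<in> ?H" for x
  proof -
    obtain X where X: "\<And>k. X k \<in> torus_exp ` V" "X \<longlonglongrightarrow> x"
      using x unfolding closure_sequential by blast
    have c: "(\<chi> i. cnj (torus_exp v $ i)) = torus_exp (- v)" for v :: "real^'n"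
      by (simp add: torus_exp_def vec_eq_iff cis_cnj)
    have "(\<lambda>k. \<chi> i. cnj (X k $ i)) \<longlonglongrightarrow> (\<chi> i. cnj (x $ i))"
      by (intro tendsto_vec_lambda tendsto_cnj tendsto_vec_nth X)
    moreover have "(\<chi> i. cnj (X k $ i)) \<in> torus_exp ` V" for k
      using X(1)[of k] subspace_neg[OF V] by (auto simp: c)
    ultimately have "(\<chi> i. cnj (x $ i)) \<in> ?H"
      unfolding closure_sequential by (intro exI[of _ "\<lambda>k. \<chi> i. cnj (X k $ i)"]) blast
    moreover have "(\<chi> i. cnj (x $ i)) * x = 1"
    proof -
      have n: "norm (x $ i) = 1" for i using x sub by (auto simp: in_torus_iff)
      have "cnj (x $ i) * x $ i = 1" for i
        using complex_norm_square[of "x $ i"] n[of i] by (simp add: mult.commute)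
      then show ?thesis by (simp add: vec_eq_iff)
    qed
    ultimately show ?thesis by blast
  qed
  have "subgroup ?H torus"
  proof (rule group.subgroupI[OF group_torus sub])
    show "inv\<^bsub>torus\<^esub> x \<in> ?H" if x: "x \<in> ?H" for x
    proof -
      obtain y where y: "y \<in> ?H" "y * x = 1" using inv[OF x] by blast
      then have "inv\<^bsub>torus\<^esub> x = y"
        using group.inv_equality[OF group_torus, of y x] x sub by auto
      with y show ?thesis by simp
    qed
  qed (use one mult in auto)
  moreover have "connected ?H"
    by (intro connected_imp_connected_closure connected_continuous_image[OF continuous_on_torus_exp]
        convex_connected subspace_imp_convex V)
  ultimately show "subtorus ?H" by (simp add: subtorus_def)
  show "V \<subseteq> lie_algebra ?H"
    using subspace_scale[OF V] closure_subset by (fastforce simp: lie_algebra_def)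
qed

text \<open>
  The directions with a nontrivial integral linear relation between their coordinates lie on countably
  many hyperplanes and form a null set, so every ball contains a direction without such a
  relation. For these, Kronecker's approximation theorem gives density.
\<close>
lemma exists_dense_one_parameter_group:
  fixes \<eta> :: "real^'n"
  assumes "\<epsilon> > 0"
  obtains \<xi> where "norm (\<xi> - \<eta>) < \<epsilon>" "carrier torus \<subseteq> closure (range (\<lambda>s. torus_exp (s *\<^sub>R \<xi>)))"
proof -
  define bad where "bad k = {\<xi>::real^'n. (\<chi> i. real_of_int (k $ i)) \<bullet> \<xi> = 0}" for k :: "int^'n"
  have neg: "negligible (\<Union>(bad ` {k. k \<noteq> 0}))"
  proof (rule negligible_countable_Union)
    show "countable (bad ` {k. k \<noteq> 0})" by simp
    show "negligible S" if S: "S \<in> bad ` {k. k \<noteq> 0}" for S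
    proof -
      obtain k where k: "S = bad k" "k \<noteq> 0" using S by blast
      have "(\<chi> i. real_of_int (k $ i)) \<noteq> 0" using k(2) by (simp add: vec_eq_iff)
      then show ?thesis unfolding k bad_def by (intro negligible_hyperplane disjI1)
    qed
  qed
  have "\<not> negligible (ball \<eta> \<epsilon>)"
    using open_not_negligible[OF open_ball, of \<eta> \<epsilon>] assms by auto
  then have "\<not> ball \<eta> \<epsilon> \<subseteq> \<Union>(bad ` {k. k \<noteq> 0})"
    using neg negligible_subset by blast
  then obtain \<xi> where \<xi>: "dist \<eta> \<xi> < \<epsilon>" and good: "\<And>k. k \<noteq> 0 \<Longrightarrow> \<xi> \<notin> bad k"
    by (auto simp: subset_iff)
  have indep: "k = 0" if "(\<Sum>i\<in>UNIV. real_of_int (k $ i) * \<xi> $ i) = 0" for k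
    using good[of k] that by (auto simp: bad_def inner_vec_def)
  define n where "n = CARD('n)"
  obtain \<sigma> where \<sigma>: "bij_betw \<sigma> {..<n} (UNIV :: 'n set)"
    unfolding n_def by (metis ex_bij_betw_nat_finite finite atLeast0LessThan)
  define \<theta> where "\<theta> j = \<xi> $ \<sigma> j" for j
  have inj_\<xi>: "i = j" if eq: "\<xi> $ i = \<xi> $ j" for i j
  proof (rule ccontr)
    assume ne: "i \<noteq> j"
    \<comment> \<open>Equal coordinates would be an integral relation.\<close>
    define k :: "int^'n" where "k = axis i 1 - axis j 1"
    have "(\<Sum>l\<in>UNIV. real_of_int (k $ l) * \<xi> $ l)
        = (\<Sum>l\<in>UNIV. (if l = i then \<xi> $ l else 0) - (if l = j then \<xi> $ l else 0))"
      by (intro sum.cong) (auto simp: k_def axis_def)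
    also have "\<dots> = 0" using eq by (simp add: sum_subtractf)
    finally have "k = 0" by (rule indep)
    then have "k $ i = 0" by simp
    with ne show False by (simp add: k_def axis_def)
  qed
  have inj: "inj_on \<theta> {..<n}"
    using bij_betw_imp_inj_on[OF \<sigma>] by (auto simp: inj_on_def \<theta>_def dest: inj_\<xi>)
  interpret Z: Modules.module "(\<lambda>r. (*) (real_of_int r))"
    by (simp add: Modules.module.intro distrib_left mult.commute)
  have img: "\<theta> ` {..<n} = range (($) \<xi>)"
    using bij_betw_imp_surj_on[OF \<sigma>] by (force simp: \<theta>_def)
  have "Z.independent (\<theta> ` {..<n})"
    unfolding Z.independent_explicit_module img
  proof (intro allI impI)
    fix t :: "real set" and u :: "real \<Rightarrow> int" and v
    assume t: "finite t" "t \<subseteq> range (($) \<xi>)" and sum0: "(\<Sum>v\<in>t. real_of_int (u v) * v) = 0" and v: "v \<in> t"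
    define k :: "int^'n" where "k = (\<chi> i. if \<xi> $ i \<in> t then u (\<xi> $ i) else 0)"
    have "(\<Sum>i\<in>UNIV. real_of_int (k $ i) * \<xi> $ i)
        = (\<Sum>i\<in>{i. \<xi> $ i \<in> t}. real_of_int (u (\<xi> $ i)) * \<xi> $ i)"
      by (rule sum.mono_neutral_cong_right) (auto simp: k_def)
    also have "\<dots> = (\<Sum>v\<in>($) \<xi> ` {i. \<xi> $ i \<in> t}. real_of_int (u v) * v)"
      by (subst sum.reindex) (auto simp: inj_on_def dest: inj_\<xi>)
    also have "($) \<xi> ` {i. \<xi> $ i \<in> t} = t" using t(2) by auto
    finally have "k = 0" using sum0 indep by simp
    moreover obtain i where "v = \<xi> $ i" using v t(2) by blast
    ultimately show "u v = 0" using v by (auto simp: k_def vec_eq_iff split: if_splits)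
  qed
  then have approx: "\<exists>t h. \<forall>j<n. \<bar>t * \<theta> j - real_of_int (h j) - \<alpha> j\<bar> < \<epsilon>'" if "\<epsilon>' > 0" for \<alpha> :: "nat \<Rightarrow> real" and \<epsilon>'
    using Kronecker_thm_1[OF _ inj that, of \<alpha>] by metis
  have "z \<in> closure (range (\<lambda>s. torus_exp (s *\<^sub>R \<xi>)))" if z: "z \<in> carrier torus" for z
    unfolding closure_approachable
  proof (intro allI impI)
    fix e :: real assume e: "e > 0"
    obtain x where x: "torus_exp x = z" using torus_exp_surj[OF z] by blast
    define \<epsilon>' where "\<epsilon>' = e / (2 * pi * real n)"
    have n: "n > 0" by (simp add: n_def)
    have "\<epsilon>' > 0" using e n by (simp add: \<epsilon>'_def)
    from approx[OF this, of "\<lambda>j. x $ \<sigma> j / (2 * pi)"]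
    obtain t h where th: "\<And>j. j < n \<Longrightarrow> \<bar>t * \<theta> j - real_of_int (h j) - x $ \<sigma> j / (2 * pi)\<bar> < \<epsilon>'"
      by blast
    have comp: "norm ((torus_exp ((2 * pi * t) *\<^sub>R \<xi>) - z) $ i) < 2 * pi * \<epsilon>'" for i
    proof -
      obtain j where j: "j < n" "i = \<sigma> j"
        using bij_betw_imp_surj_on[OF \<sigma>] by (metis UNIV_I imageE lessThan_iff)
      define d where "d = t * \<theta> j - real_of_int (h j) - x $ \<sigma> j / (2 * pi)"
      have split: "2 * pi * t * \<xi> $ i = 2 * pi * real_of_int (h j) + (x $ i + 2 * pi * d)"
        by (simp add: d_def j \<theta>_def field_simps)
      have "cis (2 * pi * t * \<xi> $ i) = cis (x $ i) * cis (2 * pi * d)"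
        unfolding split by (simp flip: cis_mult)
      then have "norm ((torus_exp ((2 * pi * t) *\<^sub>R \<xi>) - z) $ i) = norm (cis (x $ i) * (cis (2 * pi * d) - 1))"
        by (simp add: torus_exp_def flip: x) (simp add: algebra_simps)
      also have "\<dots> = 2 * \<bar>sin (2 * pi * d / 2)\<bar>"
        using dist_exp_i_1[of "2 * pi * d"] by (simp add: norm_mult cis_conv_exp)
      also have "\<dots> \<le> 2 * \<bar>2 * pi * d / 2\<bar>"
        using abs_sin_x_le_abs_x[of "2 * pi * d / 2"] by simp
      also have "\<dots> = 2 * pi * \<bar>d\<bar>" by (simp add: abs_mult)
      also have "\<dots> < 2 * pi * \<epsilon>'" using th[OF j(1)] by (simp add: d_def)
      finally show ?thesis .
    qed
    have "norm (torus_exp ((2 * pi * t) *\<^sub>R \<xi>) - z)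
        \<le> (\<Sum>i\<in>UNIV. norm ((torus_exp ((2 * pi * t) *\<^sub>R \<xi>) - z) $ i))"
      by (simp add: norm_vec_def L2_set_le_sum)
    also have "\<dots> < (\<Sum>i\<in>(UNIV::'n set). 2 * pi * \<epsilon>')"
      by (rule sum_strict_mono) (use comp in auto)
    also have "\<dots> = e" using n by (simp add: \<epsilon>'_def flip: n_def)
    finally show "\<exists>y\<in>range (\<lambda>s. torus_exp (s *\<^sub>R \<xi>)). dist y z < e"
      by (auto simp: dist_norm)
  qed
  then show ?thesis using that[of \<xi>] \<xi> by (simp add: dist_norm norm_minus_commute subset_iff)
qed

section \<open>Charts\<close>

text \<open>
  A derivative within a relatively open subset of a subspace computes the directional
  derivatives along the subspace.
\<close>
lemma has_vector_derivative_along_line: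
  fixes f :: "'a::real_normed_vector \<Rightarrow> 'b::real_normed_vector"
  assumes E: "subspace E" and U: "openin (top_of_set E) U" and x: "x \<in> U" and v: "v \<in> E"
    and f': "(f has_derivative f') (at x within U)"
  shows "((\<lambda>s. f (x + s *\<^sub>R v)) has_vector_derivative f' v) (at 0)"
    and "dir_deriv f x v = f' v"
proof -
  obtain W where W: "open W" "U = E \<inter> W" using U by (auto simp: openin_open)
  define J where "J = (\<lambda>s::real. x + s *\<^sub>R v) -` W"
  have J: "open J" unfolding J_def by (intro open_vimage W continuous_intros)
  have sub: "(\<lambda>s. x + s *\<^sub>R v) ` J \<subseteq> U"
    using E v x W(2) by (auto simp: J_def subspace_add subspace_scale)
  have "((\<lambda>s. x + s *\<^sub>R v) has_derivative (\<lambda>s. s *\<^sub>R v)) (at 0 within J)"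
    by (auto intro!: derivative_eq_intros)
  moreover have "(f has_derivative f') (at (x + 0 *\<^sub>R v) within ((\<lambda>s. x + s *\<^sub>R v) ` J))"
    using has_derivative_subset[OF f' sub] by simp
  ultimately have "((\<lambda>s. f (x + s *\<^sub>R v)) has_derivative (\<lambda>s. f' (s *\<^sub>R v))) (at 0 within J)"
    by (rule has_derivative_in_compose[where g = f and f = "\<lambda>s. x + s *\<^sub>R v"])
  moreover have "f' (s *\<^sub>R v) = s *\<^sub>R f' v" for s
    using linear_scale[OF has_derivative_linear[OF f']] .
  moreover have "0 \<in> J" using x W(2) by (simp add: J_def)
  ultimately show *: "((\<lambda>s. f (x + s *\<^sub>R v)) has_vector_derivative f' v) (at 0)"
    using at_within_open[OF _ J] by (simp add: has_vector_derivative_def)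
  show "dir_deriv f x v = f' v"
    unfolding dir_deriv_def by (rule vector_derivative_at[OF *])
qed

context smooth_manifold
begin

lemma chart_dom_subset: "c \<in> \<A> \<Longrightarrow> chart_dom c \<subseteq> topspace M"
  using dom_open openin_subset by blast

lemma chart_at:
  assumes "p \<in> topspace M"
  obtains c where "c \<in> \<A>" "p \<in> chart_dom c"
proof -
  have "p \<in> (\<Union>c\<in>\<A>. chart_dom c)" using assms charts_cover by simp
  then show ?thesis using that by blast
qed

lemma chart_img_subset: "c \<in> \<A> \<Longrightarrow> chart_img c \<subseteq> E"
  using img_open openin_subset[of "top_of_set E"] by auto

lemma inj_on_chart: "c \<in> \<A> \<Longrightarrow> inj_on (chart_map c) (chart_dom c)"
  using homeomorphic_imp_injective_map[OF chart_homeo] chart_dom_subset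
  by (metis inf.absorb2 topspace_subtopology)

lemma chart_inv_map [simp]:
  "\<lbrakk>c \<in> \<A>; p \<in> chart_dom c\<rbrakk> \<Longrightarrow> chart_inv c (chart_map c p) = p"
  using inj_on_chart by (simp add: chart_inv_def)

lemma chart_map_in_img: "p \<in> chart_dom c \<Longrightarrow> chart_map c p \<in> chart_img c"
  by (simp add: chart_img_def)

lemma chart_map_inv [simp]: "y \<in> chart_img c \<Longrightarrow> chart_map c (chart_inv c y) = y"
  by (simp add: chart_img_def chart_inv_def f_inv_into_f)

lemma chart_inv_in_dom: "y \<in> chart_img c \<Longrightarrow> chart_inv c y \<in> chart_dom c"
  by (simp add: chart_img_def chart_inv_def inv_into_into)

lemma chart_inv_in_topspace: "\<lbrakk>c \<in> \<A>; y \<in> chart_img c\<rbrakk> \<Longrightarrow> chart_inv c y \<in> topspace M"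
  using subsetD[OF chart_dom_subset chart_inv_in_dom] .

lemma continuous_map_chart_inv:
  assumes "c \<in> \<A>"
  shows "continuous_map (top_of_set (chart_img c)) M (chart_inv c)"
proof -
  obtain h where h: "homeomorphic_maps (subtopology M (chart_dom c)) (top_of_set (chart_img c)) (chart_map c) h"
    using chart_homeo[OF assms] homeomorphic_map_maps by metis
  have "continuous_map (top_of_set (chart_img c)) M h"
    using h by (simp add: homeomorphic_maps_def continuous_map_in_subtopology)
  then show ?thesis
  proof (rule continuous_map_eq)
    fix y assume "y \<in> topspace (top_of_set (chart_img c))"
    then obtain p where p: "p \<in> chart_dom c" "y = chart_map c p" by (auto simp: chart_img_def)
    then have "h y = p"
      using h chart_dom_subset[OF assms] by (auto simp: homeomorphic_maps_def)
    then show "h y = chart_inv c y" using p assms by simp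
  qed
qed

lemma openin_chart_vimage:
  assumes "c \<in> \<A>" "openin M U"
  shows "openin (top_of_set E) {y \<in> chart_img c. chart_inv c y \<in> U}"
  using openin_continuous_map_preimage[OF continuous_map_chart_inv[OF assms(1)] assms(2)]
    img_open[OF assms(1)] openin_trans by auto

lemma openin_chart_ball:
  assumes "c \<in> \<A>"
  shows "openin M {p \<in> chart_dom c. chart_map c p \<in> ball a r}"
proof -
  have "continuous_map (subtopology M (chart_dom c)) euclidean (chart_map c)"
    using homeomorphic_imp_continuous_map[OF chart_homeo[OF assms]]
    by (simp add: continuous_map_in_subtopology)
  from openin_continuous_map_preimage[OF this, of "ball a r"]
  have "openin (subtopology M (chart_dom c)) {p \<in> chart_dom c. chart_map c p \<in> ball a r}"
    using chart_dom_subset[OF assms] by (simp add: Int_absorb1)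
  then show ?thesis using dom_open[OF assms] by (rule openin_trans_full)
qed

lemma cball_in_chart:
  assumes "c \<in> \<A>" "p \<in> chart_dom c" "openin M U" "p \<in> U"
  obtains r where "r > 0" "\<And>y. y \<in> E \<inter> cball (chart_map c p) r \<Longrightarrow> y \<in> chart_img c \<and> chart_inv c y \<in> U"
proof -
  obtain W where W: "open W" "{y \<in> chart_img c. chart_inv c y \<in> U} = E \<inter> W"
    using openin_chart_vimage[OF assms(1,3)] by (auto simp: openin_open)
  have "chart_map c p \<in> {y \<in> chart_img c. chart_inv c y \<in> U}"
    using assms chart_map_in_img by simp
  then have "chart_map c p \<in> W" using W(2) by blast
  then obtain r where "r > 0" "cball (chart_map c p) r \<subseteq> W"
    using W(1) open_contains_cball by blast
  then show ?thesis using W(2) by (intro that[of r]) blast+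
qed

end

section \<open>Smooth torus actions in charts\<close>

locale torus_manifold = smooth_manifold M E \<A>
  for M :: "'m topology" and E :: "'e::euclidean_space set" and \<A> :: "('m, 'e) chart set" +
  fixes \<rho> :: "complex^'n \<Rightarrow> 'm \<Rightarrow> 'm"
  assumes smooth_action: "smooth_torus_action M \<A> \<rho>"
begin

lemma action: "group_action torus (topspace M) \<rho>"
  using smooth_action by (simp add: smooth_torus_action_def)

lemma act_one: "p \<in> topspace M \<Longrightarrow> \<rho> 1 p = p"
  using group_action.id_eq_one[OF action] by (metis restrict_apply' torus_simps(2))

lemma act_mult:
  "\<lbrakk>g \<in> carrier torus; h \<in> carrier torus; p \<in> topspace M\<rbrakk> \<Longrightarrow> \<rho> (g * h) p = \<rho> g (\<rho> h p)"
  using group_action.composition_rule[OF action, of p g h] by simp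

lemma act_exp_add:
  "p \<in> topspace M \<Longrightarrow> \<rho> (torus_exp (x + y)) p = \<rho> (torus_exp x) (\<rho> (torus_exp y) p)"
  by (simp add: torus_exp_add act_mult)

lemma continuous_map_act:
  "continuous_map (prod_topology (top_of_set (carrier torus)) M) M (\<lambda>(g, p). \<rho> g p)"
  using smooth_action by (simp add: smooth_torus_action_def)

lemma continuous_map_act_at:
  assumes "g \<in> carrier torus"
  shows "continuous_map M M (\<rho> g)"
proof -
  have "continuous_map M (prod_topology (top_of_set (carrier torus)) M) (\<lambda>p. (g, p))"
    using assms by (intro continuous_map_pairedI) auto
  from continuous_map_compose[OF this continuous_map_act] show ?thesis by (simp add: o_def)
qed

lemma continuous_map_orbit:
  assumes "p \<in> topspace M"
  shows "continuous_map (top_of_set (carrier torus)) M (\<lambda>g. \<rho> g p)"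
proof -
  have "continuous_map (top_of_set (carrier torus)) (prod_topology (top_of_set (carrier torus)) M) (\<lambda>g. (g, p))"
    using assms by (intro continuous_map_pairedI) auto
  from continuous_map_compose[OF this continuous_map_act] show ?thesis by (simp add: o_def)
qed

abbreviation act_domain :: "('m, 'e) chart \<Rightarrow> ((real^'n) \<times> 'e) set" where
  "act_domain c \<equiv> {(\<xi>, x). x \<in> chart_img c \<and> \<rho> (torus_exp \<xi>) (chart_inv c x) \<in> chart_dom c}"

lemma openin_act_domain:
  assumes "c \<in> \<A>"
  shows "openin (top_of_set (UNIV \<times> E)) (act_domain c)"
proof -
  let ?X = "prod_topology (euclidean :: (real^'n) topology) (top_of_set (chart_img c))"
  have X: "?X = top_of_set (UNIV \<times> chart_img c)"
    by (metis prod_topology_subtopology_eu subtopology_UNIV)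
  have "continuous_map ?X (top_of_set (carrier torus)) (torus_exp \<circ> fst)"
    by (intro continuous_map_compose[OF continuous_map_fst])
       (auto simp: continuous_map_in_subtopology continuous_on_torus_exp)
  moreover have "continuous_map ?X M (chart_inv c \<circ> snd)"
    by (intro continuous_map_compose[OF continuous_map_snd] continuous_map_chart_inv assms)
  ultimately have "continuous_map ?X (prod_topology (top_of_set (carrier torus)) M)
      (\<lambda>z. ((torus_exp \<circ> fst) z, (chart_inv c \<circ> snd) z))"
    by (rule continuous_map_pairedI)
  from continuous_map_compose[OF this continuous_map_act]
  have "continuous_map ?X M (\<lambda>z. \<rho> (torus_exp (fst z)) (chart_inv c (snd z)))"
    by (simp add: o_def)
  from openin_continuous_map_preimage[OF this dom_open[OF assms]]
  have "openin ?X {z \<in> topspace ?X. \<rho> (torus_exp (fst z)) (chart_inv c (snd z)) \<in> chart_dom c}" .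
  moreover have "{z \<in> topspace ?X. \<rho> (torus_exp (fst z)) (chart_inv c (snd z)) \<in> chart_dom c} = act_domain c"
    by auto
  ultimately have "openin (top_of_set (UNIV \<times> chart_img c)) (act_domain c)"
    unfolding X by simp
  moreover have "openin (top_of_set (UNIV \<times> E)) (UNIV \<times> chart_img c :: ((real^'n) \<times> 'e) set)"
    by (intro openin_Times img_open assms) simp
  ultimately show ?thesis by (rule openin_trans)
qed

definition local_act :: "('m, 'e) chart \<Rightarrow> complex^'n \<Rightarrow> 'e \<Rightarrow> 'e" where
  "local_act c g y = chart_map c (\<rho> g (chart_inv c y))"

text \<open>
  The derivatives of the action are bounded on the compact product of \<open>\<Xi>\<close> with a small coordinate
  ball. The set \<open>\<Xi>\<close> is a compact piece of the Lie algebra that covers a closed subgroup or a short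
  piece of a one-parameter group.
\<close>
lemma local_estimates:
  fixes \<Xi> :: "(real^'n) set"
  assumes c: "c \<in> \<A>" and q: "q \<in> chart_dom c" and \<Xi>: "compact \<Xi>"
    and stay: "\<And>\<xi>. \<xi> \<in> \<Xi> \<Longrightarrow> \<rho> (torus_exp \<xi>) q \<in> chart_dom c"
  obtains r L C where "r > 0" "L > 0" "C > 0"
    "E \<inter> cball (chart_map c q) r \<subseteq> chart_img c"
    "\<And>\<xi> y. \<lbrakk>\<xi> \<in> \<Xi>; y \<in> E \<inter> cball (chart_map c q) r\<rbrakk> \<Longrightarrow>
       \<rho> (torus_exp \<xi>) (chart_inv c y) \<in> chart_dom c"
    "\<And>\<xi> x y. \<lbrakk>\<xi> \<in> \<Xi>; x \<in> E \<inter> cball (chart_map c q) r; y \<in> E \<inter> cball (chart_map c q) r\<rbrakk> \<Longrightarrow>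
       norm (local_act c (torus_exp \<xi>) x - local_act c (torus_exp \<xi>) y) \<le> L * norm (x - y)"
    "\<And>\<xi> x y. \<lbrakk>\<xi> \<in> \<Xi>; x \<in> E \<inter> cball (chart_map c q) r; y \<in> E \<inter> cball (chart_map c q) r\<rbrakk> \<Longrightarrow>
       norm (local_act c (torus_exp \<xi>) (midpoint x y)
         - (1/2) *\<^sub>R (local_act c (torus_exp \<xi>) x + local_act c (torus_exp \<xi>) y)) \<le> C * (norm (x - y))\<^sup>2"
proof -
  define a where "a = chart_map c q"
  \<comment> \<open>Adding \<open>0\<close> puts the ball itself into the image of the chart, also for empty \<open>\<Xi>\<close>.\<close>
  define \<Xi>' where "\<Xi>' = insert 0 \<Xi>"
  have qM: "q \<in> topspace M" using chart_dom_subset[OF c] q by blast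
  have aE: "a \<in> E" using chart_img_subset[OF c] chart_map_in_img[OF q] by (auto simp: a_def)
  obtain W where W: "open W" "act_domain c = (UNIV \<times> E) \<inter> W"
    using openin_act_domain[OF c] unfolding openin_open by auto
  have "\<Xi>' \<times> {a} \<subseteq> act_domain c"
    using stay c q chart_map_in_img[OF q] act_one[OF qM] by (auto simp: \<Xi>'_def a_def)
  then have "\<Xi>' \<times> {a} \<subseteq> W" using W(2) by blast
  moreover have "compact (\<Xi>' \<times> {a})"
    unfolding \<Xi>'_def by (intro compact_Times compact_insert \<Xi>) simp
  ultimately obtain \<epsilon> where \<epsilon>: "\<epsilon> > 0" "(\<Union>z\<in>\<Xi>' \<times> {a}. ball z \<epsilon>) \<subseteq> W"
    using compact_subset_open_imp_ball_epsilon_subset W(1) by metis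
  define r where "r = \<epsilon> / 2"
  define B where "B = E \<inter> cball a r"
  have convB: "convex B"
    unfolding B_def by (intro convex_Int subspace_imp_convex model_subspace convex_cball)
  have compB: "compact B"
    unfolding B_def by (intro closed_Int_compact closed_subspace model_subspace compact_cball)
  have ZD: "\<Xi>' \<times> B \<subseteq> act_domain c"
  proof
    fix z assume z: "z \<in> \<Xi>' \<times> B"
    then obtain \<xi> y where zy: "z = (\<xi>, y)" "\<xi> \<in> \<Xi>'" "y \<in> B" by blast
    have "dist (\<xi>, a) z < \<epsilon>"
      using zy(3) \<epsilon>(1) by (simp add: zy(1) dist_Pair_Pair B_def r_def)
    then have "z \<in> ball (\<xi>, a) \<epsilon>" by simp
    then have "z \<in> W" using \<epsilon>(2) zy(2) by blast
    then show "z \<in> act_domain c" using W(2) zy by (auto simp: B_def)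
  qed
  have compZ: "compact (\<Xi>' \<times> B)"
    unfolding \<Xi>'_def by (intro compact_Times compact_insert \<Xi> compB)
  define f where "f = (\<lambda>(\<xi>, x). chart_map c (\<rho> (torus_exp \<xi>) (chart_inv c x)))"
  have f: "Ck_on k (act_domain c) f" for k
    using smooth_action c by (auto simp: smooth_torus_action_def smooth_on_def f_def)
  have f_eq: "f (\<xi>, x) = local_act c (torus_exp \<xi>) x" for \<xi> x
    by (simp add: f_def local_act_def)
  have seg: "closed_segment (\<xi>, x) (\<xi>, y) \<subseteq> \<Xi>' \<times> B" if "\<xi> \<in> \<Xi>'" "x \<in> B" "y \<in> B" for \<xi> x y
  proof
    fix z assume "z \<in> closed_segment (\<xi>, x) (\<xi>, y)"
    then obtain u where u: "0 \<le> u" "u \<le> 1" "z = (1 - u) *\<^sub>R (\<xi>, x) + u *\<^sub>R (\<xi>, y)"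
      by (auto simp: in_segment)
    then have "z = (\<xi>, (1 - u) *\<^sub>R x + u *\<^sub>R y)"
      by (simp add: scaleR_Pair flip: scaleR_add_left)
    moreover have "(1 - u) *\<^sub>R x + u *\<^sub>R y \<in> B"
      using convB that(2,3) u unfolding convex_alt by blast
    ultimately show "z \<in> \<Xi>' \<times> B" using that(1) by blast
  qed
  have mid: "midpoint (\<xi>, x) (\<xi>, y) = (\<xi>, midpoint x y)" for \<xi> :: "real^'n" and x y :: 'e
    by (simp add: midpoint_def scaleR_Pair flip: scaleR_add_left)
  have diff: "norm ((\<xi>, x) - (\<xi>, y)) = norm (x - y)" for \<xi> :: "real^'n" and x y :: 'e
    by (simp add: norm_Pair)
  obtain L where L: "L > 0" "\<And>x y. closed_segment x y \<subseteq> \<Xi>' \<times> B \<Longrightarrow> norm (f x - f y) \<le> L * norm (x - y)"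
    using C1_imp_lipschitz_on_segments[OF f compZ ZD] by blast
  obtain C where C: "C > 0" "\<And>x y. closed_segment x y \<subseteq> \<Xi>' \<times> B \<Longrightarrow>
       norm (f (midpoint x y) - (1/2) *\<^sub>R (f x + f y)) \<le> C * (norm (x - y))\<^sup>2"
    using C2_imp_midpoint_estimate_on_segments[OF f compZ ZD] by blast
  show ?thesis
  proof (rule that[of r L C])
    show "r > 0" "L > 0" "C > 0" using \<epsilon> L C by (auto simp: r_def)
    show "E \<inter> cball (chart_map c q) r \<subseteq> chart_img c"
      using ZD by (auto simp: \<Xi>'_def B_def a_def)
    fix \<xi> assume \<xi>: "\<xi> \<in> \<Xi>"
    show "\<rho> (torus_exp \<xi>) (chart_inv c y) \<in> chart_dom c" if "y \<in> E \<inter> cball (chart_map c q) r" for y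
    proof -
      have "(\<xi>, y) \<in> act_domain c"
        using ZD that \<xi> unfolding \<Xi>'_def B_def a_def by blast
      then show ?thesis by simp
    qed
    fix x y assume "x \<in> E \<inter> cball (chart_map c q) r" "y \<in> E \<inter> cball (chart_map c q) r"
    then have s: "closed_segment (\<xi>, x) (\<xi>, y) \<subseteq> \<Xi>' \<times> B"
      using seg \<xi> by (auto simp: \<Xi>'_def B_def a_def)
    show "norm (local_act c (torus_exp \<xi>) x - local_act c (torus_exp \<xi>) y) \<le> L * norm (x - y)"
      using L(2)[OF s] by (simp add: f_eq diff)
    show "norm (local_act c (torus_exp \<xi>) (midpoint x y)
         - (1/2) *\<^sub>R (local_act c (torus_exp \<xi>) x + local_act c (torus_exp \<xi>) y)) \<le> C * (norm (x - y))\<^sup>2"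
      using C(2)[OF s] by (simp add: f_eq diff mid)
  qed
qed


lemma local_action:
  assumes c: "c \<in> \<A>" and q: "q \<in> chart_dom c"
    and H: "subgroup H torus" "closed H" and fix_q: "\<And>h. h \<in> H \<Longrightarrow> \<rho> h q = q"
  shows "\<exists>r L C. r > 0 \<and> E \<inter> cball (chart_map c q) r \<subseteq> chart_img c \<and>
    (\<forall>h\<in>H. \<forall>y\<in>E \<inter> cball (chart_map c q) r. \<rho> h (chart_inv c y) \<in> chart_dom c) \<and>
    uniformly_C2_local_action H (local_act c) E (E \<inter> cball (chart_map c q) r) L C"
proof -
  have Hsub: "H \<subseteq> carrier torus" using subgroup.subset[OF H(1)] .
  obtain \<Xi> where \<Xi>: "compact \<Xi>" "torus_exp ` \<Xi> = H"
    using torus_exp_surj_compact[OF H(2) Hsub] by blast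
  have stay: "\<rho> (torus_exp \<xi>) q \<in> chart_dom c" if "\<xi> \<in> \<Xi>" for \<xi>
    using fix_q[of "torus_exp \<xi>"] \<Xi>(2) that q by auto
  show ?thesis
  proof (rule local_estimates[OF c q \<Xi>(1) stay])
    fix r L C :: real
    let ?B = "E \<inter> cball (chart_map c q) r"
    assume r: "r > 0" and L: "L > 0" and C: "C > 0" and img: "?B \<subseteq> chart_img c"
      and dom': "\<And>\<xi> y. \<lbrakk>\<xi> \<in> \<Xi>; y \<in> ?B\<rbrakk> \<Longrightarrow> \<rho> (torus_exp \<xi>) (chart_inv c y) \<in> chart_dom c"
      and lip: "\<And>\<xi> x y. \<lbrakk>\<xi> \<in> \<Xi>; x \<in> ?B; y \<in> ?B\<rbrakk> \<Longrightarrow>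
         norm (local_act c (torus_exp \<xi>) x - local_act c (torus_exp \<xi>) y) \<le> L * norm (x - y)"
      and mid: "\<And>\<xi> x y. \<lbrakk>\<xi> \<in> \<Xi>; x \<in> ?B; y \<in> ?B\<rbrakk> \<Longrightarrow>
         norm (local_act c (torus_exp \<xi>) (midpoint x y)
           - (1/2) *\<^sub>R (local_act c (torus_exp \<xi>) x + local_act c (torus_exp \<xi>) y)) \<le> C * (norm (x - y))\<^sup>2"
    have dom: "\<rho> h (chart_inv c y) \<in> chart_dom c" if "h \<in> H" "y \<in> ?B" for h y
    proof -
      obtain \<xi> where "\<xi> \<in> \<Xi>" "h = torus_exp \<xi>" using \<open>h \<in> H\<close> \<Xi>(2) by blast
      then show ?thesis using dom'[of \<xi> y] that by simp
    qed
    have inM: "chart_inv c y \<in> topspace M" if "y \<in> ?B" for y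
      using chart_inv_in_topspace[OF c subsetD[OF img that]] .
    have act: "local_act c k (local_act c h y) = local_act c (k * h) y"
      if "h \<in> H" "k \<in> H" "y \<in> ?B" for h k y
    proof -
      have "chart_inv c (local_act c h y) = \<rho> h (chart_inv c y)"
        using dom[OF that(1,3)] c by (simp add: local_act_def)
      then show ?thesis
        using act_mult[OF subsetD[OF Hsub that(2)] subsetD[OF Hsub that(1)] inM[OF that(3)]]
        by (simp add: local_act_def)
    qed
    have one: "local_act c 1 y = y" if "y \<in> ?B" for y
      using act_one[OF inM[OF that]] img that by (auto simp: local_act_def)
    have "uniformly_C2_local_action H (local_act c) E ?B L C"
    proof
      show "compact ?B" by (intro closed_Int_compact closed_subspace model_subspace compact_cball)
      show "convex ?B" by (intro convex_Int subspace_imp_convex model_subspace convex_cball)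
      show "L > 0" "C > 0" by fact+
      show "\<exists>e\<in>H. \<forall>y\<in>?B. local_act c e y = y"
        using subgroup.one_closed[OF H(1)] one by (intro bexI[of _ 1]) simp_all
      show "\<exists>j\<in>H. \<forall>y\<in>?B. local_act c h y \<in> ?B \<longrightarrow> local_act c k (local_act c h y) = local_act c j y"
        if hk: "h \<in> H" "k \<in> H" for h k
        using subgroup.m_closed[OF H(1) hk(2,1)] act[OF hk]
        by (intro bexI[of _ "k * h"]) auto
      show "\<exists>j\<in>H. \<forall>y\<in>?B. local_act c h y \<in> ?B \<longrightarrow> local_act c j (local_act c h y) = y"
        if h: "h \<in> H" for h
      proof -
        let ?j = "inv\<^bsub>torus\<^esub> h"
        have j: "?j \<in> H" using subgroup.m_inv_closed[OF H(1) h] .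
        have "?j * h = 1" using group.l_inv[OF group_torus, of h] h Hsub by auto
        then show ?thesis using act[OF h j] one j by (intro bexI[of _ ?j]) simp_all
      qed
      show "local_act c h y \<in> E" if "h \<in> H" "y \<in> ?B" for h y
        using chart_map_in_img[OF dom[OF that]] chart_img_subset[OF c] by (auto simp: local_act_def)
      show "norm (local_act c h x - local_act c h y) \<le> L * norm (x - y)"
        if "h \<in> H" "x \<in> ?B" "y \<in> ?B" for h x y
      proof -
        obtain \<xi> where "\<xi> \<in> \<Xi>" "h = torus_exp \<xi>" using \<open>h \<in> H\<close> \<Xi>(2) by blast
        then show ?thesis using lip[of \<xi> x y] that by simp
      qed
      show "norm (local_act c h (midpoint x y) - (1/2) *\<^sub>R (local_act c h x + local_act c h y))
          \<le> C * (norm (x - y))\<^sup>2" if "h \<in> H" "x \<in> ?B" "y \<in> ?B" for h x y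
      proof -
        obtain \<xi> where "\<xi> \<in> \<Xi>" "h = torus_exp \<xi>" using \<open>h \<in> H\<close> \<Xi>(2) by blast
        then show ?thesis using mid[of \<xi> x y] that by simp
      qed
    qed
    then show ?thesis using r img dom by (intro exI conjI ballI) assumption+
  qed
qed

lemma fixed_points_in_chart:
  assumes c: "c \<in> \<A>" and y: "y \<in> chart_img c"
    and dom: "\<And>h. h \<in> H \<Longrightarrow> \<rho> h (chart_inv c y) \<in> chart_dom c"
  shows "chart_inv c y \<in> fixed_points \<rho> M H \<longleftrightarrow> (\<forall>h\<in>H. local_act c h y = y)"
proof -
  have "chart_inv c y \<in> topspace M"
    using chart_inv_in_topspace[OF c y] .
  moreover have "\<rho> h (chart_inv c y) = chart_inv c y \<longleftrightarrow> local_act c h y = y" if "h \<in> H" for h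
    unfolding local_act_def using chart_inv_map[OF c dom[OF that]] chart_map_inv[OF y] by metis
  ultimately show ?thesis by (simp add: fixed_points_def)
qed

lemma closed_stabilizer:
  assumes p: "p \<in> topspace M"
  shows "closed (stabilizer torus \<rho> p)"
proof -
  have "closedin M {p}" using hausdorff p by (simp add: closedin_Hausdorff_singleton)
  from closedin_continuous_map_preimage[OF continuous_map_orbit[OF p] this]
  have "closedin (top_of_set (carrier torus)) (stabilizer torus \<rho> p)"
    by (simp add: stabilizer_def)
  then show ?thesis
    using subtorus_torus closedin_closed_trans unfolding subtorus_def by blast
qed

lemma closedin_fixed_points:
  assumes "H \<subseteq> carrier torus"
  shows "closedin M (fixed_points \<rho> M H)"
proof (cases "H = {}")
  case True
  then show ?thesis by (simp add: fixed_points_def)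
next
  case False
  have "closedin M {p \<in> topspace M. \<rho> h p = p}" if "h \<in> H" for h
  proof -
    have "closedin M {p \<in> topspace M. \<rho> h p = id p}"
      using continuous_map_act_at[of h] that assms hausdorff
      by (intro closedin_continuous_maps_eq[of M M]) auto
    then show ?thesis by simp
  qed
  moreover have "fixed_points \<rho> M H = (\<Inter>h\<in>H. {p \<in> topspace M. \<rho> h p = p})"
    using False by (auto simp: fixed_points_def)
  ultimately show ?thesis using False by (auto intro!: closedin_Inter)
qed

lemma smooth_function_in_chart:
  assumes "smooth_function \<A> f" "c \<in> \<A>"
  shows "Ck_on k (chart_img c) (f \<circ> chart_inv c)"
  using assms by (simp add: smooth_function_def smooth_on_def)

lemma continuous_map_smooth_function:
  assumes f: "smooth_function \<A> f"
  shows "continuous_map M euclideanreal f"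
proof -
  have "topcontinuous_at M euclideanreal f p" if p: "p \<in> topspace M" for p
  proof -
    obtain c where c: "c \<in> \<A>" "p \<in> chart_dom c" using chart_at[OF p] .
    have "continuous_on (chart_img c) (f \<circ> chart_inv c)"
      using smooth_function_in_chart[OF f c(1), of 0] by simp
    then have "continuous_map (top_of_set (chart_img c)) euclideanreal (f \<circ> chart_inv c)" by simp
    from continuous_map_compose[OF homeomorphic_imp_continuous_map[OF chart_homeo[OF c(1)]] this]
    have cm: "continuous_map (subtopology M (chart_dom c)) euclideanreal f"
      by (rule continuous_map_eq) (use c in auto)
    show ?thesis
      unfolding topcontinuous_at_def
    proof (intro conjI allI impI)
      fix V assume V: "openin euclideanreal V \<and> f p \<in> V"
      have "openin (subtopology M (chart_dom c)) {x \<in> topspace (subtopology M (chart_dom c)). f x \<in> V}"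
        using openin_continuous_map_preimage[OF cm] V by blast
      then have "openin M {x \<in> topspace (subtopology M (chart_dom c)). f x \<in> V}"
        using dom_open[OF c(1)] openin_trans_full by blast
      moreover have "p \<in> {x \<in> topspace (subtopology M (chart_dom c)). f x \<in> V}"
        using V p c by simp
      ultimately show "\<exists>U. openin M U \<and> p \<in> U \<and> (\<forall>y\<in>U. f y \<in> V)" by blast
    qed (use p in auto)
  qed
  then show ?thesis using continuous_map_eq_topcontinuous_at by blast
qed

section \<open>Smooth functions along fixed point sets\<close>

text \<open>
  A function invariant under \<open>H\<close> has a local maximum along the fixed points of \<open>H\<close> only at critical
  points. Apply \<open>fixed_point_of_penalized_minimum\<close> to \<open>-f\<close>. At a point \<open>q + s w\<close> with \<open>f\<close> increasing in
  direction \<open>w\<close>, the gain in \<open>f\<close> is linear in \<open>s\<close> while the penalty is quadratic in \<open>s\<close>; hence the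
  minimiser lies above \<open>q\<close>.
\<close>
lemma exists_fixed_point_with_larger_value:
  assumes c: "c \<in> \<A>" and q: "q \<in> chart_dom c"
    and H: "subgroup H torus" "closed H" and qH: "q \<in> fixed_points \<rho> M H"
    and f: "smooth_function \<A> f" and inv: "\<And>h p. \<lbrakk>h \<in> H; p \<in> topspace M\<rbrakk> \<Longrightarrow> f (\<rho> h p) = f p"
    and v: "v \<in> E" "differential c f q v \<noteq> 0"
    and U: "openin M U" "q \<in> U"
  shows "\<exists>z\<in>fixed_points \<rho> M H \<inter> U. f z > f q"
proof -
  define a where "a = chart_map c q"
  define F where "F = f \<circ> chart_inv c"
  have a: "a \<in> chart_img c" "a \<in> E" "chart_inv c a = q"
    using chart_map_in_img[OF q] chart_img_subset[OF c] c q by (auto simp: a_def)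
  have F: "Ck_on k (chart_img c) F" for k
    unfolding F_def by (rule smooth_function_in_chart[OF f c])
  obtain F' where F': "(F has_derivative F') (at a within chart_img c)"
    using F[of "Suc 0"] a(1) by auto
  have line: "((\<lambda>s. F (a + s *\<^sub>R u)) has_vector_derivative F' u) (at 0)" if "u \<in> E" for u
    by (rule has_vector_derivative_along_line(1)[OF model_subspace img_open[OF c] a(1) that F'])
  have "F' v \<noteq> 0"
    using v has_vector_derivative_along_line(2)[OF model_subspace img_open[OF c] a(1) v(1) F']
    by (simp add: differential_def F_def a_def)
  then obtain w where w: "w \<in> E" "F' w > 0"
    using v(1) subspace_neg[OF model_subspace v(1)] linear_neg[OF has_derivative_linear[OF F'], of v]
    by (cases "F' v > 0") auto
  obtain r L C where r: "r > 0" and img: "E \<inter> cball a r \<subseteq> chart_img c"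
    and dom: "\<And>h y. \<lbrakk>h \<in> H; y \<in> E \<inter> cball a r\<rbrakk> \<Longrightarrow> \<rho> h (chart_inv c y) \<in> chart_dom c"
    and loc: "uniformly_C2_local_action H (local_act c) E (E \<inter> cball a r) L C"
  proof -
    have fix_q: "\<rho> h q = q" if "h \<in> H" for h using qH that by (simp add: fixed_points_def)
    have "\<exists>r L C. r > 0 \<and> E \<inter> cball a r \<subseteq> chart_img c \<and>
      (\<forall>h\<in>H. \<forall>y\<in>E \<inter> cball a r. \<rho> h (chart_inv c y) \<in> chart_dom c) \<and>
      uniformly_C2_local_action H (local_act c) E (E \<inter> cball a r) L C"
      unfolding a_def by (rule local_action[OF c q H]) (rule fix_q)
    then show thesis by (elim exE conjE) (rule that; simp)
  qed
  interpret loc: uniformly_C2_local_action H "local_act c" E "E \<inter> cball a r" L C by (rule loc)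
  obtain r' where r': "r' > 0" "\<And>y. y \<in> E \<inter> cball a r' \<Longrightarrow> chart_inv c y \<in> U"
    by (rule cball_in_chart[OF c q U, folded a_def]) simp
  obtain \<delta>\<^sub>0 where \<delta>\<^sub>0: "\<delta>\<^sub>0 > 0"
    "\<And>\<delta>. \<lbrakk>0 < \<delta>; \<delta> \<le> \<delta>\<^sub>0\<rbrakk> \<Longrightarrow> 2 * \<delta> * C + 4 * \<delta>\<^sup>2 * C\<^sup>2 \<le> 1 / (8 * L\<^sup>2)"
    by (rule loc.small_radius) simp
  define \<delta> where "\<delta> = min \<delta>\<^sub>0 (min r r')"
  have \<delta>: "\<delta> > 0" "\<delta> \<le> \<delta>\<^sub>0" "\<delta> \<le> r" "\<delta> \<le> r'" using \<delta>\<^sub>0 r r' by (auto simp: \<delta>_def)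
  obtain A where A: "A > 0" "\<And>x y. closed_segment x y \<subseteq> E \<inter> cball a r \<Longrightarrow>
       norm (F (midpoint x y) - (1/2) *\<^sub>R (F x + F y)) \<le> A * (norm (x - y))\<^sup>2"
    using C2_imp_midpoint_estimate_on_segments[OF F loc.compact_B img] by blast
  define K where "K = 8 * L\<^sup>2 * (A + 1)"
  have K: "K > 0" "A < K / (8 * L\<^sup>2)"
    using A(1) loc.L_pos by (auto simp: K_def)
  have a_fix: "local_act c h a = a" if "h \<in> H" for h
    using fixed_points_in_chart[OF c a(1), of H] dom r a qH that by auto
  define g where "g s = F (a + s *\<^sub>R w) - K * (L * s * norm w)\<^sup>2" for s
  have "((\<lambda>s. F (a + s *\<^sub>R w)) has_real_derivative F' w) (at 0)"
    using line[OF w(1)] by (simp add: has_real_derivative_iff_has_vector_derivative)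
  then have "(g has_real_derivative F' w) (at 0)"
    unfolding g_def by (auto intro!: derivative_eq_intros)
  from DERIV_pos_inc_right[OF this w(2)]
  obtain d where d: "d > 0" "\<And>s. 0 < s \<Longrightarrow> s < d \<Longrightarrow> g 0 < g s" by auto
  \<comment> \<open>With \<open>s b \<le> \<delta>\<close>, both the step \<open>s |w|\<close> and the orbit radius \<open>L s |w|\<close> are at most \<open>\<delta>\<close>.\<close>
  define b where "b = (L + 1) * norm w + 1"
  have b: "b > 0" using loc.L_pos by (auto simp: b_def add_nonneg_pos)
  define s where "s = min (d / 2) (\<delta> / b)"
  have s: "0 < s" "s < d" "s * b \<le> \<delta>"
  proof -
    show "0 < s" "s < d" using d \<delta> b by (auto simp: s_def)
    have "s * b \<le> \<delta> / b * b" using b by (intro mult_right_mono) (auto simp: s_def)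
    then show "s * b \<le> \<delta>" using b by simp
  qed
  have "s * b = L * s * norm w + s * norm w + s" by (simp add: b_def algebra_simps)
  moreover have "0 \<le> L * s * norm w" "0 \<le> s * norm w" using s loc.L_pos by simp_all
  ultimately have small: "L * s * norm w \<le> \<delta>" "s * norm w \<le> \<delta>" using s by linarith+
  define y where "y = a + s *\<^sub>R w"
  have yB: "y \<in> E \<inter> cball a r"
    using a(2) w(1) model_subspace small(2) \<delta>(3) s(1)
    by (auto simp: y_def subspace_add subspace_scale dist_norm)
  have aB: "a \<in> E \<inter> cball a r" using a(2) r by simp
  obtain z where z: "z \<in> E \<inter> cball a r" "\<And>h. h \<in> H \<Longrightarrow> local_act c h z = z"
    "norm (z - a) \<le> \<delta>" "- F z + K * (norm (z - a))\<^sup>2 \<le> - F y + K * (L * s * norm w)\<^sup>2"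
  proof (rule loc.fixed_point_of_penalized_minimum[OF \<delta>(1) \<delta>\<^sub>0(2)[OF \<delta>(1,2)] _ yB _ small(1),
        where f = "\<lambda>y. - F y" and A = A and K = K and c = a])
    show "cball a \<delta> \<inter> E \<subseteq> E \<inter> cball a r" using \<delta>(3) by auto
    show "norm (local_act c h y - a) \<le> L * s * norm w" if "h \<in> H" for h
      using loc.lipschitz[OF that yB aB] a_fix[OF that] s(1) by (simp add: y_def mult.assoc)
    show "continuous_on (E \<inter> cball a r) (\<lambda>y. - F y)"
      using F[of 0] img by (auto intro: continuous_on_subset continuous_on_minus)
    show "- F (midpoint x y) \<le> (- F x + - F y) / 2 + A * (norm (x - y))\<^sup>2"
      if "x \<in> E \<inter> cball a r" "y \<in> E \<inter> cball a r" for x y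
    proof -
      have "closed_segment x y \<subseteq> E \<inter> cball a r"
        using closed_segment_subset[OF that loc.convex_B] .
      from A(2)[OF this] show ?thesis by (simp add: field_simps)
    qed
    show "- F (local_act c h u) = - F u" if "h \<in> H" "u \<in> E \<inter> cball a r" for h u
    proof -
      have "chart_inv c u \<in> topspace M"
        using chart_inv_in_topspace[OF c subsetD[OF img that(2)]] .
      then show ?thesis using dom[OF that] inv[OF that(1)] c by (simp add: F_def local_act_def)
    qed
    show "K > 0" "A < K / (8 * L\<^sup>2)" by (rule K)+
  qed blast
  have "F a < F y - K * (L * s * norm w)\<^sup>2"
    using d(2)[OF s(1,2)] by (simp add: g_def y_def)
  also have "\<dots> \<le> F z - K * (norm (z - a))\<^sup>2" using z(4) by simp
  also have "\<dots> \<le> F z" using K(1) by simp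
  finally have "f q < f (chart_inv c z)" using a(3) by (simp add: F_def)
  moreover have "chart_inv c z \<in> fixed_points \<rho> M H"
    using fixed_points_in_chart[OF c, of z H] img z(1,2) dom by blast
  moreover have "chart_inv c z \<in> U"
    using r'(2)[of z] z(1,3) \<delta>(4) by (auto simp: dist_norm norm_minus_commute)
  ultimately show ?thesis by blast
qed

text \<open>
  At a critical point the Taylor estimate leaves only the quadratic term.
\<close>
lemma locally_constant_on_critical_fixed_points:
  assumes H: "subgroup H torus" "closed H"
    and f: "smooth_function \<A> f"
    and crit: "\<And>p c v. \<lbrakk>p \<in> fixed_points \<rho> M H; c \<in> \<A>; p \<in> chart_dom c; v \<in> E\<rbrakk> \<Longrightarrow> differential c f p v = 0"
  shows "locally_constant_on M (fixed_points \<rho> M H) f"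
  unfolding locally_constant_on_def
proof
  fix q assume qH: "q \<in> fixed_points \<rho> M H"
  then have "q \<in> topspace M" by (simp add: fixed_points_def)
  then obtain c where c: "c \<in> \<A>" and q: "q \<in> chart_dom c" by (rule chart_at)
  define a where "a = chart_map c q"
  define F where "F = f \<circ> chart_inv c"
  have a: "a \<in> chart_img c" "a \<in> E" "chart_inv c a = q"
    using chart_map_in_img[OF q] chart_img_subset[OF c] c q by (auto simp: a_def)
  have F: "Ck_on k (chart_img c) F" for k
    unfolding F_def by (rule smooth_function_in_chart[OF f c])
  obtain r L C where r: "r > 0" and img: "E \<inter> cball a r \<subseteq> chart_img c"
    and dom: "\<And>h y. \<lbrakk>h \<in> H; y \<in> E \<inter> cball a r\<rbrakk> \<Longrightarrow> \<rho> h (chart_inv c y) \<in> chart_dom c"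
    and loc: "uniformly_C2_local_action H (local_act c) E (E \<inter> cball a r) L C"
  proof -
    have fix_q: "\<rho> h q = q" if "h \<in> H" for h using qH that by (simp add: fixed_points_def)
    have "\<exists>r L C. r > 0 \<and> E \<inter> cball a r \<subseteq> chart_img c \<and>
      (\<forall>h\<in>H. \<forall>y\<in>E \<inter> cball a r. \<rho> h (chart_inv c y) \<in> chart_dom c) \<and>
      uniformly_C2_local_action H (local_act c) E (E \<inter> cball a r) L C"
      unfolding a_def by (rule local_action[OF c q H]) (rule fix_q)
    then show thesis by (elim exE conjE) (rule that; simp)
  qed
  interpret loc: uniformly_C2_local_action H "local_act c" E "E \<inter> cball a r" L C by (rule loc)
  have "\<exists>A. \<forall>x\<in>E \<inter> cball a r. \<forall>y\<in>E \<inter> cball a r. (\<forall>h\<in>H. local_act c h x = x) \<longrightarrow> \<bar>F x - F y\<bar> \<le> A * (norm (x - y))\<^sup>2"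
  proof (rule C2_imp_taylor_estimate_on_segments[OF F loc.compact_B img])
    fix F' A
    assume F': "\<And>x. x \<in> chart_img c \<Longrightarrow> (F has_derivative F' x) (at x within chart_img c)"
      and est: "\<And>x y. closed_segment x y \<subseteq> E \<inter> cball a r \<Longrightarrow>
        norm (F y - F x - F' x (y - x)) \<le> A * (norm (x - y))\<^sup>2"
    have "\<bar>F x - F y\<bar> \<le> A * (norm (x - y))\<^sup>2"
      if x: "x \<in> E \<inter> cball a r" and y: "y \<in> E \<inter> cball a r" and fix_x: "\<forall>h\<in>H. local_act c h x = x" for x y
    proof -
      have xi: "x \<in> chart_img c" using x img by blast
      have "chart_inv c x \<in> fixed_points \<rho> M H"
        using fixed_points_in_chart[OF c xi] fix_x dom[OF _ x] by blast
      moreover have yx: "y - x \<in> E" using x y model_subspace subspace_diff by blast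
      ultimately have "differential c f (chart_inv c x) (y - x) = 0"
        using crit c chart_inv_in_dom[OF xi] by blast
      then have "F' x (y - x) = 0"
        using has_vector_derivative_along_line(2)[OF model_subspace img_open[OF c] xi yx F'[OF xi]] xi
        by (simp add: differential_def F_def)
      moreover have "closed_segment x y \<subseteq> E \<inter> cball a r"
        using closed_segment_subset[OF x y loc.convex_B] .
      ultimately show ?thesis using est[of x y] by (simp add: abs_minus_commute)
    qed
    then show ?thesis by blast
  qed
  then obtain A where A': "\<forall>x\<in>E \<inter> cball a r. \<forall>y\<in>E \<inter> cball a r.
      (\<forall>h\<in>H. local_act c h x = x) \<longrightarrow> \<bar>F x - F y\<bar> \<le> A * (norm (x - y))\<^sup>2" by (elim exE)
  have A: "\<bar>F x - F y\<bar> \<le> A * (norm (x - y))\<^sup>2"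
    if "x \<in> E \<inter> cball a r" "y \<in> E \<inter> cball a r" "\<And>h. h \<in> H \<Longrightarrow> local_act c h x = x" for x y
    using A'[rule_format, OF that] .
  obtain \<epsilon> where \<epsilon>: "\<epsilon> > 0" "\<And>x y. \<lbrakk>x \<in> E \<inter> cball a r; y \<in> E \<inter> cball a r;
       \<And>h. h \<in> H \<Longrightarrow> local_act c h x = x; \<And>h. h \<in> H \<Longrightarrow> local_act c h y = y;
       norm (x - a) \<le> \<epsilon>; norm (y - a) \<le> \<epsilon>\<rbrakk> \<Longrightarrow> F x = F y"
  proof (rule loc.locally_constant_on_fixed_points[OF r, of a F A])
    show "cball a r \<inter> E \<subseteq> E \<inter> cball a r" by auto
    show "\<bar>F x - F y\<bar> \<le> A * (norm (x - y))\<^sup>2"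
      if "x \<in> E \<inter> cball a r" "y \<in> E \<inter> cball a r" "\<And>h. h \<in> H \<Longrightarrow> local_act c h x = x" for x y
      using that by (rule A)
    fix \<epsilon> :: real
    assume 1: "\<epsilon> > 0" and 2: "\<And>x y. \<lbrakk>x \<in> E \<inter> cball a r; y \<in> E \<inter> cball a r;
       \<And>h. h \<in> H \<Longrightarrow> local_act c h x = x; \<And>h. h \<in> H \<Longrightarrow> local_act c h y = y;
       norm (x - a) \<le> \<epsilon>; norm (y - a) \<le> \<epsilon>\<rbrakk> \<Longrightarrow> F x = F y"
    show thesis by (rule that[OF 1 2])
  qed
  define V where "V = {p \<in> chart_dom c. chart_map c p \<in> ball a (min r \<epsilon>)}"
  have "openin M V" unfolding V_def by (rule openin_chart_ball[OF c])
  then have "openin (subtopology M (fixed_points \<rho> M H)) (fixed_points \<rho> M H \<inter> V)"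
    by (metis inf_commute openin_subtopology)
  moreover have "q \<in> fixed_points \<rho> M H \<inter> V" using qH q r \<epsilon>(1) by (simp add: V_def a_def)
  moreover have "f p = f q" if p: "p \<in> fixed_points \<rho> M H \<inter> V" for p
  proof -
    define x where "x = chart_map c p"
    have pc: "p \<in> chart_dom c" using p by (simp add: V_def)
    have xi: "x \<in> chart_img c" and px: "chart_inv c x = p"
      using chart_map_in_img[OF pc] chart_inv_map[OF c pc] by (simp_all add: x_def)
    have x: "x \<in> E \<inter> cball a r" "norm (x - a) \<le> \<epsilon>"
      using p xi chart_img_subset[OF c] by (auto simp: V_def x_def dist_norm norm_minus_commute)
    have aB: "a \<in> E \<inter> cball a r" using a(2) r by simp
    have "F x = F a"
    proof (rule \<epsilon>(2)[OF x(1) aB])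
      show "local_act c h x = x" if "h \<in> H" for h
        using fixed_points_in_chart[OF c xi, of H] dom[OF _ x(1)] p px that by auto
      show "local_act c h a = a" if "h \<in> H" for h
        using fixed_points_in_chart[OF c a(1), of H] dom[OF _ aB] qH a(3) that by auto
    qed (use x \<epsilon> in auto)
    then show ?thesis by (simp add: F_def px a(3))
  qed
  ultimately show "\<exists>U. openin (subtopology M (fixed_points \<rho> M H)) U \<and> q \<in> U \<and> (\<forall>p\<in>U. f p = f q)"
    by blast
qed

section \<open>Stationary orbits\<close>

lemma orbit_curve_in_chart:
  assumes c: "c \<in> \<A>" and q: "q \<in> chart_dom c"
  obtains s\<^sub>0 where "s\<^sub>0 > 0" "\<And>s. \<bar>s\<bar> \<le> s\<^sub>0 \<Longrightarrow> \<rho> (torus_exp (s *\<^sub>R \<xi>)) q \<in> chart_dom c"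
proof -
  have qM: "q \<in> topspace M" using chart_dom_subset[OF c] q by blast
  have "continuous_map euclideanreal (top_of_set (carrier torus)) (\<lambda>s. torus_exp (s *\<^sub>R \<xi>))"
  proof -
    have "continuous_on UNIV (\<lambda>s. torus_exp (s *\<^sub>R \<xi>))"
      by (rule continuous_on_compose2[OF continuous_on_torus_exp[of UNIV]]) (auto intro: continuous_intros)
    then show ?thesis by (simp add: continuous_map_in_subtopology Pi_iff)
  qed
  from continuous_map_compose[OF this continuous_map_orbit[OF qM]]
  have "continuous_map euclideanreal M (\<lambda>s. \<rho> (torus_exp (s *\<^sub>R \<xi>)) q)" by (simp add: o_def)
  from openin_continuous_map_preimage[OF this dom_open[OF c]]
  have op: "open {s. \<rho> (torus_exp (s *\<^sub>R \<xi>)) q \<in> chart_dom c}" (is "open ?S")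
    by simp
  have "\<rho> (torus_exp (0 *\<^sub>R \<xi>)) q = q" using act_one[OF qM] by simp
  then have "0 \<in> ?S" using q by simp
  from open_contains_cball[THEN iffD1, OF op, rule_format, OF this]
  obtain s\<^sub>0 where s\<^sub>0: "s\<^sub>0 > 0" "cball 0 s\<^sub>0 \<subseteq> ?S" by (elim exE conjE)
  show ?thesis
  proof (rule that[OF s\<^sub>0(1)])
    show "\<rho> (torus_exp (s *\<^sub>R \<xi>)) q \<in> chart_dom c" if "\<bar>s\<bar> \<le> s\<^sub>0" for s
      using subsetD[OF s\<^sub>0(2), of s] that by simp
  qed
qed

text \<open>
  The nondegeneracy of the symplectic form only concerns vectors in the model space \<open>E\<close>; the velocity
  of an orbit is such a vector as a limit of difference quotients in \<open>E\<close>.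
\<close>
lemma generating_field_props:
  assumes c: "c \<in> \<A>" and q: "q \<in> chart_dom c"
  shows "((\<lambda>s. chart_map c (\<rho> (torus_exp (s *\<^sub>R \<xi>)) q)) has_vector_derivative generating_field \<rho> c \<xi> q) (at 0)"
    and "generating_field \<rho> c \<xi> q \<in> E"
proof -
  define a where "a = chart_map c q"
  define \<gamma> where "\<gamma> s = chart_map c (\<rho> (torus_exp (s *\<^sub>R \<xi>)) q)" for s
  have qM: "q \<in> topspace M" using chart_dom_subset[OF c] q by blast
  have a: "a \<in> chart_img c" "chart_inv c a = q"
    using chart_map_in_img[OF q] c q by (auto simp: a_def)
  define f where "f = (\<lambda>(\<xi>, x). chart_map c (\<rho> (torus_exp \<xi>) (chart_inv c x)))"
  have "Ck_on (Suc 0) (act_domain c) f"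
    using smooth_action c by (auto simp del: Ck_on.simps simp: smooth_torus_action_def smooth_on_def f_def)
  then obtain D where D: "\<forall>z\<in>act_domain c. (f has_derivative D z) (at z within act_domain c)"
    unfolding Ck_on.simps by (elim exE conjE)
  have mem: "(0, a) \<in> act_domain c" using a q act_one[OF qM] by simp
  define f' where "f' = D (0, a)"
  have f': "(f has_derivative f') (at (0, a) within act_domain c)"
    unfolding f'_def using D mem by (rule bspec)
  have "subspace (UNIV \<times> E :: ((real^'n) \<times> 'e) set)" 
    using model_subspace by (auto simp: subspace_def zero_prod_def)
  moreover have "(\<xi>, 0) \<in> (UNIV \<times> E :: ((real^'n) \<times> 'e) set)" using subspace_0[OF model_subspace] by simp
  ultimately have "((\<lambda>s. f ((0, a) + s *\<^sub>R (\<xi>, 0))) has_vector_derivative f' (\<xi>, 0)) (at 0)"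
    by (rule has_vector_derivative_along_line(1)[OF _ openin_act_domain[OF c] mem _ f'])
  moreover have "f ((0, a) + s *\<^sub>R (\<xi>, 0)) = \<gamma> s" for s
    by (simp add: f_def \<gamma>_def a(2) scaleR_Pair)
  ultimately have D: "(\<gamma> has_vector_derivative f' (\<xi>, 0)) (at 0)" by simp
  then have gen: "generating_field \<rho> c \<xi> q = f' (\<xi>, 0)"
    unfolding generating_field_def \<gamma>_def by (rule vector_derivative_at)
  show "((\<lambda>s. chart_map c (\<rho> (torus_exp (s *\<^sub>R \<xi>)) q)) has_vector_derivative generating_field \<rho> c \<xi> q) (at 0)"
    using D unfolding gen \<gamma>_def .
  obtain s\<^sub>0 where s\<^sub>0: "s\<^sub>0 > 0" "\<And>s. \<bar>s\<bar> \<le> s\<^sub>0 \<Longrightarrow> \<rho> (torus_exp (s *\<^sub>R \<xi>)) q \<in> chart_dom c"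
    by (rule orbit_curve_in_chart[OF c q, where \<xi> = \<xi>]) simp
  have \<gamma>E: "\<gamma> s \<in> E" if "\<bar>s\<bar> \<le> s\<^sub>0" for s
    using chart_map_in_img[OF s\<^sub>0(2)[OF that]] chart_img_subset[OF c] by (auto simp: \<gamma>_def)
  have lim: "((\<lambda>s. (1 / s) *\<^sub>R (\<gamma> s - \<gamma> 0)) \<longlongrightarrow> f' (\<xi>, 0)) (at 0)"
  proof (rule Lim_null[THEN iffD2], rule tendsto_norm_zero_cancel, rule Lim_transform_eventually)
    show "((\<lambda>s. norm (\<gamma> (0 + s) - \<gamma> 0 - s *\<^sub>R f' (\<xi>, 0)) / norm s) \<longlongrightarrow> 0) (at 0)"
      using D[unfolded has_vector_derivative_def has_derivative_at] by (rule conjunct2)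
    have quot: "norm (\<gamma> (0 + s) - \<gamma> 0 - s *\<^sub>R f' (\<xi>, 0)) / norm s
        = norm ((1 / s) *\<^sub>R (\<gamma> s - \<gamma> 0) - f' (\<xi>, 0))" if "s \<noteq> 0" for s
    proof -
      have "(1 / s) *\<^sub>R (\<gamma> s - \<gamma> 0) - f' (\<xi>, 0) = (1 / s) *\<^sub>R (\<gamma> s - \<gamma> 0 - s *\<^sub>R f' (\<xi>, 0))"
        using that by (simp add: scaleR_diff_right)
      then show ?thesis by simp
    qed
    show "\<forall>\<^sub>F s in at 0. norm (\<gamma> (0 + s) - \<gamma> 0 - s *\<^sub>R f' (\<xi>, 0)) / norm s
        = norm ((1 / s) *\<^sub>R (\<gamma> s - \<gamma> 0) - f' (\<xi>, 0))"
      by (rule eventually_mono[OF eventually_neq_at_within[of 0]]) (rule quot)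
  qed
  have "eventually (\<lambda>s. (1 / s) *\<^sub>R (\<gamma> s - \<gamma> 0) \<in> E) (at 0)"
    unfolding eventually_at
  proof (intro exI conjI ballI impI)
    fix s :: real assume s: "s \<noteq> 0 \<and> dist s 0 < s\<^sub>0"
    have "\<gamma> s \<in> E" "\<gamma> 0 \<in> E" using \<gamma>E[of s] \<gamma>E[of 0] s s\<^sub>0(1) by simp_all
    then show "(1 / s) *\<^sub>R (\<gamma> s - \<gamma> 0) \<in> E"
      using subspace_diff[OF model_subspace] subspace_scale[OF model_subspace] by blast
  qed (rule s\<^sub>0(1))
  then show "generating_field \<rho> c \<xi> q \<in> E"
    unfolding gen by (rule Lim_in_closed_set[OF closed_subspace[OF model_subspace]]) (simp, rule lim)
qed

text \<open>
  By the group law, the displacement of the orbit curve from time \<open>t\<close> to time \<open>t + u\<close> is the image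
  under \<open>exp(t \<xi>)\<close> of its displacement from time \<open>0\<close> to time \<open>u\<close>. The latter is \<open>o(u)\<close>, and the maps
  \<open>exp(t \<xi>)\<close> are uniformly Lipschitz for small \<open>t\<close>; so the curve has derivative zero and is
  constant for small times, hence for all times.
\<close>
lemma stationary_if_generating_field_zero:
  assumes c: "c \<in> \<A>" and q: "q \<in> chart_dom c" and zero: "generating_field \<rho> c \<xi> q = 0"
  shows "\<rho> (torus_exp (s *\<^sub>R \<xi>)) q = q"
proof -
  define a where "a = chart_map c q"
  define \<gamma> where "\<gamma> s = chart_map c (\<rho> (torus_exp (s *\<^sub>R \<xi>)) q)" for s
  have qM: "q \<in> topspace M" using chart_dom_subset[OF c] q by blast
  have a: "a \<in> E" using chart_map_in_img[OF q] chart_img_subset[OF c] by (auto simp: a_def)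
  have \<gamma>0: "\<gamma> 0 = a" using act_one[OF qM] by (simp add: \<gamma>_def a_def)
  obtain s\<^sub>0 where s\<^sub>0: "s\<^sub>0 > 0" "\<And>s. \<bar>s\<bar> \<le> s\<^sub>0 \<Longrightarrow> \<rho> (torus_exp (s *\<^sub>R \<xi>)) q \<in> chart_dom c"
    by (rule orbit_curve_in_chart[OF c q, where \<xi> = \<xi>]) simp
  have \<gamma>E: "\<gamma> s \<in> E" if "\<bar>s\<bar> \<le> s\<^sub>0" for s
    using chart_map_in_img[OF s\<^sub>0(2)[OF that]] chart_img_subset[OF c] by (auto simp: \<gamma>_def)
  have "compact ((\<lambda>s. s *\<^sub>R \<xi>) ` {-s\<^sub>0..s\<^sub>0})"
    by (intro compact_continuous_image continuous_intros) simp
  then obtain r L where r: "r > 0" and L: "L > 0" and lip: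
    "\<And>t x y. \<lbrakk>\<bar>t\<bar> \<le> s\<^sub>0; x \<in> E \<inter> cball a r; y \<in> E \<inter> cball a r\<rbrakk> \<Longrightarrow>
      norm (local_act c (torus_exp (t *\<^sub>R \<xi>)) x - local_act c (torus_exp (t *\<^sub>R \<xi>)) y) \<le> L * norm (x - y)"
  proof (rule local_estimates[OF c q])
    show "\<rho> (torus_exp \<zeta>) q \<in> chart_dom c" if "\<zeta> \<in> (\<lambda>s. s *\<^sub>R \<xi>) ` {-s\<^sub>0..s\<^sub>0}" for \<zeta>
      using that s\<^sub>0(2) by auto
    fix r L C :: real
    assume 1: "r > 0" "L > 0" and 2: "\<And>\<zeta> x y. \<lbrakk>\<zeta> \<in> (\<lambda>s. s *\<^sub>R \<xi>) ` {-s\<^sub>0..s\<^sub>0};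
        x \<in> E \<inter> cball (chart_map c q) r; y \<in> E \<inter> cball (chart_map c q) r\<rbrakk> \<Longrightarrow>
       norm (local_act c (torus_exp \<zeta>) x - local_act c (torus_exp \<zeta>) y) \<le> L * norm (x - y)"
    show thesis
    proof (rule that[OF 1])
      show "norm (local_act c (torus_exp (t *\<^sub>R \<xi>)) x - local_act c (torus_exp (t *\<^sub>R \<xi>)) y) \<le> L * norm (x - y)"
        if "\<bar>t\<bar> \<le> s\<^sub>0" "x \<in> E \<inter> cball a r" "y \<in> E \<inter> cball a r" for t x y
      proof -
        have "t *\<^sub>R \<xi> \<in> (\<lambda>s. s *\<^sub>R \<xi>) ` {-s\<^sub>0..s\<^sub>0}"
          using that(1) by (intro imageI) auto
        then show ?thesis by (rule 2) (use that(2,3) in \<open>simp_all add: a_def\<close>)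
      qed
    qed
  qed
  have "(\<gamma> has_derivative (\<lambda>_. 0)) (at 0)"
    using generating_field_props(1)[OF c q, of \<xi>] zero
    unfolding \<gamma>_def has_vector_derivative_def by simp
  then have "\<forall>e>0. \<exists>d>0. \<forall>u. norm (u - 0) < d \<longrightarrow> norm (\<gamma> u - \<gamma> 0 - 0) \<le> e * norm (u - 0)"
    unfolding has_derivative_at_alt by (elim conjE)
  then have D0: "\<exists>d>0. \<forall>u. \<bar>u\<bar> < d \<longrightarrow> norm (\<gamma> u - a) \<le> e * \<bar>u\<bar>" if "e > 0" for e
    using that unfolding \<gamma>0 by simp
  have shift: "\<gamma> (t + u) = local_act c (torus_exp (t *\<^sub>R \<xi>)) (\<gamma> u)" if "\<bar>u\<bar> \<le> s\<^sub>0" for t u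
    using act_exp_add[OF qM, of "t *\<^sub>R \<xi>" "u *\<^sub>R \<xi>"] s\<^sub>0(2)[OF that] c
    by (simp add: \<gamma>_def local_act_def scaleR_add_left)
  have D: "(\<gamma> has_derivative (\<lambda>_. 0)) (at t)" if t: "\<bar>t\<bar> \<le> s\<^sub>0" for t
    unfolding has_derivative_at_alt
  proof (intro conjI allI impI)
    fix e :: real assume e: "e > 0"
    obtain d where d: "d > 0" "\<And>u. \<bar>u\<bar> < d \<Longrightarrow> norm (\<gamma> u - a) \<le> e / L * \<bar>u\<bar>"
      using D0[of "e / L"] e L by auto
    \<comment> \<open>The third bound keeps \<open>\<gamma> u\<close> in the coordinate ball, since \<open>|\<gamma> u - a| \<le> (e / L) |u|\<close>.\<close>
  define d' where "d' = min d (min s\<^sub>0 (r * L / e))"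
    have "d' > 0" using d(1) s\<^sub>0(1) r L e by (simp add: d'_def)
    moreover have "norm (\<gamma> y - \<gamma> t - 0) \<le> e * norm (y - t)" if y: "norm (y - t) < d'" for y
    proof -
      define u where "u = y - t"
      have u: "\<bar>u\<bar> < d" "\<bar>u\<bar> \<le> s\<^sub>0" "\<bar>u\<bar> \<le> r * L / e" using y by (auto simp: u_def d'_def)
      have "norm (\<gamma> u - a) \<le> e / L * \<bar>u\<bar>" using d(2) u(1) by blast
      also have "\<dots> \<le> e / L * (r * L / e)" using u(3) e L by (intro mult_left_mono) auto
      also have "\<dots> = r" using e L by simp
      finally have "\<gamma> u \<in> E \<inter> cball a r" using \<gamma>E[OF u(2)] by (simp add: dist_norm norm_minus_commute)
      moreover have "a \<in> E \<inter> cball a r" using a r by simp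
      ultimately have "norm (\<gamma> (t + u) - \<gamma> (t + 0)) \<le> L * norm (\<gamma> u - a)"
        using lip[OF t] shift[OF u(2), of t] shift[of 0 t] s\<^sub>0(1) \<gamma>0 by simp
      also have "\<dots> \<le> L * (e / L * \<bar>u\<bar>)" using d(2)[OF u(1)] L by (intro mult_left_mono) auto
      also have "\<dots> = e * \<bar>u\<bar>" using L by simp
      finally show ?thesis by (simp add: u_def)
    qed
    ultimately show "\<exists>d>0. \<forall>y. norm (y - t) < d \<longrightarrow> norm (\<gamma> y - \<gamma> t - 0) \<le> e * norm (y - t)" by blast
  qed simp
  have fix_small: "\<rho> (torus_exp (s *\<^sub>R \<xi>)) q = q" if s: "\<bar>s\<bar> \<le> s\<^sub>0" for s
  proof -
    have "\<exists>k. \<forall>x\<in>{-s\<^sub>0..s\<^sub>0}. \<gamma> x = k"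
    proof (rule has_derivative_zero_constant)
      show "(\<gamma> has_derivative (\<lambda>_. 0)) (at x within {-s\<^sub>0..s\<^sub>0})" if "x \<in> {-s\<^sub>0..s\<^sub>0}" for x
        by (rule has_derivative_at_withinI, rule D) (use that in auto)
    qed simp
    then have "\<gamma> s = \<gamma> 0" using s s\<^sub>0(1) by (auto simp: abs_le_iff)
    then have "chart_map c (\<rho> (torus_exp (s *\<^sub>R \<xi>)) q) = chart_map c q"
      unfolding \<gamma>0 a_def by (simp add: \<gamma>_def)
    then show ?thesis using chart_inv_map[OF c s\<^sub>0(2)[OF s]] chart_inv_map[OF c q] by metis
  qed
  obtain N :: nat where N: "\<bar>s\<bar> / s\<^sub>0 < real N" using reals_Archimedean2 by blast
  then have Npos: "N > 0" using s\<^sub>0(1) by (cases N) (auto simp: field_simps)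
  have small: "\<bar>s / real N\<bar> \<le> s\<^sub>0"
    using N Npos s\<^sub>0(1) by (simp add: field_simps)
  have "\<rho> (torus_exp ((real k * (s / real N)) *\<^sub>R \<xi>)) q = q" for k
  proof (induction k)
    case 0
    then show ?case using act_one[OF qM] by simp
  next
    case (Suc k)
    have "(real (Suc k) * (s / real N)) *\<^sub>R \<xi> = (s / real N) *\<^sub>R \<xi> + (real k * (s / real N)) *\<^sub>R \<xi>"
      by (simp only: of_nat_Suc distrib_right scaleR_add_left mult_1_left)
    then show ?case using act_exp_add[OF qM] Suc.IH fix_small[OF small] by simp
  qed
  from this[of N] show ?thesis using Npos by simp
qed

lemma torus_fixed_if_dense_direction_stationary:
  assumes dense: "carrier torus \<subseteq> closure (range (\<lambda>s. torus_exp (s *\<^sub>R \<xi>)))"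
    and c: "c \<in> \<A>" and q: "q \<in> chart_dom c" and zero: "generating_field \<rho> c \<xi> q = 0"
  shows "q \<in> fixed_points \<rho> M (carrier torus)"
proof -
  have qM: "q \<in> topspace M" using chart_dom_subset[OF c] q by blast
  have "range (\<lambda>s. torus_exp (s *\<^sub>R \<xi>)) \<subseteq> stabilizer torus \<rho> q"
    using stationary_if_generating_field_zero[OF c q zero] by (auto simp: stabilizer_def)
  then have "carrier torus \<subseteq> stabilizer torus \<rho> q"
    using dense closure_minimal[OF _ closed_stabilizer[OF qM]] by blast
  then show ?thesis using qM by (auto simp: fixed_points_def stabilizer_def)
qed

end

section \<open>Locally constant functions\<close>

lemma locally_constant_on_level_set:
  assumes "locally_constant_on X S f"
  shows "openin (subtopology X S) {q \<in> S. f q = v}"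
    and "S \<subseteq> topspace X \<Longrightarrow> closedin (subtopology X S) {q \<in> S. f q = v}"
proof -
  have op: "openin (subtopology X S) {q \<in> S. P (f q)}" for P
  proof (subst openin_subopen, intro ballI)
    fix q assume q: "q \<in> {q \<in> S. P (f q)}"
    then obtain U where U: "openin (subtopology X S) U" "q \<in> U" "\<forall>y\<in>U. f y = f q"
      using assms unfolding locally_constant_on_def by blast
    have "U \<subseteq> S" using openin_subset[OF U(1)] by simp
    moreover have "P (f y)" if "y \<in> U" for y
      using U(3)[rule_format, OF that] q by simp
    ultimately show "\<exists>T. openin (subtopology X S) T \<and> q \<in> T \<and> T \<subseteq> {q \<in> S. P (f q)}"
      using U(1,2) by blast
  qed
  show "openin (subtopology X S) {q \<in> S. f q = v}" by (rule op)
  assume S: "S \<subseteq> topspace X"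
  have "S - {q \<in> S. f q = v} = {q \<in> S. f q \<noteq> v}" by auto
  then show "closedin (subtopology X S) {q \<in> S. f q = v}"
    using op[of "\<lambda>y. y \<noteq> v"] S by (simp add: closedin_def Int_absorb1 subset_iff)
qed

lemma locally_constant_on_Pair:
  assumes "locally_constant_on X S f" "locally_constant_on X S g"
  shows "locally_constant_on X S (\<lambda>q. (f q, g q))"
  unfolding locally_constant_on_def
proof
  fix p assume p: "p \<in> S"
  obtain U where U: "openin (subtopology X S) U" "p \<in> U" "\<forall>q\<in>U. f q = f p"
    using assms(1) p unfolding locally_constant_on_def by blast
  obtain V where V: "openin (subtopology X S) V" "p \<in> V" "\<forall>q\<in>V. g q = g p"
    using assms(2) p unfolding locally_constant_on_def by blast
  show "\<exists>W. openin (subtopology X S) W \<and> p \<in> W \<and> (\<forall>q\<in>W. (f q, g q) = (f p, g p))"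
  proof (intro exI conjI ballI)
    show "openin (subtopology X S) (U \<inter> V)" using U(1) V(1) by (rule openin_Int)
    show "p \<in> U \<inter> V" using U(2) V(2) by blast
    show "(f q, g q) = (f p, g p)" if "q \<in> U \<inter> V" for q
      using U(3)[rule_format, of q] V(3)[rule_format, of q] that by simp
  qed
qed

lemma locally_constant_on_subset:
  assumes "locally_constant_on X S f" "T \<subseteq> S"
  shows "locally_constant_on X T f"
  unfolding locally_constant_on_def
proof
  fix p assume p: "p \<in> T"
  then obtain U where U: "openin (subtopology X S) U" "p \<in> U" "\<forall>q\<in>U. f q = f p"
    using assms unfolding locally_constant_on_def by blast
  obtain W where W: "openin X W" "U = W \<inter> S" using U(1) by (auto simp: openin_subtopology)
  have "openin (subtopology X T) (W \<inter> T)" using W(1) by (auto simp: openin_subtopology)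
  then show "\<exists>U. openin (subtopology X T) U \<and> p \<in> U \<and> (\<forall>q\<in>U. f q = f p)"
    using U W p assms(2) by blast
qed

lemma locally_constant_on_compose:
  assumes "locally_constant_on X S f" "\<And>p. p \<in> S \<Longrightarrow> g p = G (f p)"
  shows "locally_constant_on X S g"
  unfolding locally_constant_on_def
proof
  fix p assume p: "p \<in> S"
  obtain U where U: "openin (subtopology X S) U" "p \<in> U" "\<forall>q\<in>U. f q = f p"
    using assms(1) p unfolding locally_constant_on_def by blast
  have "U \<subseteq> S" using openin_subset[OF U(1)] by simp
  then have "g q = g p" if "q \<in> U" for q
    using U(3)[rule_format, OF that] assms(2)[of q] assms(2)[OF p] that by auto
  then show "\<exists>U. openin (subtopology X S) U \<and> p \<in> U \<and> (\<forall>q\<in>U. g q = g p)"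
    using U(1,2) by blast
qed

lemma locally_constant_on_connected:
  assumes f: "locally_constant_on X S f" and S: "S \<subseteq> topspace X"
    and F: "connectedin (subtopology X S) F" and p: "p \<in> F" and q: "q \<in> F"
  shows "f p = f q"
proof -
  have "F \<subseteq> S" using connectedin_subset_topspace[OF F] by auto
  have "F \<subseteq> {x \<in> S. f x = f q} \<or> disjnt F {x \<in> S. f x = f q}"
    by (rule connectedin_clopen_cases[OF F locally_constant_on_level_set(2)[OF f S] locally_constant_on_level_set(1)[OF f]])
  then show ?thesis using p q \<open>F \<subseteq> S\<close> by (auto simp: disjnt_iff)
qed

section \<open>Hamiltonian functions and torus-fixed points\<close>

lemma Ck_on_diff:
  "\<lbrakk>Ck_on k S f; Ck_on k S g\<rbrakk> \<Longrightarrow> Ck_on k S (\<lambda>x. f x - g x)"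
proof (induction k arbitrary: f g)
  case 0
  then show ?case by (simp add: continuous_on_diff)
next
  case (Suc k)
  obtain f' where f': "\<forall>x\<in>S. (f has_derivative f' x) (at x within S)" "\<forall>v. Ck_on k S (\<lambda>x. f' x v)"
    using Suc.prems(1) unfolding Ck_on.simps by (elim exE conjE)
  obtain g' where g': "\<forall>x\<in>S. (g has_derivative g' x) (at x within S)" "\<forall>v. Ck_on k S (\<lambda>x. g' x v)"
    using Suc.prems(2) unfolding Ck_on.simps by (elim exE conjE)
  show ?case
    unfolding Ck_on.simps
  proof (intro exI[of _ "\<lambda>x v. f' x v - g' x v"] conjI ballI allI)
    show "((\<lambda>x. f x - g x) has_derivative (\<lambda>v. f' x v - g' x v)) (at x within S)" if "x \<in> S" for x
      using f'(1) g'(1) that by (intro has_derivative_diff) auto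
    show "Ck_on k S (\<lambda>x. f' x v - g' x v)" for v
      using f'(2) g'(2) by (intro Suc.IH) auto
  qed
qed

lemma subgroup_torus_one: "subgroup {1} torus" "closed {1 :: complex^'n}"
  using group.triv_subgroup[OF group_torus] by simp_all

locale hamiltonian_torus_manifold =
  symplectic_manifold M E \<A> \<omega> + torus_manifold M E \<A> \<rho>
  for M :: "'m topology" and E :: "'e::euclidean_space set" and \<A> :: "('m, 'e) chart set"
    and \<omega> :: "('m, 'e) form2" and \<rho> :: "complex^'n \<Rightarrow> 'm \<Rightarrow> 'm" +
  assumes compact: "compact_space M"
    and hamiltonian: "hamiltonian_torus_action M E \<A> \<omega> \<rho>"
begin

text \<open>
  The vector field of \<open>\<xi>\<close> is the Hamiltonian vector field of \<open>f\<close>; the components of a moment map are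
  such functions.
\<close>
definition generates_flow :: "('m \<Rightarrow> real) \<Rightarrow> real^'n \<Rightarrow> bool" where
  "generates_flow f \<xi> \<longleftrightarrow> smooth_function \<A> f \<and>
     (\<forall>c\<in>\<A>. \<forall>p\<in>chart_dom c. \<forall>v\<in>E. differential c f p v = \<omega> c p (generating_field \<rho> c \<xi> p) v)"

lemma generates_flowD:
  assumes "generates_flow f \<xi>"
  shows "smooth_function \<A> f"
    and "\<lbrakk>c \<in> \<A>; p \<in> chart_dom c; v \<in> E\<rbrakk> \<Longrightarrow> differential c f p v = \<omega> c p (generating_field \<rho> c \<xi> p) v"
  using assms by (simp_all add: generates_flow_def)

lemma generating_field_zero_if_critical:
  assumes f: "generates_flow f \<xi>" and c: "c \<in> \<A>" and q: "q \<in> chart_dom c"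
    and crit: "\<And>v. v \<in> E \<Longrightarrow> differential c f q v = 0"
  shows "generating_field \<rho> c \<xi> q = 0"
  by (rule form_nondegenerate[OF c q generating_field_props(2)[OF c q]])
     (simp add: generates_flowD(2)[OF f c q, symmetric] crit)

lemma critical_if_torus_fixed:
  assumes f: "generates_flow f \<xi>" and c: "c \<in> \<A>" and q: "q \<in> chart_dom c"
    and fixed: "q \<in> fixed_points \<rho> M (carrier torus)" and v: "v \<in> E"
  shows "differential c f q v = 0"
proof -
  have "\<rho> (torus_exp (s *\<^sub>R \<xi>)) q = q" for s
    using fixed torus_exp_in_torus by (auto simp: fixed_points_def)
  then have "generating_field \<rho> c \<xi> q = 0" by (simp add: generating_field_def)
  then show ?thesis
    using generates_flowD(2)[OF f c q v] bilinear_lzero[OF form_bilinear[OF c q]] by simp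
qed

lemma locally_constant_on_torus_fixed_points:
  assumes "generates_flow f \<xi>"
  shows "locally_constant_on M (fixed_points \<rho> M (carrier torus)) f"
proof (rule locally_constant_on_critical_fixed_points)
  show "subgroup (carrier torus) torus" "closed (carrier torus :: (complex^'n) set)"
    using subtorus_torus by (auto simp: subtorus_def)
  show "smooth_function \<A> f" using generates_flowD(1)[OF assms] .
  show "differential c f p v = 0"
    if "p \<in> fixed_points \<rho> M (carrier torus)" "c \<in> \<A>" "p \<in> chart_dom c" "v \<in> E" for p c v
    using critical_if_torus_fixed[OF assms that(2,3,1,4)] .
qed

lemma differential_diff:
  assumes f: "smooth_function \<A> f" and g: "smooth_function \<A> g"
    and c: "c \<in> \<A>" and p: "p \<in> chart_dom c" and v: "v \<in> E"
  shows "differential c (\<lambda>x. f x - g x) p v = differential c f p v - differential c g p v"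
proof -
  let ?x = "chart_map c p"
  have x: "?x \<in> chart_img c" by (rule chart_map_in_img[OF p])
  have ex: "\<exists>f'. (h \<circ> chart_inv c has_derivative f') (at ?x within chart_img c)"
    if "smooth_function \<A> h" for h
    using smooth_function_in_chart[OF that c, of "Suc 0"] x unfolding Ck_on.simps by blast
  obtain f' where f': "(f \<circ> chart_inv c has_derivative f') (at ?x within chart_img c)"
    using ex[OF f] by (elim exE)
  obtain g' where g': "(g \<circ> chart_inv c has_derivative g') (at ?x within chart_img c)"
    using ex[OF g] by (elim exE)
  have "((\<lambda>y. (f \<circ> chart_inv c) y - (g \<circ> chart_inv c) y) has_derivative (\<lambda>v. f' v - g' v)) (at ?x within chart_img c)"
    by (rule has_derivative_diff[OF f' g'])
  moreover have "(\<lambda>x. f x - g x) \<circ> chart_inv c = (\<lambda>y. (f \<circ> chart_inv c) y - (g \<circ> chart_inv c) y)"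
    by auto
  ultimately have d: "((\<lambda>x. f x - g x) \<circ> chart_inv c has_derivative (\<lambda>v. f' v - g' v)) (at ?x within chart_img c)"
    by simp
  note line = has_vector_derivative_along_line(2)[OF model_subspace img_open[OF c] x v]
  show ?thesis
    unfolding differential_def line[OF d] line[OF f'] line[OF g'] ..
qed

text \<open>
  The difference has zero differential everywhere, and every point is fixed by the trivial subgroup.
\<close>
lemma locally_constant_difference:
  assumes f: "generates_flow f \<xi>" and g: "generates_flow g \<xi>"
  shows "locally_constant_on M (topspace M) (\<lambda>x. f x - g x)"
proof -
  have "fixed_points \<rho> M {1} = topspace M"
    using act_one by (auto simp: fixed_points_def)
  moreover have "locally_constant_on M (fixed_points \<rho> M {1}) (\<lambda>x. f x - g x)"
  proof (rule locally_constant_on_critical_fixed_points[OF subgroup_torus_one])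
    show "smooth_function \<A> (\<lambda>x. f x - g x)"
      unfolding smooth_function_def smooth_on_def
    proof (intro ballI allI)
      fix c k assume c: "c \<in> \<A>"
      have "Ck_on k (chart_img c) (\<lambda>y. (f \<circ> chart_inv c) y - (g \<circ> chart_inv c) y)"
        using generates_flowD(1)[OF f] generates_flowD(1)[OF g] c
        by (intro Ck_on_diff smooth_function_in_chart)
      then show "Ck_on k (chart_img c) ((\<lambda>x. f x - g x) \<circ> chart_inv c)" by (simp add: o_def)
    qed
    show "differential c (\<lambda>x. f x - g x) p v = 0"
      if "p \<in> fixed_points \<rho> M {1}" "c \<in> \<A>" "p \<in> chart_dom c" "v \<in> E" for p c v
      using differential_diff[OF generates_flowD(1)[OF f] generates_flowD(1)[OF g] that(2,3,4)]
        generates_flowD(2)[OF f that(2,3,4)] generates_flowD(2)[OF g that(2,3,4)] by simp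
  qed
  ultimately show ?thesis by simp
qed

lemma moment_map_exists:
  obtains \<mu> where "\<And>\<xi>. generates_flow (\<lambda>p. \<mu> p \<xi>) \<xi>"
    "\<And>p. p \<in> topspace M \<Longrightarrow> linear (\<mu> p)"
    "\<And>g p \<xi>. \<lbrakk>g \<in> carrier torus; p \<in> topspace M\<rbrakk> \<Longrightarrow> \<mu> (\<rho> g p) \<xi> = \<mu> p \<xi>"
proof -
  obtain \<mu> where \<mu>: "moment_map M E \<A> \<omega> \<rho> (carrier torus) \<mu>"
    using hamiltonian unfolding hamiltonian_torus_action_def by (elim conjE exE)
  show ?thesis
  proof (rule that[of \<mu>])
    show "generates_flow (\<lambda>p. \<mu> p \<xi>) \<xi>" for \<xi>
      using \<mu> unfolding moment_map_def generates_flow_def by simp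
    show "linear (\<mu> p)" if p: "p \<in> topspace M" for p
    proof -
      obtain l where l: "linear l" "\<forall>\<xi>\<in>lie_algebra (carrier torus). \<mu> p \<xi> = l \<xi>"
        using \<mu> p unfolding moment_map_def by blast
      then have "\<mu> p = l" by auto
      with l(1) show ?thesis by simp
    qed
    show "\<mu> (\<rho> g p) \<xi> = \<mu> p \<xi>" if "g \<in> carrier torus" "p \<in> topspace M" for g p \<xi>
      using \<mu> that unfolding moment_map_def by simp
  qed
qed

lemma torus_fixed_point_if_maximal:
  assumes f: "generates_flow f \<xi>" and dense: "carrier torus \<subseteq> closure (range (\<lambda>s. torus_exp (s *\<^sub>R \<xi>)))"
    and inv: "\<And>g p. \<lbrakk>g \<in> carrier torus; p \<in> topspace M\<rbrakk> \<Longrightarrow> f (\<rho> g p) = f p"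
    and H: "subgroup H torus" "closed H"
    and X: "openin (subtopology M (fixed_points \<rho> M H)) X"
    and q: "q \<in> X" and max: "\<And>z. z \<in> X \<Longrightarrow> f z \<le> f q"
  shows "q \<in> fixed_points \<rho> M (carrier torus)"
proof -
  obtain U where U: "openin M U" "X = U \<inter> fixed_points \<rho> M H"
    using X by (auto simp: openin_subtopology)
  have qH: "q \<in> fixed_points \<rho> M H" and qU: "q \<in> U" using q U by auto
  then have "q \<in> topspace M" by (simp add: fixed_points_def)
  then obtain c where c: "c \<in> \<A>" and qc: "q \<in> chart_dom c" by (rule chart_at)
  have "differential c f q v = 0" if v: "v \<in> E" for v
  proof (rule ccontr)
    assume "differential c f q v \<noteq> 0"
    then have "\<exists>z\<in>fixed_points \<rho> M H \<inter> U. f z > f q"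
      using subgroup.subset[OF H(1)]
      by (intro exists_fixed_point_with_larger_value[OF c qc H qH generates_flowD(1)[OF f] inv v _ U(1) qU]) auto
    then obtain z where "z \<in> X" "f z > f q" using U(2) by blast
    with max[of z] show False by simp
  qed
  then have "generating_field \<rho> c \<xi> q = 0"
    by (rule generating_field_zero_if_critical[OF f c qc])
  then show ?thesis by (rule torus_fixed_if_dense_direction_stationary[OF dense c qc])
qed

text \<open>
  \<open>\<alpha>\<close> stands for the restrictions of an assignment to the Lie algebra of \<open>H\<close>. The functions \<open>\<Phi>\<close> and
  \<open>\<mu>\<^sup>\<eta>\<close> differ by a locally constant function \<open>u\<close>; prescribing the value of \<open>u\<close> together with
  that of \<open>\<alpha>\<close> makes differences of \<open>\<Phi>\<close> on \<open>X\<close> equal to differences of \<open>\<mu>\<^sup>\<eta>\<close>. Replacing \<open>\<eta>\<close> by the dense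
  direction \<open>\<xi>\<close> changes values of the moment map by at most \<open>K |\<xi> - \<eta>|\<close>.
\<close>
lemma exists_torus_fixed_point_nearly_above:
  assumes \<Phi>: "generates_flow \<Phi> \<eta>"
    and H: "subgroup H torus" "closed H" and p: "p \<in> fixed_points \<rho> M H"
    and \<alpha>: "locally_constant_on M (fixed_points \<rho> M H) \<alpha>" and \<epsilon>: "\<epsilon> > 0"
  shows "\<exists>q\<in>fixed_points \<rho> M (carrier torus). \<alpha> q = \<alpha> p \<and> \<Phi> q > \<Phi> p - \<epsilon>"
proof (rule moment_map_exists)
  fix \<mu> :: "'m \<Rightarrow> real^'n \<Rightarrow> real"
  assume gen: "\<And>\<xi>. generates_flow (\<lambda>p. \<mu> p \<xi>) \<xi>"
    and lin: "\<And>p. p \<in> topspace M \<Longrightarrow> linear (\<mu> p)"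
    and inv: "\<And>g p \<xi>. \<lbrakk>g \<in> carrier torus; p \<in> topspace M\<rbrakk> \<Longrightarrow> \<mu> (\<rho> g p) \<xi> = \<mu> p \<xi>"
  let ?F = "fixed_points \<rho> M H"
  have FM: "?F \<subseteq> topspace M" by (auto simp: fixed_points_def)
  have pM: "p \<in> topspace M" using p FM by blast
  have cont: "continuous_map M euclideanreal (\<lambda>x. \<mu> x \<xi>)" for \<xi>
    by (rule continuous_map_smooth_function[OF generates_flowD(1)[OF gen]])
  have "\<exists>B. \<forall>x\<in>topspace M. \<bar>\<mu> x b\<bar> \<le> B" for b
  proof -
    have "compact ((\<lambda>x. \<mu> x b) ` topspace M)"
      using image_compactin[OF _ cont] compact by (simp add: compact_space_def)
    from compact_imp_bounded[OF this] show ?thesis by (simp add: bounded_iff)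
  qed
  then obtain B where B: "\<And>b x. x \<in> topspace M \<Longrightarrow> \<bar>\<mu> x b\<bar> \<le> B b" by metis
  define K where "K = 1 + \<bar>\<Sum>b\<in>Basis. B b\<bar>"
  have K: "K > 0" by (simp add: K_def)
  have \<mu>_bound: "\<bar>\<mu> x \<zeta>\<bar> \<le> K * norm \<zeta>" if x: "x \<in> topspace M" for x \<zeta>
  proof -
    have "\<bar>\<mu> x \<zeta>\<bar> \<le> (\<Sum>b\<in>Basis. B b) * norm \<zeta>"
      using linear_map_bounded_on_Basis[OF lin[OF x], of B \<zeta>] B[OF x] by simp
    also have "\<dots> \<le> K * norm \<zeta>" by (intro mult_right_mono) (auto simp: K_def)
    finally show ?thesis .
  qed
  obtain \<xi> where \<xi>: "norm (\<xi> - \<eta>) < \<epsilon> / (2 * K)"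
    and dense: "carrier torus \<subseteq> closure (range (\<lambda>s. torus_exp (s *\<^sub>R \<xi>)))"
    using exists_dense_one_parameter_group[of "\<epsilon> / (2 * K)" \<eta>] \<epsilon> K by auto
  define u where "u x = \<Phi> x - \<mu> x \<eta>" for x
  have "locally_constant_on M ?F u"
    using locally_constant_on_subset[OF locally_constant_difference[OF \<Phi> gen] FM] by (simp add: u_def[abs_def])
  then have loc: "locally_constant_on M ?F (\<lambda>x. (\<alpha> x, u x))" by (rule locally_constant_on_Pair[OF \<alpha>])
  \<comment> \<open>Closed and open in the fixed point set of \<open>H\<close>, hence compact.\<close>
  define X where "X = {x \<in> ?F. (\<alpha> x, u x) = (\<alpha> p, u p)}"
  have Xopen: "openin (subtopology M ?F) X"
    unfolding X_def by (rule locally_constant_on_level_set(1)[OF loc])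
  have "closedin (subtopology M ?F) X"
    unfolding X_def by (rule locally_constant_on_level_set(2)[OF loc FM])
  then have "closedin M X"
    using closedin_trans_full closedin_fixed_points[OF subgroup.subset[OF H(1)]] by blast
  then have "compactin M X" using compact closedin_compact_space by blast
  then have "compact ((\<lambda>x. \<mu> x \<xi>) ` X)" using image_compactin[OF _ cont] by simp
  moreover have pX: "p \<in> X" using p by (simp add: X_def)
  ultimately obtain q where q: "q \<in> X" and max: "\<And>z. z \<in> X \<Longrightarrow> \<mu> z \<xi> \<le> \<mu> q \<xi>"
    using compact_attains_sup[of "(\<lambda>x. \<mu> x \<xi>) ` X"] by auto
  have qM: "q \<in> topspace M" using q FM by (auto simp: X_def)
  have "q \<in> fixed_points \<rho> M (carrier torus)"
    by (rule torus_fixed_point_if_maximal[OF gen dense inv H Xopen q max])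
  moreover have "\<alpha> q = \<alpha> p" and uq: "u q = u p" using q by (auto simp: X_def)
  moreover have "\<Phi> q > \<Phi> p - \<epsilon>"
  proof -
    have split: "\<mu> x \<eta> = \<mu> x \<xi> - \<mu> x (\<xi> - \<eta>)" if "x \<in> topspace M" for x
      using linear_diff[OF lin[OF that]] by simp
    have "K * norm (\<xi> - \<eta>) < \<epsilon> / 2"
      using \<xi> K by (simp add: field_simps)
    then have "\<bar>\<mu> q (\<xi> - \<eta>)\<bar> < \<epsilon> / 2" "\<bar>\<mu> p (\<xi> - \<eta>)\<bar> < \<epsilon> / 2"
      using \<mu>_bound[OF qM, of "\<xi> - \<eta>"] \<mu>_bound[OF pM, of "\<xi> - \<eta>"] by linarith+
    then have "\<mu> q \<eta> > \<mu> p \<eta> - \<epsilon>"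
      using max[OF pX] split[OF qM] split[OF pM] by linarith
    then show ?thesis using uq unfolding u_def by linarith
  qed
  ultimately show ?thesis by blast
qed

text \<open>
  One step inside the level set of \<open>\<alpha>\<close> in \<open>M\<^sup>H\<close> strictly increases \<open>\<Phi>\<close>; this increase is taken for \<open>\<epsilon>\<close>
  in \<open>exists_torus_fixed_point_nearly_above\<close>. The step is taken with \<open>\<mu>\<^sup>\<eta>\<close>, which is invariant under the
  torus.
\<close>
lemma exists_torus_fixed_point_above:
  assumes \<Phi>: "generates_flow \<Phi> \<eta>"
    and H: "subgroup H torus" "closed H" and p: "p \<in> fixed_points \<rho> M H"
    and \<alpha>: "locally_constant_on M (fixed_points \<rho> M H) \<alpha>"
    and c: "c \<in> \<A>" and pc: "p \<in> chart_dom c" and v: "v \<in> E" "differential c \<Phi> p v \<noteq> 0"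
  shows "\<exists>q\<in>fixed_points \<rho> M (carrier torus). \<alpha> q = \<alpha> p \<and> \<Phi> q > \<Phi> p"
proof (rule moment_map_exists)
  fix \<mu> :: "'m \<Rightarrow> real^'n \<Rightarrow> real"
  assume gen: "\<And>\<xi>. generates_flow (\<lambda>p. \<mu> p \<xi>) \<xi>"
    and inv: "\<And>g p \<xi>. \<lbrakk>g \<in> carrier torus; p \<in> topspace M\<rbrakk> \<Longrightarrow> \<mu> (\<rho> g p) \<xi> = \<mu> p \<xi>"
  let ?F = "fixed_points \<rho> M H"
  have FM: "?F \<subseteq> topspace M" by (auto simp: fixed_points_def)
  define u where "u x = \<Phi> x - \<mu> x \<eta>" for x
  have "locally_constant_on M ?F u"
    using locally_constant_on_subset[OF locally_constant_difference[OF \<Phi> gen] FM] by (simp add: u_def[abs_def])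
  then have loc: "locally_constant_on M ?F (\<lambda>x. (\<alpha> x, u x))" by (rule locally_constant_on_Pair[OF \<alpha>])
  obtain U where U: "openin M U" "{x \<in> ?F. (\<alpha> x, u x) = (\<alpha> p, u p)} = U \<inter> ?F"
    using locally_constant_on_level_set(1)[OF loc, of "(\<alpha> p, u p)"] unfolding openin_subtopology by (elim exE conjE)
  have pU: "p \<in> U" using U(2) p by blast
  have "differential c (\<lambda>x. \<mu> x \<eta>) p v \<noteq> 0"
    using v generates_flowD(2)[OF \<Phi> c pc v(1)] generates_flowD(2)[OF gen c pc v(1)] by simp
  then have "\<exists>z\<in>?F \<inter> U. \<mu> z \<eta> > \<mu> p \<eta>"
    using subgroup.subset[OF H(1)]
    by (intro exists_fixed_point_with_larger_value[OF c pc H p generates_flowD(1)[OF gen] inv v(1) _ U(1) pU]) auto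
  then obtain z where z: "z \<in> ?F" "z \<in> U" "\<mu> z \<eta> > \<mu> p \<eta>" by blast
  have "\<alpha> z = \<alpha> p" "u z = u p" using U(2) z by auto
  then have "\<Phi> z > \<Phi> p" using z(3) by (simp add: u_def)
  then obtain q where "q \<in> fixed_points \<rho> M (carrier torus)" "\<alpha> q = \<alpha> z" "\<Phi> q > \<Phi> z - (\<Phi> z - \<Phi> p)"
    using exists_torus_fixed_point_nearly_above[OF \<Phi> H z(1) \<alpha>, of "\<Phi> z - \<Phi> p"] by auto
  then show ?thesis using \<open>\<alpha> z = \<alpha> p\<close> by auto
qed

end

section \<open>Assignments\<close>

lemma restrict_UNIV: "restrict f UNIV = f"
  by (simp add: restrict_def)

definition zero_polynomial :: "(real^'n) set \<Rightarrow> real^'n \<Rightarrow> real" where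
  "zero_polynomial \<h> = (\<lambda>\<xi>\<in>\<h>. 0)"

lemma zero_sym_algebra: "\<zero>\<^bsub>sym_algebra \<h>\<^esub> = zero_polynomial \<h>"
  by (simp add: sym_algebra_def zero_polynomial_def)

lemma restrict_zero_polynomial: "\<l> \<subseteq> \<h> \<Longrightarrow> restrict (zero_polynomial \<h>) \<l> = zero_polynomial \<l>"
  by (auto simp: zero_polynomial_def restrict_def fun_eq_iff)

lemma zero_polynomial_in_sym_algebra: "zero_polynomial \<h> \<in> carrier (sym_algebra \<h>)"
  by (auto simp: sym_algebra_def zero_polynomial_def intro!: exI[of _ "\<lambda>_. 0"] real_polynomial_function.intros)

context torus_manifold
begin

abbreviation isotropy :: "'m \<Rightarrow> (real^'n) set" where
  "isotropy \<equiv> isotropy_algebra \<rho>"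

text \<open>
  Allows the local constancy of an assignment to be applied with the full isotropy algebra of \<open>p\<close>.
\<close>
lemma isotropy_subtorus:
  assumes p: "p \<in> topspace M"
  obtains H where "subtorus H" "lie_algebra H = isotropy p" "p \<in> fixed_points \<rho> M H"
proof -
  let ?S = "stabilizer torus \<rho> p"
  let ?H = "closure (torus_exp ` isotropy p)"
  have "subgroup ?S torus" by (rule group_action.stabilizer_subgroup[OF action p])
  then have sub: "subspace (isotropy p)"
    unfolding isotropy_algebra_def by (rule subspace_lie_algebra)
  have "torus_exp \<xi> \<in> ?S" if "\<xi> \<in> isotropy p" for \<xi>
    using that unfolding isotropy_algebra_def lie_algebra_def by (metis (mono_tags) mem_Collect_eq scaleR_one)
  then have HS: "?H \<subseteq> ?S"
    by (intro closure_minimal closed_stabilizer p) auto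
  then have "lie_algebra ?H \<subseteq> isotropy p"
    unfolding isotropy_algebra_def lie_algebra_def by blast
  then show ?thesis
    using subtorus_closure_exp[OF sub] HS p
    by (intro that[of ?H]) (auto simp: fixed_points_def stabilizer_def)
qed

lemma lie_algebra_subset_isotropy:
  assumes "subtorus H" "p \<in> fixed_points \<rho> M H"
  shows "lie_algebra H \<subseteq> isotropy p"
proof -
  have "H \<subseteq> carrier torus" using assms(1) by (auto simp: subtorus_def dest: subgroup.subset)
  then have "H \<subseteq> stabilizer torus \<rho> p" using assms(2) by (auto simp: stabilizer_def fixed_points_def)
  then show ?thesis unfolding isotropy_algebra_def lie_algebra_def by blast
qed

lemma isotropy_torus_fixed: "q \<in> fixed_points \<rho> M (carrier torus) \<Longrightarrow> isotropy q = UNIV"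
  using lie_algebra_subset_isotropy[OF subtorus_torus, of q] by (simp add: top.extremum_unique)

lemma assignments_iff:
  "A \<in> assignments \<rho> M \<longleftrightarrow> A \<in> extensional (topspace M) \<and>
     (\<forall>p\<in>topspace M. A p \<in> carrier (sym_algebra (isotropy p))) \<and>
     (\<forall>H. subtorus H \<longrightarrow> locally_constant_on M (fixed_points \<rho> M H) (\<lambda>p. restrict (A p) (lie_algebra H)))"
  by (auto simp: assignments_def PiE_def Pi_iff)

lemma assignment_extensional:
  assumes "A \<in> assignments \<rho> M" "p \<in> topspace M"
  shows "A p \<in> extensional (isotropy p)"
  using assms by (auto simp: assignments_iff sym_algebra_def)

lemma assignment_locally_constant:
  assumes "A \<in> assignments \<rho> M" "subtorus H"
  shows "locally_constant_on M (fixed_points \<rho> M H) (\<lambda>p. restrict (A p) (lie_algebra H))"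
  using assms by (simp add: assignments_iff)

lemma assignment_eqI:
  assumes "A \<in> extensional (topspace M)" "B \<in> extensional (topspace M)"
    "\<And>p. p \<in> topspace M \<Longrightarrow> A p \<in> extensional (isotropy p)"
    "\<And>p. p \<in> topspace M \<Longrightarrow> B p \<in> extensional (isotropy p)"
    "\<And>p \<xi>. \<lbrakk>p \<in> topspace M; \<xi> \<in> isotropy p\<rbrakk> \<Longrightarrow> A p \<xi> = B p \<xi>"
  shows "A = B"
proof (rule extensionalityI[OF assms(1,2)])
  fix p assume p: "p \<in> topspace M"
  show "A p = B p" by (rule extensionalityI[OF assms(3,4)[OF p]]) (rule assms(5)[OF p])
qed

definition assignment_add ::
  "('m \<Rightarrow> real^'n \<Rightarrow> real) \<Rightarrow> ('m \<Rightarrow> real^'n \<Rightarrow> real) \<Rightarrow> 'm \<Rightarrow> real^'n \<Rightarrow> real" where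
  "assignment_add A B = (\<lambda>p\<in>topspace M. \<lambda>\<xi>\<in>isotropy p. A p \<xi> + B p \<xi>)"

definition assignment_scale ::
  "(real^'n \<Rightarrow> real) \<Rightarrow> ('m \<Rightarrow> real^'n \<Rightarrow> real) \<Rightarrow> 'm \<Rightarrow> real^'n \<Rightarrow> real" where
  "assignment_scale f A = (\<lambda>p\<in>topspace M. \<lambda>\<xi>\<in>isotropy p. f \<xi> * A p \<xi>)"

definition assignment_zero :: "'m \<Rightarrow> real^'n \<Rightarrow> real" where
  "assignment_zero = (\<lambda>p\<in>topspace M. zero_polynomial (isotropy p))"

lemma assignment_algebra_simps [simp]:
  "carrier (assignment_algebra \<rho> M) = assignments \<rho> M"
  "A \<oplus>\<^bsub>assignment_algebra \<rho> M\<^esub> B = assignment_add A B"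
  "\<zero>\<^bsub>assignment_algebra \<rho> M\<^esub> = assignment_zero"
  "f \<odot>\<^bsub>assignment_algebra \<rho> M\<^esub> A = assignment_scale f A"
  by (auto simp: assignment_algebra_def assignment_add_def assignment_scale_def assignment_zero_def
      zero_polynomial_def sym_algebra_def restrict_def fun_eq_iff)

lemma assignment_add_closed:
  assumes A: "A \<in> assignments \<rho> M" and B: "B \<in> assignments \<rho> M"
  shows "assignment_add A B \<in> assignments \<rho> M"
  unfolding assignments_iff
proof (intro conjI ballI allI impI)
  show "assignment_add A B \<in> extensional (topspace M)" by (simp add: assignment_add_def)
next
  fix p assume p: "p \<in> topspace M"
  obtain a where a: "real_polynomial_function a" "A p = restrict a (isotropy p)"
    using A p by (auto simp: assignments_iff sym_algebra_def)
  obtain b where b: "real_polynomial_function b" "B p = restrict b (isotropy p)"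
    using B p by (auto simp: assignments_iff sym_algebra_def)
  have "assignment_add A B p = restrict (\<lambda>\<xi>. a \<xi> + b \<xi>) (isotropy p)"
    using p a(2) b(2) by (auto simp: assignment_add_def)
  then show "assignment_add A B p \<in> carrier (sym_algebra (isotropy p))"
    using real_polynomial_function.intros(3)[OF a(1) b(1)] by (auto simp: sym_algebra_def)
next
  fix H :: "(complex^'n) set" assume H: "subtorus H"
  show "locally_constant_on M (fixed_points \<rho> M H) (\<lambda>p. restrict (assignment_add A B p) (lie_algebra H))"
  proof (rule locally_constant_on_compose[OF locally_constant_on_Pair[OF assignment_locally_constant[OF A H] assignment_locally_constant[OF B H]]])
    fix p assume p: "p \<in> fixed_points \<rho> M H"
    then have "p \<in> topspace M" by (simp add: fixed_points_def)
    then show "restrict (assignment_add A B p) (lie_algebra H)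
        = (\<lambda>(a, b). \<lambda>\<xi>\<in>lie_algebra H. a \<xi> + b \<xi>) (restrict (A p) (lie_algebra H), restrict (B p) (lie_algebra H))"
      using lie_algebra_subset_isotropy[OF H p] by (auto simp: assignment_add_def fun_eq_iff)
  qed
qed

lemma assignment_scale_closed:
  assumes f: "real_polynomial_function f" and A: "A \<in> assignments \<rho> M"
  shows "assignment_scale f A \<in> assignments \<rho> M"
  unfolding assignments_iff
proof (intro conjI ballI allI impI)
  show "assignment_scale f A \<in> extensional (topspace M)" by (simp add: assignment_scale_def)
next
  fix p assume p: "p \<in> topspace M"
  obtain a where a: "real_polynomial_function a" "A p = restrict a (isotropy p)"
    using A p by (auto simp: assignments_iff sym_algebra_def)
  have "assignment_scale f A p = restrict (\<lambda>\<xi>. f \<xi> * a \<xi>) (isotropy p)"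
    using p a(2) by (auto simp: assignment_scale_def)
  then show "assignment_scale f A p \<in> carrier (sym_algebra (isotropy p))"
    using real_polynomial_function.intros(4)[OF f a(1)] by (auto simp: sym_algebra_def)
next
  fix H :: "(complex^'n) set" assume H: "subtorus H"
  show "locally_constant_on M (fixed_points \<rho> M H) (\<lambda>p. restrict (assignment_scale f A p) (lie_algebra H))"
  proof (rule locally_constant_on_compose[OF assignment_locally_constant[OF A H]])
    fix p assume p: "p \<in> fixed_points \<rho> M H"
    then have "p \<in> topspace M" by (simp add: fixed_points_def)
    then show "restrict (assignment_scale f A p) (lie_algebra H)
        = (\<lambda>a. \<lambda>\<xi>\<in>lie_algebra H. f \<xi> * a \<xi>) (restrict (A p) (lie_algebra H))"
      using lie_algebra_subset_isotropy[OF H p] by (auto simp: assignment_scale_def fun_eq_iff)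
  qed
qed

lemma assignment_zero_closed: "assignment_zero \<in> assignments \<rho> M"
  unfolding assignments_iff
proof (intro conjI ballI allI impI)
  fix H :: "(complex^'n) set" assume H: "subtorus H"
  have "restrict (assignment_zero p) (lie_algebra H) = zero_polynomial (lie_algebra H)"
    if p: "p \<in> fixed_points \<rho> M H" for p
  proof -
    have "p \<in> topspace M" using p by (simp add: fixed_points_def)
    then show ?thesis
      using restrict_zero_polynomial[OF lie_algebra_subset_isotropy[OF H p]] by (simp add: assignment_zero_def)
  qed
  then show "locally_constant_on M (fixed_points \<rho> M H) (\<lambda>p. restrict (assignment_zero p) (lie_algebra H))"
    unfolding locally_constant_on_def
    by (intro ballI exI[of _ "fixed_points \<rho> M H"]) (auto simp: fixed_points_def openin_subtopology_refl)
qed (auto simp: assignment_zero_def zero_polynomial_in_sym_algebra)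

lemma group_assignments: "group (add_monoid (assignment_algebra \<rho> M))"
proof (rule groupI, simp_all)
  show "assignment_add A B \<in> assignments \<rho> M" if "A \<in> assignments \<rho> M" "B \<in> assignments \<rho> M" for A B
    using that by (rule assignment_add_closed)
  show "assignment_zero \<in> assignments \<rho> M" by (rule assignment_zero_closed)
  show "assignment_add (assignment_add A B) C = assignment_add A (assignment_add B C)" for A B C
    by (rule assignment_eqI) (auto simp: assignment_add_def)
  show "assignment_add assignment_zero A = A" if A: "A \<in> assignments \<rho> M" for A
    using A assignment_extensional[OF A]
    by (intro assignment_eqI) (auto simp: assignment_add_def assignment_zero_def zero_polynomial_def assignments_iff)
  show "\<exists>B\<in>assignments \<rho> M. assignment_add B A = assignment_zero" if A: "A \<in> assignments \<rho> M" for A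
  proof
    show "assignment_scale (\<lambda>_. -1) A \<in> assignments \<rho> M"
      by (intro assignment_scale_closed A real_polynomial_function.intros)
    show "assignment_add (assignment_scale (\<lambda>_. -1) A) A = assignment_zero"
      by (rule assignment_eqI)
         (auto simp: assignment_add_def assignment_scale_def assignment_zero_def zero_polynomial_def)
  qed
qed

text \<open>
  The kernel of the restriction map and the modules \<open>K\<^sup>+\<close> and \<open>K\<^sup>-\<close> are all of this form.
\<close>
definition vanishing_assignments :: "'m set \<Rightarrow> ('m \<Rightarrow> real^'n \<Rightarrow> real) set" where
  "vanishing_assignments P = {A \<in> assignments \<rho> M. \<forall>p\<in>P. A p = zero_polynomial (isotropy p)}"

lemma submodule_vanishing_assignments:
  assumes P: "P \<subseteq> topspace M"
  shows "submodule (vanishing_assignments P) (sym_algebra UNIV) (assignment_algebra \<rho> M)"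
proof -
  have scale: "assignment_scale f A \<in> vanishing_assignments P"
    if f: "real_polynomial_function f" and A: "A \<in> vanishing_assignments P" for f A
  proof -
    have "assignment_scale f A p = zero_polynomial (isotropy p)" if "p \<in> P" for p
      using A P that by (auto simp: vanishing_assignments_def assignment_scale_def zero_polynomial_def fun_eq_iff)
    then show ?thesis
      using assignment_scale_closed[OF f] A by (simp add: vanishing_assignments_def)
  qed
  have add: "assignment_add A B \<in> vanishing_assignments P"
    if A: "A \<in> vanishing_assignments P" and B: "B \<in> vanishing_assignments P" for A B
  proof -
    have "assignment_add A B p = zero_polynomial (isotropy p)" if "p \<in> P" for p
      using A B P that by (auto simp: vanishing_assignments_def assignment_add_def zero_polynomial_def fun_eq_iff)
    then show ?thesis
      using assignment_add_closed A B by (simp add: vanishing_assignments_def)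
  qed
  show ?thesis
  proof (intro submodule.intro subgroup.intro submodule_axioms.intro)
    show "vanishing_assignments P \<subseteq> carrier (add_monoid (assignment_algebra \<rho> M))"
      by (auto simp: vanishing_assignments_def)
    show "A \<otimes>\<^bsub>add_monoid (assignment_algebra \<rho> M)\<^esub> B \<in> vanishing_assignments P"
      if "A \<in> vanishing_assignments P" "B \<in> vanishing_assignments P" for A B
      using add[OF that] by simp
    show "\<one>\<^bsub>add_monoid (assignment_algebra \<rho> M)\<^esub> \<in> vanishing_assignments P"
      using P assignment_zero_closed by (auto simp: vanishing_assignments_def assignment_zero_def)
    show "inv\<^bsub>add_monoid (assignment_algebra \<rho> M)\<^esub> A \<in> vanishing_assignments P"
      if A: "A \<in> vanishing_assignments P" for A
    proof -
      have neg: "assignment_scale (\<lambda>_. -1) A \<in> vanishing_assignments P"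
        by (intro scale A real_polynomial_function.intros)
      moreover have "assignment_add (assignment_scale (\<lambda>_. -1) A) A = assignment_zero"
        by (rule assignment_eqI)
           (auto simp: assignment_add_def assignment_scale_def assignment_zero_def zero_polynomial_def)
      ultimately have "inv\<^bsub>add_monoid (assignment_algebra \<rho> M)\<^esub> A = assignment_scale (\<lambda>_. -1) A"
        using A by (intro group.inv_equality[OF group_assignments]) (auto simp: vanishing_assignments_def)
      with neg show ?thesis by simp
    qed
    show "f \<odot>\<^bsub>assignment_algebra \<rho> M\<^esub> A \<in> vanishing_assignments P"
      if "f \<in> carrier (sym_algebra UNIV)" "A \<in> vanishing_assignments P" for f A
      using scale[of f A] that by (auto simp: sym_algebra_def restrict_UNIV)
  qed
qed

lemma kernel_restriction:
  assumes Z: "Z \<subseteq> topspace M"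
  shows "a_kernel (assignment_algebra \<rho> M) (assignment_algebra \<rho> (subtopology M Z)) (assignment_restriction Z)
    = vanishing_assignments Z"
proof -
  have "\<zero>\<^bsub>assignment_algebra \<rho> (subtopology M Z)\<^esub> = (\<lambda>p\<in>Z. zero_polynomial (isotropy p))"
    using Z by (simp add: assignment_algebra_def zero_sym_algebra Int_absorb1)
  then show ?thesis
    by (auto simp: a_kernel_def' assignment_restriction_def vanishing_assignments_def restrict_def fun_eq_iff)
qed

text \<open>
  On the zero level of \<open>\<Phi>\<close> the two prescriptions agree, and near such a point of a fixed point set both
  restrict to zero.
\<close>
lemma cut_assignment:
  assumes A: "A \<in> assignments \<rho> M" and \<Phi>: "continuous_map M euclideanreal \<Phi>"
    and van: "\<And>p. \<lbrakk>p \<in> topspace M; \<Phi> p = 0\<rbrakk> \<Longrightarrow> A p = zero_polynomial (isotropy p)"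
  shows "(\<lambda>p\<in>topspace M. if \<Phi> p < 0 then A p else zero_polynomial (isotropy p)) \<in> assignments \<rho> M"
    (is "?B \<in> _")
  unfolding assignments_iff
proof (intro conjI ballI allI impI)
  show "?B \<in> extensional (topspace M)" by simp
  show "?B p \<in> carrier (sym_algebra (isotropy p))" if "p \<in> topspace M" for p
    using A that by (simp add: assignments_iff zero_polynomial_in_sym_algebra)
  fix H :: "(complex^'n) set" assume H: "subtorus H"
  let ?F = "fixed_points \<rho> M H" and ?\<h> = "lie_algebra H"
  have zero: "restrict (zero_polynomial (isotropy q)) ?\<h> = zero_polynomial ?\<h>" if "q \<in> ?F" for q
    by (rule restrict_zero_polynomial[OF lie_algebra_subset_isotropy[OF H that]])
  have FM: "?F \<subseteq> topspace M" by (auto simp: fixed_points_def)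
  have B: "restrict (?B q) ?\<h> = (if \<Phi> q < 0 then restrict (A q) ?\<h> else zero_polynomial ?\<h>)" if "q \<in> ?F" for q
    using zero[OF that] FM that by auto
  show "locally_constant_on M ?F (\<lambda>p. restrict (?B p) ?\<h>)"
    unfolding locally_constant_on_def
  proof
    fix p assume p: "p \<in> ?F"
    then have pM: "p \<in> topspace M" using FM by blast
    obtain U where U: "openin (subtopology M ?F) U" "p \<in> U" "\<forall>q\<in>U. restrict (A q) ?\<h> = restrict (A p) ?\<h>"
      using assignment_locally_constant[OF A H] p unfolding locally_constant_on_def by blast
    have UF: "U \<subseteq> ?F" using openin_subset[OF U(1)] by simp
    have neg: "openin (subtopology M ?F) (?F \<inter> {x \<in> topspace M. \<Phi> x \<in> {..<0}})"
      by (intro openin_subtopology_Int2 openin_continuous_map_preimage[OF \<Phi>]) simp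
    have pos: "openin (subtopology M ?F) (?F \<inter> {x \<in> topspace M. \<Phi> x \<in> {0<..}})"
      by (intro openin_subtopology_Int2 openin_continuous_map_preimage[OF \<Phi>]) simp
    consider "\<Phi> p < 0" | "\<Phi> p = 0" | "\<Phi> p > 0" by linarith
    then show "\<exists>V. openin (subtopology M ?F) V \<and> p \<in> V \<and> (\<forall>q\<in>V. restrict (?B q) ?\<h> = restrict (?B p) ?\<h>)"
    proof cases
      case 1
      let ?V = "U \<inter> (?F \<inter> {x \<in> topspace M. \<Phi> x \<in> {..<0}})"
      have "restrict (?B q) ?\<h> = restrict (?B p) ?\<h>" if "q \<in> ?V" for q
        using B[of q] B[OF p] that 1 U(3)[rule_format, of q] by simp
      moreover have "openin (subtopology M ?F) ?V" using U(1) neg by (rule openin_Int)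
      moreover have "p \<in> ?V" using U(2) p pM 1 by simp
      ultimately show ?thesis by blast
    next
      case 2
      have "restrict (A p) ?\<h> = zero_polynomial ?\<h>" using van[OF pM 2] zero[OF p] by simp
      then have "restrict (?B q) ?\<h> = restrict (?B p) ?\<h>" if "q \<in> U" for q
        using B[of q] B[OF p] that UF U(3)[rule_format, OF that] by auto
      then show ?thesis using U(1,2) by blast
    next
      case 3
      let ?V = "?F \<inter> {x \<in> topspace M. \<Phi> x \<in> {0<..}}"
      have "restrict (?B q) ?\<h> = restrict (?B p) ?\<h>" if "q \<in> ?V" for q
        using B[of q] B[OF p] that 3 by simp
      moreover have "p \<in> ?V" using p pM 3 by simp
      ultimately show ?thesis using pos by blast
    qed
  qed
qed

lemma value_on_fixed_component:
  assumes f: "locally_constant_on M (fixed_points \<rho> M (carrier torus)) f"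
    and F: "F \<in> fixed_components \<rho> M" and q: "q \<in> F"
  shows "value_on f F = f q"
proof -
  have "fixed_points \<rho> M (carrier torus) \<subseteq> topspace M" by (auto simp: fixed_points_def)
  moreover have "connectedin (subtopology M (fixed_points \<rho> M (carrier torus))) F"
    using F unfolding fixed_components_def by (rule connectedin_connected_components_of)
  ultimately have "f p = f q" if "p \<in> F" for p
    using locally_constant_on_connected[OF f _ _ that q] by blast
  then have "f ` F = {f q}" using q by blast
  then show ?thesis by (simp add: value_on_def)
qed

text \<open>
  The constant value on a component is the value at any of its points, as \<open>A\<close> and \<open>\<Phi>\<close> are locally
  constant on the fixed point set of the torus and every point of it lies in a component.
\<close>
lemma vanishing_on_components:
  assumes \<Phi>: "locally_constant_on M (fixed_points \<rho> M (carrier torus)) \<Phi>"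
  shows "{A \<in> assignments \<rho> M. \<forall>F\<in>fixed_components \<rho> M. R (value_on \<Phi> F) \<longrightarrow> value_on A F = \<zero>\<^bsub>sym_algebra UNIV\<^esub>}
    = vanishing_assignments {q \<in> fixed_points \<rho> M (carrier torus). R (\<Phi> q)}"
proof -
  let ?MT = "fixed_points \<rho> M (carrier torus)"
  have comp: "\<exists>F\<in>fixed_components \<rho> M. q \<in> F" if "q \<in> ?MT" for q
  proof -
    have "topspace (subtopology M ?MT) = ?MT" by (auto simp: fixed_points_def)
    then show ?thesis
      using that Union_connected_components_of[of "subtopology M ?MT"] unfolding fixed_components_def by blast
  qed
  have nonempty: "\<exists>q. q \<in> F \<and> q \<in> ?MT" if "F \<in> fixed_components \<rho> M" for F
    using that nonempty_connected_components_of connected_components_of_subset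
    unfolding fixed_components_def by fastforce
  have A: "locally_constant_on M ?MT A" if "A \<in> assignments \<rho> M" for A
    using assignment_locally_constant[OF that subtorus_torus] by (simp add: restrict_UNIV)
  have zero: "\<zero>\<^bsub>sym_algebra UNIV\<^esub> = zero_polynomial (isotropy q)" if "q \<in> ?MT" for q
    using isotropy_torus_fixed[OF that] by (simp add: zero_sym_algebra)
  have "(\<forall>F\<in>fixed_components \<rho> M. R (value_on \<Phi> F) \<longrightarrow> value_on A F = \<zero>\<^bsub>sym_algebra UNIV\<^esub>)
      \<longleftrightarrow> (\<forall>q\<in>?MT. R (\<Phi> q) \<longrightarrow> A q = zero_polynomial (isotropy q))" if "A \<in> assignments \<rho> M" for A
  proof (intro iffI ballI impI)
    fix q assume all: "\<forall>F\<in>fixed_components \<rho> M. R (value_on \<Phi> F) \<longrightarrow> value_on A F = \<zero>\<^bsub>sym_algebra UNIV\<^esub>"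
      and q: "q \<in> ?MT" "R (\<Phi> q)"
    obtain F where F: "F \<in> fixed_components \<rho> M" "q \<in> F" using comp[OF q(1)] by blast
    show "A q = zero_polynomial (isotropy q)"
      using all F(1) q(2) zero[OF q(1)] value_on_fixed_component[OF \<Phi> F] value_on_fixed_component[OF A[OF that] F]
      by simp
  next
    fix F assume all: "\<forall>q\<in>?MT. R (\<Phi> q) \<longrightarrow> A q = zero_polynomial (isotropy q)"
      and F: "F \<in> fixed_components \<rho> M" "R (value_on \<Phi> F)"
    obtain q where q: "q \<in> F" "q \<in> ?MT" using nonempty[OF F(1)] by blast
    show "value_on A F = \<zero>\<^bsub>sym_algebra UNIV\<^esub>"
      using all F(2) q(2) zero[OF q(2)] value_on_fixed_component[OF \<Phi> F(1) q(1)]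
        value_on_fixed_component[OF A[OF that] F(1) q(1)]
      by simp
  qed
  then show ?thesis by (auto simp: vanishing_assignments_def)
qed

lemma assignment_zero_from_torus_fixed_point:
  assumes A: "A \<in> assignments \<rho> M" and p: "p \<in> topspace M" and \<h>: "\<h> = isotropy p"
    and q: "q \<in> fixed_points \<rho> M (carrier torus)" and eq: "restrict (A q) \<h> = restrict (A p) \<h>"
    and zero: "A q = zero_polynomial (isotropy q)"
  shows "A p = zero_polynomial (isotropy p)"
proof -
  have "A p = restrict (A p) \<h>"
    using extensional_restrict[OF assignment_extensional[OF A p]] by (simp add: \<h>)
  also have "\<dots> = zero_polynomial \<h>"
    unfolding eq[symmetric] zero isotropy_torus_fixed[OF q] by (rule restrict_zero_polynomial) simp
  finally show ?thesis by (simp add: \<h>)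
qed

end

section \<open>The kernel of the restriction to the zero level\<close>

context hamiltonian_torus_manifold
begin

lemma assignment_determined_on_torus_fixed_points:
  assumes \<Phi>: "generates_flow \<Phi> \<eta>"
    and A: "A \<in> vanishing_assignments (fixed_points \<rho> M (carrier torus))"
  shows "A = assignment_zero"
proof (rule extensionalityI)
  have A': "A \<in> assignments \<rho> M" using A by (simp add: vanishing_assignments_def)
  then show "A \<in> extensional (topspace M)" by (simp add: assignments_iff)
  show "assignment_zero \<in> extensional (topspace M)" by (simp add: assignment_zero_def)
  fix p assume p: "p \<in> topspace M"
  obtain H where H: "subtorus H" "lie_algebra H = isotropy p" "p \<in> fixed_points \<rho> M H"
    by (rule isotropy_subtorus[OF p])
  have "\<exists>q\<in>fixed_points \<rho> M (carrier torus).
      restrict (A q) (lie_algebra H) = restrict (A p) (lie_algebra H) \<and> \<Phi> q > \<Phi> p - 1"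
    using H(1) by (intro exists_torus_fixed_point_nearly_above[OF \<Phi> _ _ H(3) assignment_locally_constant[OF A' H(1)]])
      (auto simp: subtorus_def)
  then obtain q where q: "q \<in> fixed_points \<rho> M (carrier torus)"
    "restrict (A q) (lie_algebra H) = restrict (A p) (lie_algebra H)" by blast
  have "A q = zero_polynomial (isotropy q)" using A q(1) by (simp add: vanishing_assignments_def)
  then show "A p = assignment_zero p"
    using assignment_zero_from_torus_fixed_point[OF A' p H(2) q] p by (simp add: assignment_zero_def)
qed

lemma assignment_vanishes_at_noncritical_point:
  assumes \<Phi>: "generates_flow \<Phi> \<eta>" and p: "p \<in> topspace M" "\<Phi> p = 0"
    and A: "A \<in> vanishing_assignments {q \<in> fixed_points \<rho> M (carrier torus). \<Phi> q > 0}"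
    and c: "c \<in> \<A>" "p \<in> chart_dom c" and v: "v \<in> E" "differential c \<Phi> p v \<noteq> 0"
  shows "A p = zero_polynomial (isotropy p)"
proof -
  have A': "A \<in> assignments \<rho> M" using A by (simp add: vanishing_assignments_def)
  obtain H where H: "subtorus H" "lie_algebra H = isotropy p" "p \<in> fixed_points \<rho> M H"
    by (rule isotropy_subtorus[OF p(1)])
  have "\<exists>q\<in>fixed_points \<rho> M (carrier torus).
      restrict (A q) (lie_algebra H) = restrict (A p) (lie_algebra H) \<and> \<Phi> q > \<Phi> p"
    using H(1) by (intro exists_torus_fixed_point_above[OF \<Phi> _ _ H(3) assignment_locally_constant[OF A' H(1)] c v])
      (auto simp: subtorus_def)
  then obtain q where q: "q \<in> fixed_points \<rho> M (carrier torus)"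
    "restrict (A q) (lie_algebra H) = restrict (A p) (lie_algebra H)" "\<Phi> q > 0" using p(2) by auto
  have "A q = zero_polynomial (isotropy q)" using A q(1,3) by (simp add: vanishing_assignments_def)
  then show ?thesis by (rule assignment_zero_from_torus_fixed_point[OF A' p(1) H(2) q(1,2)])
qed

lemma differential_minus:
  assumes f: "smooth_function \<A> f" and c: "c \<in> \<A>" and p: "p \<in> chart_dom c" and v: "v \<in> E"
  shows "differential c (\<lambda>x. - f x) p v = - differential c f p v"
proof -
  have "Ck_on k S (\<lambda>_. a)" for k and S :: "'e set" and a :: real
  proof (induction k arbitrary: a)
    case (Suc k)
    show ?case unfolding Ck_on.simps by (intro exI[of _ "\<lambda>_ _. 0"] conjI ballI allI Suc) simp
  qed simp
  then have "smooth_function \<A> (\<lambda>_. 0)" by (simp add: smooth_function_def smooth_on_def o_def)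
  from differential_diff[OF this f c p v] show ?thesis
    by (simp add: differential_def dir_deriv_def o_def)
qed

theorem kernel_is_direct_sum:
  assumes \<Phi>: "generates_flow \<Phi> \<eta>" and neg: "generates_flow (\<lambda>p. - \<Phi> p) (- \<eta>)"
    and reg: "regular_value M E \<A> \<Phi> 0"
  shows "internal_direct_sum (sym_algebra UNIV) (assignment_algebra \<rho> M)
     (a_kernel (assignment_algebra \<rho> M) (assignment_algebra \<rho> (subtopology M (zero_level M \<Phi>)))
        (assignment_restriction (zero_level M \<Phi>)))
     (K_plus \<rho> M \<Phi>) (K_minus \<rho> M \<Phi>)"
proof -
  let ?MT = "fixed_points \<rho> M (carrier torus)" and ?Z = "zero_level M \<Phi>" and ?V = "assignment_algebra \<rho> M"
  let ?P = "{q \<in> ?MT. \<Phi> q > 0}" and ?N = "{q \<in> ?MT. \<Phi> q < 0}"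
  have MT: "?MT \<subseteq> topspace M" by (auto simp: fixed_points_def)
  have ZM: "?Z \<subseteq> topspace M" by (auto simp: zero_level_def)
  have plus: "K_plus \<rho> M \<Phi> = vanishing_assignments ?P"
    unfolding K_plus_def by (rule vanishing_on_components[OF locally_constant_on_torus_fixed_points[OF \<Phi>]])
  have minus: "K_minus \<rho> M \<Phi> = vanishing_assignments ?N"
    unfolding K_minus_def by (rule vanishing_on_components[OF locally_constant_on_torus_fixed_points[OF \<Phi>]])
  have ker: "a_kernel ?V (assignment_algebra \<rho> (subtopology M ?Z)) (assignment_restriction ?Z) = vanishing_assignments ?Z"
    by (rule kernel_restriction[OF ZM])
  have noncritical: "\<exists>c v. c \<in> \<A> \<and> p \<in> chart_dom c \<and> v \<in> E \<and> differential c \<Phi> p v \<noteq> 0" if p: "p \<in> ?Z" for p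
  proof -
    have pM: "p \<in> topspace M" "\<Phi> p = 0" using p by (auto simp: zero_level_def)
    obtain c where c: "c \<in> \<A>" "p \<in> chart_dom c" by (rule chart_at[OF pM(1)])
    have "differential c \<Phi> p ` E = UNIV" using reg pM c by (simp add: regular_value_def)
    then have "1 \<in> differential c \<Phi> p ` E" by simp
    then obtain v where "v \<in> E" "differential c \<Phi> p v = 1" by (metis imageE)
    then show ?thesis using c by (intro exI[of _ c] exI[of _ v]) simp
  qed
  have nonzero: "\<Phi> q \<noteq> 0" if q: "q \<in> ?MT" for q
  proof
    assume "\<Phi> q = 0"
    then have "q \<in> ?Z" using q MT by (auto simp: zero_level_def)
    from noncritical[OF this] obtain c v where "c \<in> \<A>" "q \<in> chart_dom c" "v \<in> E" "differential c \<Phi> q v \<noteq> 0"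
      by (elim exE conjE)
    then show False using critical_if_torus_fixed[OF \<Phi> _ _ q] by blast
  qed
  have cont: "continuous_map M euclideanreal \<Phi>" "continuous_map M euclideanreal (\<lambda>p. - \<Phi> p)"
    by (rule continuous_map_smooth_function[OF generates_flowD(1)], fact \<Phi>)
       (rule continuous_map_smooth_function[OF generates_flowD(1)[OF neg]])
  have inter: "K_plus \<rho> M \<Phi> \<inter> K_minus \<rho> M \<Phi> = {\<zero>\<^bsub>?V\<^esub>}"
  proof
    show "K_plus \<rho> M \<Phi> \<inter> K_minus \<rho> M \<Phi> \<subseteq> {\<zero>\<^bsub>?V\<^esub>}"
    proof
      fix A assume "A \<in> K_plus \<rho> M \<Phi> \<inter> K_minus \<rho> M \<Phi>"
      then have A: "A \<in> assignments \<rho> M" "\<forall>q\<in>?P. A q = zero_polynomial (isotropy q)" "\<forall>q\<in>?N. A q = zero_polynomial (isotropy q)"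
        unfolding plus minus by (simp_all add: vanishing_assignments_def)
      have "A q = zero_polynomial (isotropy q)" if "q \<in> ?MT" for q
        using A(2,3) that nonzero[OF that] by (cases "\<Phi> q > 0") auto
      then have "A \<in> vanishing_assignments ?MT" using A(1) by (simp add: vanishing_assignments_def)
      then show "A \<in> {\<zero>\<^bsub>?V\<^esub>}" using assignment_determined_on_torus_fixed_points[OF \<Phi>] by simp
    qed
    show "{\<zero>\<^bsub>?V\<^esub>} \<subseteq> K_plus \<rho> M \<Phi> \<inter> K_minus \<rho> M \<Phi>"
      unfolding plus minus using MT assignment_zero_closed
      by (auto simp: vanishing_assignments_def assignment_zero_def)
  qed
  have sub_plus: "K_plus \<rho> M \<Phi> \<subseteq> vanishing_assignments ?Z"
  proof
    fix A assume A: "A \<in> K_plus \<rho> M \<Phi>"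
    have "A p = zero_polynomial (isotropy p)" if p: "p \<in> ?Z" for p
    proof -
      obtain c v where cv: "c \<in> \<A>" "p \<in> chart_dom c" "v \<in> E" "differential c \<Phi> p v \<noteq> 0"
        using noncritical[OF p] by (elim exE conjE)
      show ?thesis
        using p A[unfolded plus] by (intro assignment_vanishes_at_noncritical_point[OF \<Phi> _ _ _ cv]) (auto simp: zero_level_def)
    qed
    then show "A \<in> vanishing_assignments ?Z" using A by (simp add: plus vanishing_assignments_def)
  qed
  have sub_minus: "K_minus \<rho> M \<Phi> \<subseteq> vanishing_assignments ?Z"
  proof
    fix A assume A: "A \<in> K_minus \<rho> M \<Phi>"
    have "A p = zero_polynomial (isotropy p)" if p: "p \<in> ?Z" for p
    proof -
      obtain c v where cv: "c \<in> \<A>" "p \<in> chart_dom c" "v \<in> E" "differential c \<Phi> p v \<noteq> 0"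
        using noncritical[OF p] by (elim exE conjE)
      have "differential c (\<lambda>p. - \<Phi> p) p v \<noteq> 0"
        using cv(4) differential_minus[OF generates_flowD(1)[OF \<Phi>] cv(1,2,3)] by simp
      then show ?thesis
        using p A[unfolded minus]
        by (intro assignment_vanishes_at_noncritical_point[OF neg _ _ _ cv(1,2,3)]) (auto simp: zero_level_def)
    qed
    then show "A \<in> vanishing_assignments ?Z" using A by (simp add: minus vanishing_assignments_def)
  qed
  have sum: "vanishing_assignments ?Z = K_plus \<rho> M \<Phi> <+>\<^bsub>?V\<^esub> K_minus \<rho> M \<Phi>"
  proof
    show "K_plus \<rho> M \<Phi> <+>\<^bsub>?V\<^esub> K_minus \<rho> M \<Phi> \<subseteq> vanishing_assignments ?Z"
    proof
      fix A assume "A \<in> K_plus \<rho> M \<Phi> <+>\<^bsub>?V\<^esub> K_minus \<rho> M \<Phi>"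
      then obtain B C where BC: "B \<in> K_plus \<rho> M \<Phi>" "C \<in> K_minus \<rho> M \<Phi>" "A = B \<oplus>\<^bsub>?V\<^esub> C"
        by (auto simp: set_add_def')
      have "subgroup (vanishing_assignments ?Z) (add_monoid ?V)"
        by (rule submodule.axioms(1)[OF submodule_vanishing_assignments[OF ZM]])
      from subgroup.m_closed[OF this, of B C] show "A \<in> vanishing_assignments ?Z"
        using BC sub_plus sub_minus by auto
    qed
    show "vanishing_assignments ?Z \<subseteq> K_plus \<rho> M \<Phi> <+>\<^bsub>?V\<^esub> K_minus \<rho> M \<Phi>"
    proof
      fix A assume A: "A \<in> vanishing_assignments ?Z"
      then have A': "A \<in> assignments \<rho> M" by (simp add: vanishing_assignments_def)
      have van: "A p = zero_polynomial (isotropy p)" if "p \<in> topspace M" "\<Phi> p = 0" for p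
        using A that by (simp add: vanishing_assignments_def zero_level_def)
      define B where "B = (\<lambda>p\<in>topspace M. if \<Phi> p < 0 then A p else zero_polynomial (isotropy p))"
      define C where "C = (\<lambda>p\<in>topspace M. if - \<Phi> p < 0 then A p else zero_polynomial (isotropy p))"
      have "B \<in> assignments \<rho> M"
        unfolding B_def by (rule cut_assignment[OF A' cont(1) van])
      then have B: "B \<in> K_plus \<rho> M \<Phi>"
        unfolding plus using MT by (auto simp: vanishing_assignments_def B_def)
      have "C \<in> assignments \<rho> M"
        unfolding C_def by (rule cut_assignment[OF A' cont(2)]) (simp_all add: van)
      then have C: "C \<in> K_minus \<rho> M \<Phi>"
        unfolding minus using MT by (auto simp: vanishing_assignments_def C_def)
      have "A = assignment_add B C"
      proof (rule assignment_eqI)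
        show "A \<in> extensional (topspace M)" using A' by (simp add: assignments_iff)
        fix p \<xi> assume p: "p \<in> topspace M" "\<xi> \<in> isotropy p"
        then show "A p \<xi> = assignment_add B C p \<xi>"
          using van[OF p(1)] by (auto simp: assignment_add_def B_def C_def zero_polynomial_def)
      qed (use assignment_extensional[OF A'] in \<open>auto simp: assignment_add_def\<close>)
      then show "A \<in> K_plus \<rho> M \<Phi> <+>\<^bsub>?V\<^esub> K_minus \<rho> M \<Phi>"
        using B C by (auto simp: set_add_def')
    qed
  qed
  have "submodule (K_plus \<rho> M \<Phi>) (sym_algebra UNIV) ?V" "submodule (K_minus \<rho> M \<Phi>) (sym_algebra UNIV) ?V"
    unfolding plus minus by (rule submodule_vanishing_assignments; use MT in auto)+
  then show ?thesis
    using inter sum by (simp only: internal_direct_sum_def ker)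
qed

end

theorem theorem8p11:
  fixes M :: "'m topology"
    and E :: "'e::euclidean_space set"
    and \<A> :: "('m, 'e) chart set"
    and \<omega> :: "('m, 'e) form2"
    and \<rho> :: "complex^'n \<Rightarrow> 'm \<Rightarrow> 'm"
    and Q :: "(complex^'n) set"
    and g :: "real^'n \<Rightarrow> real^'n \<Rightarrow> real"
    and \<eta> :: "real^'n"
    and \<Phi> :: "'m \<Rightarrow> real"
  assumes "symplectic_manifold M E \<A> \<omega>"
    and "compact_space M"
    and "hamiltonian_torus_action M E \<A> \<omega> \<rho>"
    and "circle_subgroup Q"
    and "inner_product g"
    and "circle_moment_map M E \<A> \<omega> \<rho> Q g \<eta> \<Phi>"
    and "regular_value M E \<A> \<Phi> 0"
  shows "internal_direct_sum (sym_algebra UNIV) (assignment_algebra \<rho> M)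
           (a_kernel (assignment_algebra \<rho> M)
              (assignment_algebra \<rho> (subtopology M (zero_level M \<Phi>)))
              (assignment_restriction (zero_level M \<Phi>)))
           (K_plus \<rho> M \<Phi>) (K_minus \<rho> M \<Phi>)"
proof -
  interpret symplectic_manifold M E \<A> \<omega> by fact
  interpret hamiltonian_torus_manifold M E \<A> \<omega> \<rho>
    by unfold_locales (use assms(2,3) in \<open>simp_all add: hamiltonian_torus_action_def\<close>)
  have \<eta>: "\<eta> \<in> lie_algebra Q" "g \<eta> \<eta> = 1"
    and mm: "moment_map M E \<A> \<omega> \<rho> Q (\<lambda>p \<xi>. \<Phi> p * g \<eta> \<xi>)"
    using assms(6) by (simp_all add: circle_moment_map_def)
  have "subgroup Q torus" using assms(4) by (simp add: circle_subgroup_def subtorus_def)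
  then have neg_\<eta>: "- \<eta> \<in> lie_algebra Q"
    using subspace_neg[OF subspace_lie_algebra \<eta>(1)] by simp
  have "bilinear g" using assms(5) by (simp add: inner_product_def)
  then have "g \<eta> (- \<eta>) = - 1" using bilinear_rneg \<eta>(2) by metis
  moreover have flow: "generates_flow (\<lambda>p. \<Phi> p * g \<eta> \<xi>) \<xi>" if "\<xi> \<in> lie_algebra Q" for \<xi>
    using mm that unfolding moment_map_def generates_flow_def by simp
  ultimately have "generates_flow \<Phi> \<eta>" "generates_flow (\<lambda>p. - \<Phi> p) (- \<eta>)"
    using flow[OF \<eta>(1)] flow[OF neg_\<eta>] \<eta>(2) by simp_all
  then show ?thesis using assms(7) by (rule kernel_is_direct_sum)
qed

end
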